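(* Let $S$ be a (finite) connected $\mathscr R$-trivial semigroup. For each $X\in\Lambda(S)$ fix an idempotent $f_X\in S$ with $Sf_X=X$. For $X,Y\in\Lambda(S)$, let $Z_{X,Y}$ be the complement, in the set $f_YSf_X/{\sim_{X,Y}}$ of $\sim_{X,Y}$-classes, of the $\sim_{X,Y}$-class containing $I_YI_X\cap f_YSf_X$, if $I_YI_X$ is nonempty; otherwise let $Z_{X,Y}=f_YSf_X/{\sim_{X,Y}}$. Let $Q(S)$ be a quiver with vertex set $\Lambda(S)$ in which the number of arrows from $X$ to $Y$ is \[|Q(S)_1(X,Y)|=\begin{cases}|Z_{X,Y}|, & \text{if } X \text{ and } Y \text{ are incomparable},\\ |Z_{X,Y}|-1, & \text{if } X \text{ and } Y \text{ are comparable}.\end{cases}\] Then $\mathbb ZS\cong \mathbb ZQ(S)/I$ for some admissible ideal $I$ of $\mathbb ZQ(S)$. Consequently, for any field $k$, we have $kS\cong kQ(S)/(k\otimes I)$, and $k\otimes I$ is an admissible ideal of $kQ(S)$.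
   Context: All semigroups are finite. $S^1$ denotes $S$ with an adjoined identity. Write $s\leq_{\mathscr R}t$ iff $sS^1\subseteq tS^1$; $S$ is $\mathscr R$-trivial if $\leq_{\mathscr R}$ is a partial order. For $s\in S$, $s^\omega$ denotes the unique idempotent power of $s$. For $S$ $\mathscr R$-trivial, $\Lambda(S)$ is the set of left ideals of the form $Se$ with $e\in S$ idempotent, ordered by inclusion; it is closed under intersection, hence is a meet semilattice, and $c\colon S\to\Lambda(S)$, $c(s)=Ss^\omega$, is a surjective homomorphism ($c(st)=c(s)\cap c(t)$). An $\mathscr R$-trivial semigroup $S$ is connected if $s\in sS$ for all $s\in S$ and the equivalence relation $\{(s,t): c(s)=c(t)\}$ is the equivalence relation generated by all pairs $(s,t)$ such that $c(s)=c(t)$ and there is $x\in S$ with $xs=s$ and $xt=t$. For $Z\in\Lambda(S)$, $I_Z=\{s\in S: c(s)\ngeq Z\}$ (a two-sided ideal if nonempty), and $I_YI_X=\{ab: a\in I_Y, b\in I_X\}$. For $X,Y\in\Lambda(S)$, $\sim_{X,Y}$ is the least equivalence relation on $f_YSf_X$ such that: (1) $f_Ystf_X\sim_{X,Y}f_Ysf_X$ whenever $s,t\in S$ with $c(s)\ngeq Y$ and $c(t)\geq X$; (2) $s\sim_{X,Y}t$ whenever $s,t\in I_YI_X\cap f_YSf_X$. Elements $X,Y\in\Lambda(S)$ are comparable if $X\leq Y$ or $Y\leq X$ (in particular if $X=Y$). A quiver $Q$ is a finite directed graph (multiple edges and loops allowed) with vertex set $Q_0$ and edge set $Q_1$; $Q_1(v,w)$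 is the set of edges from $v$ to $w$. For a commutative ring $k$ with unit, the path algebra $kQ$ has $k$-basis the directed paths in $Q$, including an empty path at each vertex; paths are composed from right to left, with $pq$ the concatenation if the source of $p$ is the target of $q$, and $pq=0$ otherwise. The arrow ideal $J_k$ is the ideal with basis all paths of positive length. An ideal $I$ of $kQ$ is admissible if there is $n\geq 2$ with $J_k^n\subseteq I\subseteq J_k^2$ and $kQ/I$ is projective over $k$. For an admissible ideal $I$ of $\mathbb ZQ$, the quotient $\mathbb ZQ/I$ is free abelian, so $k\otimes I$ ($\otimes$ over $\mathbb Z$) is identified with its image in $k\otimes\mathbb ZQ\cong kQ$. $kS$ denotes the semigroup algebra. *)

theory Defs
  imports
    "HOL-Algebra.QuotRing"
    "HOL-Algebra.Ideal_Product"
    "HOL-Algebra.Module"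
    "HOL-Library.Poly_Mapping"
    "Graph_Theory.Arc_Walk"
begin

section \<open>Finite R-trivial semigroups\<close>

text \<open>
  A (nonempty) finite semigroup is a type of sort \<open>{semigroup_mult, finite}\<close>.
\<close>

definition is_idempotent :: "'a::semigroup_mult \<Rightarrow> bool" where
  "is_idempotent e \<longleftrightarrow> e * e = e"

text \<open>The class has no unit, hence no powers; \<open>((*) s ^^ n) s\<close> is the power of \<open>s\<close> with exponent \<open>n + 1\<close>.\<close>

definition omega :: "'a::{semigroup_mult,finite} \<Rightarrow> 'a" where
  "omega s = (THE e. is_idempotent e \<and> (\<exists>n. e = ((*) s ^^ n) s))"

text \<open>\<open>s S\<^sup>1\<close>, where \<open>S\<^sup>1\<close> is \<open>S\<close> with an adjoined identity, is \<open>{s} \<union> s S\<close>.\<close>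

definition right_ideal1 :: "'a::semigroup_mult \<Rightarrow> 'a set" where
  "right_ideal1 s = insert s {s * x | x. True}"

definition R_le :: "'a::semigroup_mult rel" where
  "R_le = {(s, t). right_ideal1 s \<subseteq> right_ideal1 t}"

definition R_trivial :: "'a::{semigroup_mult,finite} itself \<Rightarrow> bool" where
  "R_trivial _ \<longleftrightarrow> partial_order_on UNIV (R_le :: 'a rel)"

definition left_ideal :: "'a::semigroup_mult \<Rightarrow> 'a set" where
  "left_ideal s = {x * s | x. True}"

text \<open>\<open>\<Lambda>(S)\<close>; its order is inclusion.\<close>

definition Lam :: "'a::semigroup_mult set set" where
  "Lam = {left_ideal e | e. is_idempotent e}"

definition content :: "'a::{semigroup_mult,finite} \<Rightarrow> 'a set" where
  "content s = left_ideal (omega s)"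

definition generated_equiv :: "'a set \<Rightarrow> 'a rel \<Rightarrow> 'a rel" where
  "generated_equiv A r = \<Inter> {e. equiv A e \<and> r \<subseteq> e}"

definition connected_R_trivial :: "'a::{semigroup_mult,finite} itself \<Rightarrow> bool" where
  "connected_R_trivial _ \<longleftrightarrow>
     R_trivial TYPE('a) \<and>
     (\<forall>s::'a. \<exists>x. s = s * x) \<and>
     {(s::'a, t). content s = content t} =
       generated_equiv UNIV
         {(s, t). content s = content t \<and> (\<exists>x. x * s = s \<and> x * t = t)}"


section \<open>The arrow counts\<close>

definition I_ideal :: "'a::{semigroup_mult,finite} set \<Rightarrow> 'a set" where
  "I_ideal Z = {s. \<not> Z \<subseteq> content s}"

definition I_prod :: "'a::{semigroup_mult,finite} set \<Rightarrow> 'a set \<Rightarrow> 'a set" where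
  "I_prod Y X = {a * b | a b. a \<in> I_ideal Y \<and> b \<in> I_ideal X}"

text \<open>\<open>f\<^sub>Y S f\<^sub>X\<close>, for a choice \<open>f\<close> of idempotents. From here on the arguments are in the order \<open>X Y\<close>.\<close>

definition corner :: "('a::semigroup_mult set \<Rightarrow> 'a) \<Rightarrow> 'a set \<Rightarrow> 'a set \<Rightarrow> 'a set" where
  "corner f X Y = {f Y * s * f X | s. True}"

definition corner_rel ::
  "('a::{semigroup_mult,finite} set \<Rightarrow> 'a) \<Rightarrow> 'a set \<Rightarrow> 'a set \<Rightarrow> 'a rel" where
  "corner_rel f X Y = generated_equiv (corner f X Y)
     ({(f Y * s * t * f X, f Y * s * f X) | s t. \<not> Y \<subseteq> content s \<and> X \<subseteq> content t} \<union>
      {(s, t). s \<in> I_prod Y X \<inter> corner f X Y \<and> t \<in> I_prod Y X \<inter> corner f X Y})"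

definition Z_set ::
  "('a::{semigroup_mult,finite} set \<Rightarrow> 'a) \<Rightarrow> 'a set \<Rightarrow> 'a set \<Rightarrow> 'a set set" where
  "Z_set f X Y =
     (if I_prod Y X \<noteq> {}
      then {C \<in> corner f X Y // corner_rel f X Y. \<not> I_prod Y X \<inter> corner f X Y \<subseteq> C}
      else corner f X Y // corner_rel f X Y)"

text \<open>
  \<open>Q\<close> is a quiver \<open>Q(S)\<close>. The arrow count is stated in \<open>int\<close>, so that the subtraction
  is not truncated.
\<close>

definition is_quiver_of ::
  "('a::{semigroup_mult,finite} set \<Rightarrow> 'a) \<Rightarrow> ('a set, 'e) pre_digraph \<Rightarrow> bool" where
  "is_quiver_of f Q \<longleftrightarrow>
     fin_digraph Q \<and> verts Q = Lam \<and>
     (\<forall>X \<in> Lam. \<forall>Y \<in> Lam.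
        int (card {e \<in> arcs Q. tail Q e = X \<and> head Q e = Y}) =
          (if X \<subseteq> Y \<or> Y \<subseteq> X then int (card (Z_set f X Y)) - 1
           else int (card (Z_set f X Y))))"


section \<open>Algebras over a commutative ring\<close>

text \<open>
  The base ring is a type of class \<open>comm_ring_1\<close>; algebras over it are \<open>module\<close> records
  (rings with a scalar multiplication). Elements of algebras with a basis are finitely
  supported functions on the basis.
\<close>

abbreviation scale :: "'k::comm_ring_1 \<Rightarrow> ('b \<Rightarrow>\<^sub>0 'k) \<Rightarrow> ('b \<Rightarrow>\<^sub>0 'k)" where
  "scale c v \<equiv> Poly_Mapping.map ((*) c) v"

text \<open>
  A semigroup algebra need not be unital; the field \<open>one\<close> is the two-sided identity
  if there is one, and is unspecified otherwise.
\<close>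

definition semigroup_mult_ext ::
  "('a::semigroup_mult \<Rightarrow>\<^sub>0 'k::comm_ring_1) \<Rightarrow> ('a \<Rightarrow>\<^sub>0 'k) \<Rightarrow> ('a \<Rightarrow>\<^sub>0 'k)" where
  "semigroup_mult_ext a b =
     (\<Sum>s \<in> Poly_Mapping.keys a. \<Sum>t \<in> Poly_Mapping.keys b.
        Poly_Mapping.single (s * t) (Poly_Mapping.lookup a s * Poly_Mapping.lookup b t))"

definition semigroup_algebra :: "('k::comm_ring_1, 'a::semigroup_mult \<Rightarrow>\<^sub>0 'k) module" where
  "semigroup_algebra =
     \<lparr> carrier = UNIV,
       mult = semigroup_mult_ext,
       one = (THE u. \<forall>x. semigroup_mult_ext u x = x \<and> semigroup_mult_ext x u = x),
       zero = 0,
       add = (+),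
       smult = scale \<rparr>"

text \<open>
  A path is a triple (source, list of arcs in the order of traversal, target).
  The product \<open>p q\<close> traverses \<open>q\<close> first, so its list of arcs is that of \<open>q\<close> followed by that of \<open>p\<close>.
\<close>

type_synonym ('v, 'e) path = "'v \<times> 'e list \<times> 'v"

definition paths :: "('v, 'e) pre_digraph \<Rightarrow> ('v, 'e) path set" where
  "paths Q = {(u, p, v). pre_digraph.awalk Q u p v}"

fun path_mult :: "('v, 'e) path \<Rightarrow> ('v, 'e) path \<Rightarrow> (('v, 'e) path \<Rightarrow>\<^sub>0 'k::comm_ring_1)" where
  "path_mult (u, p, v) (u', q, v') =
     (if u = v' then Poly_Mapping.single (u', q @ p, v) 1 else 0)"

definition path_algebra ::
  "('v, 'e) pre_digraph \<Rightarrow> ('k::comm_ring_1, ('v, 'e) path \<Rightarrow>\<^sub>0 'k) module" where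
  "path_algebra Q =
     \<lparr> carrier = {a. Poly_Mapping.keys a \<subseteq> paths Q},
       mult = (\<lambda>a b. \<Sum>p \<in> Poly_Mapping.keys a. \<Sum>q \<in> Poly_Mapping.keys b.
         scale (Poly_Mapping.lookup a p * Poly_Mapping.lookup b q) (path_mult p q)),
       one = (\<Sum>v \<in> verts Q. Poly_Mapping.single (v, [], v) 1),
       zero = 0,
       add = (+),
       smult = scale \<rparr>"

definition arrow_ideal :: "('v, 'e) pre_digraph \<Rightarrow> (('v, 'e) path \<Rightarrow>\<^sub>0 'k::comm_ring_1) set" where
  "arrow_ideal Q = {a. Poly_Mapping.keys a \<subseteq> {(u, p, v) \<in> paths Q. p \<noteq> []}}"

primrec ideal_power :: "('b, 'x) ring_scheme \<Rightarrow> 'b set \<Rightarrow> nat \<Rightarrow> 'b set" where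
  "ideal_power A J 0 = carrier A"
| "ideal_power A J (Suc n) = ideal_prod A (ideal_power A J n) J"

text \<open>\<open>A Quot I\<close> together with the scalar multiplication induced on cosets (cf. \<open>rcoset_mult\<close>).\<close>

definition quotient_algebra :: "('k, 'b, 'x) module_scheme \<Rightarrow> 'b set \<Rightarrow> ('k, 'b set) module" where
  "quotient_algebra A I =
     \<lparr> carrier = carrier (A Quot I),
       mult = mult (A Quot I),
       one = one (A Quot I),
       zero = zero (A Quot I),
       add = add (A Quot I),
       smult = (\<lambda>c C. \<Union>a\<in>C. I +>\<^bsub>A\<^esub> (c \<odot>\<^bsub>A\<^esub> a)) \<rparr>"

definition algebra_isomorphic ::
  "('k, 'b, 'x) module_scheme \<Rightarrow> ('k, 'c, 'y) module_scheme \<Rightarrow> bool" where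
  "algebra_isomorphic A B \<longleftrightarrow>
     (\<exists>h \<in> ring_iso A B. \<forall>c. \<forall>x \<in> carrier A. h (c \<odot>\<^bsub>A\<^esub> x) = c \<odot>\<^bsub>B\<^esub> h x)"

text \<open>
  \<open>M\<close> is projective if it is (up to isomorphism) a direct summand, i.e. a linear retract,
  of a free module. The free module on the elements of \<open>M\<close> suffices here: if \<open>M\<close> is a retract of
  any free module, then the canonical surjection from the free module on the elements of \<open>M\<close>
  splits.
\<close>

definition projective_module :: "('k::comm_ring_1, 'm, 'x) module_scheme \<Rightarrow> bool" where
  "projective_module M \<longleftrightarrow>
     (\<exists>(i :: 'm \<Rightarrow> ('m \<Rightarrow>\<^sub>0 'k)) (r :: ('m \<Rightarrow>\<^sub>0 'k) \<Rightarrow> 'm).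
        (\<forall>x \<in> carrier M. \<forall>y \<in> carrier M. i (x \<oplus>\<^bsub>M\<^esub> y) = i x + i y) \<and>
        (\<forall>c. \<forall>x \<in> carrier M. i (c \<odot>\<^bsub>M\<^esub> x) = scale c (i x)) \<and>
        (\<forall>v. r v \<in> carrier M) \<and>
        (\<forall>v w. r (v + w) = r v \<oplus>\<^bsub>M\<^esub> r w) \<and>
        (\<forall>c v. r (scale c v) = c \<odot>\<^bsub>M\<^esub> r v) \<and>
        (\<forall>x \<in> carrier M. r (i x) = x))"

definition admissible ::
  "('v, 'e) pre_digraph \<Rightarrow> (('v, 'e) path \<Rightarrow>\<^sub>0 'k::comm_ring_1) set \<Rightarrow> bool" where
  "admissible Q I \<longleftrightarrow>
     ideal I (path_algebra Q) \<and>
     (\<exists>n\<ge>2. ideal_power (path_algebra Q) (arrow_ideal Q) n \<subseteq> I) \<and>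
     I \<subseteq> ideal_power (path_algebra Q) (arrow_ideal Q) 2 \<and>
     projective_module (quotient_algebra (path_algebra Q) I)"

text \<open>
  The image of \<open>k \<otimes> I\<close> in \<open>k \<otimes> \<int>Q \<cong> kQ\<close>, i.e. the set of all \<open>k\<close>-linear combinations
  of the images of the elements of \<open>I\<close>.
\<close>

definition extend_scalars :: "('p \<Rightarrow>\<^sub>0 int) set \<Rightarrow> ('p \<Rightarrow>\<^sub>0 'k::comm_ring_1) set" where
  "extend_scalars I =
     {\<Sum>a\<in>A. scale (c a) (Poly_Mapping.map of_int a) | A c. finite A \<and> A \<subseteq> I}"

end

theory Submission
  imports Defs
begin

text \<open>
  In an \<open>R\<close>-trivial semigroup the content of \<open>s\<close> is \<open>{x. x s = x}\<close>, so the characters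
  \<open>chi X\<close>, which send \<open>s\<close> to 1 if \<open>X \<subseteq> content s\<close> and to 0 otherwise, are multiplicative. Their common
  kernel \<open>rad\<close> is spanned by the differences \<open>s - t\<close> of elements of equal content. Right multiplication
  by such a difference kills \<open>x\<close> or moves it strictly down in the \<open>R\<close>-order; hence \<open>rad\<close> is nilpotent, and
  the Moebius elements of \<open>\<int>\<Lambda>(S)\<close> lift over \<open>\<int>\<close> to orthogonal idempotents \<open>e X\<close>. Their sum is a right unit
  because \<open>s \<in> s S\<close>. It is a left unit because, by connectedness, \<open>rad\<close> is already spanned by the differences
  \<open>s - t\<close> with \<open>x s = s\<close> and \<open>x t = t\<close> for some \<open>x\<close>.

  The map \<open>n \<mapsto> f\<^sub>Y n f\<^sub>X\<close> induces an isomorphism from \<open>e Y (rad / rad\<^sup>2) e X\<close> onto the free abelian group on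
  \<open>Z\<^sub>X\<^sub>Y\<close> if \<open>X\<close> and \<open>Y\<close> are incomparable. If they are comparable, the image is the kernel of the functional given by
  \<open>chi (X \<inter> Y)\<close>, of rank one less. Sending the arrows to lifts of a basis yields a homomorphism
  from \<open>\<int>Q\<close> that is onto by nilpotency, and its kernel lies in the square of the arrow ideal because
  the images of the arrows are independent modulo \<open>rad\<^sup>2\<close>. Any such presentation is determined by the images of the
  paths, and reading those images over another ring \<open>k\<close> gives a presentation with kernel \<open>k \<otimes> I\<close>.
\<close>

section \<open>Linear and bilinear extension\<close>

text \<open>Two obstacles shape the proof. Over the integers, counting ranks does not exclude
  torsion in \<open>rad\<close> modulo \<open>rad2\<close>. The coordinates \<open>psi\<close> are
  therefore explicit functionals that vanish on \<open>rad2\<close>, and the elements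
  \<open>lift\<close> are dual to them; generation and independence both come from this pair.
  Moreover, multiplication by \<open>rad\<close> is known to lower the R-order only from the right,
  and there is no unit at the start. Hence idempotents are lifted by polynomials without constant
  term, and until a left unit is found nilpotency only says that \<open>x * a = 0\<close> for all
  \<open>x\<close>.

  The two clauses of the relation on \<open>f Y * s * f X\<close> record products of two elements of
  \<open>rad\<close>: \<open>(e Y * gen (f Y * s)) * (gen (t * f X) * e X - gen (f X) * e X)\<close>
  for the first, \<open>(e Y * gen a) * (gen b * e X)\<close> for the second. One arrow is lost for
  comparable X and Y because \<open>chi (X \<inter> Y)\<close> is then constant on the classes and
  gives a linear condition on \<open>rad\<close>. If X and Y are incomparable, \<open>w * w\<close>
  lies in \<open>I_prod Y X\<close> for each w in the corner and has the content of w, so content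
  imposes no such condition.\<close>

lemma lookup_scale [simp]: "Poly_Mapping.lookup (scale c v) x = c * Poly_Mapping.lookup v x"
  by transfer (auto simp: when_def)

lemma scale_add [simp]: "scale c (v + w) = scale c v + scale c w"
  by (rule poly_mapping_eqI) (simp add: lookup_add algebra_simps)

lemma scale_add_left: "scale (c + d) v = scale c v + scale d v"
  by (rule poly_mapping_eqI) (simp add: lookup_add algebra_simps)

lemma scale_scale [simp]: "scale c (scale d v) = scale (c * d) v"
  by (rule poly_mapping_eqI) (simp add: algebra_simps)

lemma scale_0_right [simp]: "scale c 0 = 0"
  by (rule poly_mapping_eqI) simp

lemma scale_0_left [simp]: "scale 0 v = 0"
  by (rule poly_mapping_eqI) simp

lemma scale_1 [simp]: "scale 1 v = v"
  by (rule poly_mapping_eqI) simp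

lemma scale_single [simp]: "scale c (Poly_Mapping.single x d) = Poly_Mapping.single x (c * d)"
  by (rule poly_mapping_eqI) (simp add: lookup_single when_def)

lemma scale_sum: "scale c (\<Sum>x\<in>A. g x) = (\<Sum>x\<in>A. scale c (g x))"
  by (rule poly_mapping_eqI) (simp add: lookup_sum sum_distrib_left)

lemma keys_scale: "Poly_Mapping.keys (scale c v) \<subseteq> Poly_Mapping.keys v"
  by (auto simp: in_keys_iff)

definition linear_pm :: "(('b \<Rightarrow>\<^sub>0 'k::comm_ring_1) \<Rightarrow> ('c \<Rightarrow>\<^sub>0 'k)) \<Rightarrow> bool" where
  "linear_pm F \<longleftrightarrow> (\<forall>a b. F (a + b) = F a + F b) \<and> (\<forall>c a. F (scale c a) = scale c (F a))"

lemma linear_pm_add: "linear_pm F \<Longrightarrow> F (a + b) = F a + F b"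
  and linear_pm_scale: "linear_pm F \<Longrightarrow> F (scale c a) = scale c (F a)"
  by (auto simp: linear_pm_def)

lemma linear_pm_0: "linear_pm F \<Longrightarrow> F 0 = 0"
  using linear_pm_scale[of F 0 0] by simp

lemma linear_pm_minus: "linear_pm F \<Longrightarrow> F (a - b) = F a - F b"
  using linear_pm_add[of F "a - b" b] by (simp add: algebra_simps)

lemma linear_pm_sum: "linear_pm F \<Longrightarrow> F (\<Sum>x\<in>A. g x) = (\<Sum>x\<in>A. F (g x))"
  by (induction A rule: infinite_finite_induct) (auto simp: linear_pm_0 linear_pm_add)

lemma linear_pm_comp: "linear_pm F \<Longrightarrow> linear_pm G \<Longrightarrow> linear_pm (\<lambda>a. F (G a))"
  by (simp add: linear_pm_def)

lemma sum_single_expand: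
  assumes "finite A" "Poly_Mapping.keys a \<subseteq> A"
  shows "a = (\<Sum>p\<in>A. scale (Poly_Mapping.lookup a p) (Poly_Mapping.single p 1))"
proof (rule poly_mapping_eqI)
  fix k
  have "(\<Sum>p\<in>A. if p = k then Poly_Mapping.lookup a p else 0) = Poly_Mapping.lookup a k"
    using assms by (auto simp: in_keys_iff)
  then show "Poly_Mapping.lookup a k =
    Poly_Mapping.lookup (\<Sum>p\<in>A. scale (Poly_Mapping.lookup a p) (Poly_Mapping.single p 1)) k"
    by (simp add: lookup_sum lookup_single when_def)
qed

text \<open>Only the support of \<open>a\<close> is tested: elements of the path algebra live in a
  type whose basis also contains triples that are not paths, and the identities to be checked may
  fail there.\<close>

lemma linear_pm_eqI:
  assumes "linear_pm F" "linear_pm G"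
    and "\<And>p. p \<in> Poly_Mapping.keys a \<Longrightarrow> F (Poly_Mapping.single p 1) = G (Poly_Mapping.single p 1)"
  shows "F a = G a"
proof -
  let ?e = "\<Sum>p\<in>Poly_Mapping.keys a. scale (Poly_Mapping.lookup a p) (Poly_Mapping.single p 1)"
  have "F ?e = G ?e"
    unfolding linear_pm_sum[OF assms(1)] linear_pm_sum[OF assms(2)]
      linear_pm_scale[OF assms(1)] linear_pm_scale[OF assms(2)]
    by (intro sum.cong refl arg_cong[where f = "scale _"] assms(3))
  then show ?thesis
    unfolding sum_single_expand[OF finite_keys subset_refl, symmetric] .
qed

definition lin_ext :: "('b \<Rightarrow> ('c \<Rightarrow>\<^sub>0 'k::comm_ring_1)) \<Rightarrow> ('b \<Rightarrow>\<^sub>0 'k) \<Rightarrow> ('c \<Rightarrow>\<^sub>0 'k)" where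
  "lin_ext \<phi> a = (\<Sum>p\<in>Poly_Mapping.keys a. scale (Poly_Mapping.lookup a p) (\<phi> p))"

lemma lin_ext_superset:
  assumes "finite A" "Poly_Mapping.keys a \<subseteq> A"
  shows "lin_ext \<phi> a = (\<Sum>p\<in>A. scale (Poly_Mapping.lookup a p) (\<phi> p))"
  unfolding lin_ext_def using assms by (intro sum.mono_neutral_left) (auto simp: in_keys_iff)

lemma lin_ext_linear: "linear_pm (lin_ext \<phi>)"
proof -
  have "lin_ext \<phi> (a + b) = lin_ext \<phi> a + lin_ext \<phi> b" for a b
  proof -
    let ?A = "Poly_Mapping.keys a \<union> Poly_Mapping.keys b"
    have "Poly_Mapping.keys (a + b) \<subseteq> ?A" by (rule keys_add)
    then show ?thesis
      by (simp add: lin_ext_superset[of ?A] lookup_add scale_add_left sum.distrib)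
  qed
  moreover have "lin_ext \<phi> (scale c a) = scale c (lin_ext \<phi> a)" for c a
    using keys_scale[of c a]
    by (simp add: lin_ext_superset[of "Poly_Mapping.keys a"] scale_sum)
  ultimately show ?thesis by (simp add: linear_pm_def)
qed

lemma lin_ext_single [simp]: "lin_ext \<phi> (Poly_Mapping.single p c) = scale c (\<phi> p)"
  by (simp add: lin_ext_superset[of "{p}"])

lemma keys_sum_subset:
  "Poly_Mapping.keys (\<Sum>x\<in>A. g x) \<subseteq> (\<Union>x\<in>A. Poly_Mapping.keys (g x))"
proof (induction A rule: infinite_finite_induct)
  case (insert x F)
  then show ?case using keys_add[of "g x" "sum g F"] by auto
qed auto

lemma keys_lin_ext: "Poly_Mapping.keys (lin_ext \<phi> a) \<subseteq> (\<Union>p\<in>Poly_Mapping.keys a. Poly_Mapping.keys (\<phi> p))"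
  unfolding lin_ext_def using keys_sum_subset keys_scale by fastforce

text \<open>The products of path algebras and of semigroup algebras both unfold to this form, so
  distributivity, associativity and multiplicativity of linear maps are proved once for
  both.\<close>

definition bilin_ext ::
  "('b \<Rightarrow> 'c \<Rightarrow> ('d \<Rightarrow>\<^sub>0 'k::comm_ring_1)) \<Rightarrow> ('b \<Rightarrow>\<^sub>0 'k) \<Rightarrow> ('c \<Rightarrow>\<^sub>0 'k) \<Rightarrow> ('d \<Rightarrow>\<^sub>0 'k)" where
  "bilin_ext \<beta> a b = (\<Sum>p\<in>Poly_Mapping.keys a. \<Sum>q\<in>Poly_Mapping.keys b.
     scale (Poly_Mapping.lookup a p * Poly_Mapping.lookup b q) (\<beta> p q))"

lemma bilin_ext_left: "bilin_ext \<beta> a b = lin_ext (\<lambda>p. lin_ext (\<beta> p) b) a"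
  by (simp add: bilin_ext_def lin_ext_def scale_sum)

lemma bilin_ext_right: "bilin_ext \<beta> a b = lin_ext (\<lambda>q. lin_ext (\<lambda>p. \<beta> p q) a) b"
  by (simp add: bilin_ext_def lin_ext_def scale_sum mult.commute sum.swap[of _ "Poly_Mapping.keys b"])

lemma linear_bilin_ext_left: "linear_pm (\<lambda>a. bilin_ext \<beta> a b)"
  unfolding bilin_ext_left by (rule lin_ext_linear)

lemma linear_bilin_ext_right: "linear_pm (\<lambda>b. bilin_ext \<beta> a b)"
  unfolding bilin_ext_right by (rule lin_ext_linear)

lemmas bilin_ext_simps =
  linear_pm_add[OF linear_bilin_ext_left] linear_pm_add[OF linear_bilin_ext_right]
  linear_pm_scale[OF linear_bilin_ext_left] linear_pm_scale[OF linear_bilin_ext_right]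
  linear_pm_minus[OF linear_bilin_ext_left] linear_pm_minus[OF linear_bilin_ext_right]
  linear_pm_0[OF linear_bilin_ext_left] linear_pm_0[OF linear_bilin_ext_right]

lemma bilin_ext_single [simp]:
  "bilin_ext \<beta> (Poly_Mapping.single p c) (Poly_Mapping.single q d) = scale (c * d) (\<beta> p q)"
  by (simp add: bilin_ext_left)

lemma keys_bilin_ext:
  "Poly_Mapping.keys (bilin_ext \<beta> a b) \<subseteq>
   (\<Union>p\<in>Poly_Mapping.keys a. \<Union>q\<in>Poly_Mapping.keys b. Poly_Mapping.keys (\<beta> p q))"
  unfolding bilin_ext_left by (rule order_trans[OF keys_lin_ext UN_mono[OF subset_refl keys_lin_ext]])

text \<open>Both sides are linear in each argument; the three arguments are replaced by basis
  elements one at a time, from the right.\<close>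

lemma bilin_ext_assoc:
  assumes "\<And>p q r. p \<in> Poly_Mapping.keys a \<Longrightarrow> q \<in> Poly_Mapping.keys b \<Longrightarrow> r \<in> Poly_Mapping.keys c \<Longrightarrow>
    bilin_ext \<beta> (\<beta> p q) (Poly_Mapping.single r 1) = bilin_ext \<beta> (Poly_Mapping.single p 1) (\<beta> q r)"
  shows "bilin_ext \<beta> (bilin_ext \<beta> a b) c = bilin_ext \<beta> a (bilin_ext \<beta> b c)"
proof (rule linear_pm_eqI[where a = c and F = "\<lambda>c. bilin_ext \<beta> (bilin_ext \<beta> a b) c"
      and G = "\<lambda>c. bilin_ext \<beta> a (bilin_ext \<beta> b c)"])
  fix r assume r: "r \<in> Poly_Mapping.keys c"
  show "bilin_ext \<beta> (bilin_ext \<beta> a b) (Poly_Mapping.single r 1) =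
        bilin_ext \<beta> a (bilin_ext \<beta> b (Poly_Mapping.single r 1))"
  proof (rule linear_pm_eqI[where a = b
        and F = "\<lambda>b. bilin_ext \<beta> (bilin_ext \<beta> a b) (Poly_Mapping.single r 1)"
        and G = "\<lambda>b. bilin_ext \<beta> a (bilin_ext \<beta> b (Poly_Mapping.single r 1))"])
    fix q assume q: "q \<in> Poly_Mapping.keys b"
    show "bilin_ext \<beta> (bilin_ext \<beta> a (Poly_Mapping.single q 1)) (Poly_Mapping.single r 1) =
          bilin_ext \<beta> a (bilin_ext \<beta> (Poly_Mapping.single q 1) (Poly_Mapping.single r 1))"
      by (rule linear_pm_eqI[where a = a
          and F = "\<lambda>a. bilin_ext \<beta> (bilin_ext \<beta> a (Poly_Mapping.single q 1)) (Poly_Mapping.single r 1)"])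
        (simp_all add: linear_bilin_ext_left linear_bilin_ext_right linear_pm_comp[OF linear_bilin_ext_left]
            linear_pm_comp[OF linear_bilin_ext_right] assms q r)
  qed (simp_all add: linear_bilin_ext_left linear_bilin_ext_right linear_pm_comp[OF linear_bilin_ext_left]
            linear_pm_comp[OF linear_bilin_ext_right])
qed (simp_all add: linear_bilin_ext_left linear_bilin_ext_right linear_pm_comp[OF linear_bilin_ext_left]
            linear_pm_comp[OF linear_bilin_ext_right])

lemma lin_ext_mult_hom:
  assumes "\<And>p q. p \<in> Poly_Mapping.keys a \<Longrightarrow> q \<in> Poly_Mapping.keys b \<Longrightarrow>
    lin_ext \<phi> (\<beta> p q) = bilin_ext \<gamma> (\<phi> p) (\<phi> q)"
  shows "lin_ext \<phi> (bilin_ext \<beta> a b) = bilin_ext \<gamma> (lin_ext \<phi> a) (lin_ext \<phi> b)"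
proof (rule linear_pm_eqI[where a = b and F = "\<lambda>b. lin_ext \<phi> (bilin_ext \<beta> a b)"
      and G = "\<lambda>b. bilin_ext \<gamma> (lin_ext \<phi> a) (lin_ext \<phi> b)"])
  fix q assume q: "q \<in> Poly_Mapping.keys b"
  show "lin_ext \<phi> (bilin_ext \<beta> a (Poly_Mapping.single q 1)) =
      bilin_ext \<gamma> (lin_ext \<phi> a) (lin_ext \<phi> (Poly_Mapping.single q 1))"
    by (rule linear_pm_eqI[where a = a and F = "\<lambda>a. lin_ext \<phi> (bilin_ext \<beta> a (Poly_Mapping.single q 1))"
      and G = "\<lambda>a. bilin_ext \<gamma> (lin_ext \<phi> a) (lin_ext \<phi> (Poly_Mapping.single q 1))"])
      (simp_all add: assms q lin_ext_linear linear_bilin_ext_left linear_bilin_ext_right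
          linear_pm_comp[OF lin_ext_linear] linear_pm_comp[OF linear_bilin_ext_left lin_ext_linear])
qed (simp_all add: lin_ext_linear linear_bilin_ext_left linear_bilin_ext_right
          linear_pm_comp[OF lin_ext_linear] linear_pm_comp[OF linear_bilin_ext_right lin_ext_linear])


section \<open>Path algebras and semigroup algebras as rings\<close>

lemma path_algebra_simps [simp]:
  "carrier (path_algebra Q) = {a. Poly_Mapping.keys a \<subseteq> paths Q}"
  "mult (path_algebra Q) = bilin_ext path_mult"
  "zero (path_algebra Q) = 0"
  "add (path_algebra Q) = (+)"
  "smult (path_algebra Q) = scale"
  by (simp_all add: path_algebra_def bilin_ext_def fun_eq_iff)

lemma one_path_algebra:
  "one (path_algebra Q) = (\<Sum>v \<in> verts Q. Poly_Mapping.single (v, [], v) 1)"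
  by (simp add: path_algebra_def)

text \<open>Unlike the pattern-matching equation, this form rewrites products of paths that are not
  written as triples.\<close>

lemma path_mult_eq:
  "path_mult p q = (if fst p = snd (snd q)
     then Poly_Mapping.single (fst q, fst (snd q) @ fst (snd p), snd (snd p)) 1 else 0)"
  by (cases "(p, q)" rule: path_mult.cases) simp

lemma path_mult_assoc:
  "bilin_ext path_mult (bilin_ext path_mult a b) c = bilin_ext path_mult a (bilin_ext path_mult b c)"
  by (rule bilin_ext_assoc) (simp add: path_mult_eq bilin_ext_simps)

lemma paths_Nil_iff [simp]: "(u, [], v) \<in> paths Q \<longleftrightarrow> u = v \<and> u \<in> verts Q"
  by (auto simp: paths_def pre_digraph.awalk_def pre_digraph.cas.simps)

lemma (in wf_digraph) paths_Cons_iff: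
  "(u, e # p, v) \<in> paths G \<longleftrightarrow> e \<in> arcs G \<and> u = tail G e \<and> (head G e, p, v) \<in> paths G"
  by (auto simp: paths_def awalk_Cons_iff)

lemma (in wf_digraph) paths_append:
  "(u, p, v) \<in> paths G \<Longrightarrow> (v, q, w) \<in> paths G \<Longrightarrow> (u, p @ q, w) \<in> paths G"
  by (auto simp: paths_def intro: awalk_appendI)

lemma (in wf_digraph) paths_verts: "(u, p, v) \<in> paths G \<Longrightarrow> u \<in> verts G \<and> v \<in> verts G"
  by (auto simp: paths_def awalk_last_in_verts awalk_hd_in_verts)

lemma (in fin_digraph) ring_path_algebra: "ring (path_algebra G :: ('k::comm_ring_1, _) module)"
proof (rule ringI)
  let ?A = "path_algebra G :: ('k, _) module"
  have one_l: "bilin_ext path_mult (one ?A) a = a" if "Poly_Mapping.keys a \<subseteq> paths G" for a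
  proof (rule linear_pm_eqI[where a = a and F = "\<lambda>a. bilin_ext path_mult (one ?A) a" and G = "\<lambda>a. a"])
    fix p assume "p \<in> Poly_Mapping.keys a"
    then have "p \<in> paths G" using that by auto
    moreover obtain u q v where p: "p = (u, q, v)" by (cases p)
    ultimately have v: "v \<in> verts G" using paths_verts by auto
    have "bilin_ext path_mult (one ?A) (Poly_Mapping.single p 1) =
        (\<Sum>w\<in>verts G. if w = v then Poly_Mapping.single p 1 else 0)"
      by (simp add: one_path_algebra linear_pm_sum[OF linear_bilin_ext_left] p if_distrib cong: if_cong)
    also have "\<dots> = Poly_Mapping.single p 1" using v by simp
    finally show "bilin_ext path_mult (one ?A) (Poly_Mapping.single p 1) = Poly_Mapping.single p 1" .
  qed (simp_all add: linear_bilin_ext_right, simp add: linear_pm_def)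
  have one_r: "bilin_ext path_mult a (one ?A) = a" if "Poly_Mapping.keys a \<subseteq> paths G" for a
  proof (rule linear_pm_eqI[where a = a and F = "\<lambda>a. bilin_ext path_mult a (one ?A)" and G = "\<lambda>a. a"])
    fix p assume "p \<in> Poly_Mapping.keys a"
    then have "p \<in> paths G" using that by auto
    moreover obtain u q v where p: "p = (u, q, v)" by (cases p)
    ultimately have v: "u \<in> verts G" using paths_verts by auto
    have "bilin_ext path_mult (Poly_Mapping.single p 1) (one ?A) =
        (\<Sum>w\<in>verts G. if u = w then Poly_Mapping.single p 1 else 0)"
      by (simp add: one_path_algebra linear_pm_sum[OF linear_bilin_ext_right] p if_distrib cong: if_cong)
    also have "\<dots> = Poly_Mapping.single p 1" using v by simp
    finally show "bilin_ext path_mult (Poly_Mapping.single p 1) (one ?A) = Poly_Mapping.single p 1" .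
  qed (simp_all add: linear_bilin_ext_left, simp add: linear_pm_def)
  have closed: "Poly_Mapping.keys (bilin_ext path_mult a b) \<subseteq> paths G"
    if "Poly_Mapping.keys a \<subseteq> paths G" "Poly_Mapping.keys b \<subseteq> paths G"
    for a b :: "('a, 'b) path \<Rightarrow>\<^sub>0 'k"
    using keys_bilin_ext[of path_mult a b] that
    by (force simp: path_mult_eq intro: paths_append split: if_splits)
  have one_c: "Poly_Mapping.keys (one ?A) \<subseteq> paths G"
    using keys_sum_subset[of "\<lambda>v. Poly_Mapping.single (v, [], v) (1::'k)" "verts G"]
    by (auto simp: one_path_algebra)
  show "monoid ?A"
    by (rule monoidI) (simp_all add: closed one_c one_l one_r path_mult_assoc)
  show "abelian_group ?A"
  proof (rule abelian_groupI)
    fix x y :: "('a, 'b) path \<Rightarrow>\<^sub>0 'k" assume "x \<in> carrier ?A" "y \<in> carrier ?A"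
    then show "x \<oplus>\<^bsub>?A\<^esub> y \<in> carrier ?A" using keys_add[of x y] by auto
  next
    fix x assume "x \<in> carrier ?A"
    then show "\<exists>y\<in>carrier ?A. y \<oplus>\<^bsub>?A\<^esub> x = \<zero>\<^bsub>?A\<^esub>" by (intro bexI[of _ "- x"]) auto
  qed (simp_all add: ac_simps)
  show "(x \<oplus>\<^bsub>?A\<^esub> y) \<otimes>\<^bsub>?A\<^esub> z = x \<otimes>\<^bsub>?A\<^esub> z \<oplus>\<^bsub>?A\<^esub> y \<otimes>\<^bsub>?A\<^esub> z"
    "z \<otimes>\<^bsub>?A\<^esub> (x \<oplus>\<^bsub>?A\<^esub> y) = z \<otimes>\<^bsub>?A\<^esub> x \<oplus>\<^bsub>?A\<^esub> z \<otimes>\<^bsub>?A\<^esub> y" for x y z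
    by (simp_all add: bilin_ext_simps)
qed

lemma ideal_prod_sum:
  fixes M :: "('k::comm_ring_1, 'b \<Rightarrow>\<^sub>0 'k) module"
  assumes "add M = (+)" "0 \<in> ideal_prod M I J" "\<And>x. x \<in> A \<Longrightarrow> g x \<in> ideal_prod M I J"
  shows "(\<Sum>x\<in>A. g x) \<in> ideal_prod M I J"
  using assms(3)
proof (induction A rule: infinite_finite_induct)
  case (insert x F)
  then have "g x \<oplus>\<^bsub>M\<^esub> sum g F \<in> ideal_prod M I J" by (intro ideal_prod.sum) auto
  with insert show ?case by (simp add: assms(1))
qed (auto simp: assms(2))

text \<open>A path with at least n + 1 arcs splits after its first arc. As products read from right
  to left, this arc is the right factor, taken from \<open>arrow_ideal\<close>, and the rest of the
  path is the left factor. Admissibility thereby becomes a condition on lengths.\<close>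

lemma (in wf_digraph) ideal_power_arrow_ideal:
  "ideal_power (path_algebra G :: ('k::comm_ring_1, _) module) (arrow_ideal G) n =
   {a. Poly_Mapping.keys a \<subseteq> {(u, p, v) \<in> paths G. n \<le> length p}}"
proof (induction n)
  case 0
  then show ?case by auto
next
  case (Suc n)
  let ?A = "path_algebra G :: ('k, _) module"
  let ?L = "\<lambda>n. {(u, p, v) \<in> paths G. n \<le> length p}"
  show ?case
  proof (intro equalityI subsetI)
    fix x assume "x \<in> ideal_power ?A (arrow_ideal G) (Suc n)"
    then have "x \<in> ideal_prod ?A {a. Poly_Mapping.keys a \<subseteq> ?L n} (arrow_ideal G)"
      using Suc by simp
    then show "x \<in> {a. Poly_Mapping.keys a \<subseteq> ?L (Suc n)}"
    proof (induction rule: ideal_prod.induct)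
      case (prod i j)
      have j: "(u, p, v) \<in> paths G \<and> length p \<ge> 1" if "(u, p, v) \<in> Poly_Mapping.keys j" for u p v
        using prod(2) that by (cases p) (auto simp: arrow_ideal_def)
      have i: "(u, p, v) \<in> paths G \<and> length p \<ge> n" if "(u, p, v) \<in> Poly_Mapping.keys i" for u p v
        using prod(1) that by auto
      show ?case
      proof
        have "(u, p, v) \<in> ?L (Suc n)" if uv: "(u, p, v) \<in> Poly_Mapping.keys (bilin_ext path_mult i j)" for u p v
        proof -
          obtain a b c a' b' where *: "(a, b, c) \<in> Poly_Mapping.keys i" "(a', b', a) \<in> Poly_Mapping.keys j"
            "u = a'" "p = b' @ b" "v = c"
            using subsetD[OF keys_bilin_ext uv] by (force simp: path_mult_eq split: if_splits)
          show ?thesis using i[OF *(1)] j[OF *(2)] * by (auto intro: paths_append)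
        qed
        then show "Poly_Mapping.keys (i \<otimes>\<^bsub>?A\<^esub> j) \<subseteq> ?L (Suc n)" by auto
      qed
    next
      case (sum s1 s2)
      then show ?case using keys_add[of s1 s2] by auto
    qed
  next
    fix x :: "('a, 'b) path \<Rightarrow>\<^sub>0 'k" assume x: "x \<in> {a. Poly_Mapping.keys a \<subseteq> ?L (Suc n)}"
    let ?P = "ideal_prod ?A {a. Poly_Mapping.keys a \<subseteq> ?L n} (arrow_ideal G)"
    have z: "0 \<in> ?P"
      using ideal_prod.prod[of 0 "{a. Poly_Mapping.keys a \<subseteq> ?L n}" 0 "arrow_ideal G" ?A]
      by (simp add: bilin_ext_simps arrow_ideal_def)
    have "scale (Poly_Mapping.lookup x q) (Poly_Mapping.single q 1) \<in> ?P"
      if q: "q \<in> Poly_Mapping.keys x" for q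
    proof -
      obtain u b p v where p: "q = (u, b # p, v)" "(u, b # p, v) \<in> paths G" "n \<le> length p"
        using q x by (cases q; cases "fst (snd q)") auto
      have h: "b \<in> arcs G" "u = tail G b" "(head G b, p, v) \<in> paths G"
        using p(2) by (auto simp: paths_Cons_iff)
      have 1: "Poly_Mapping.single (u, [b], head G b) 1 \<in> (arrow_ideal G :: (('a, 'b) path \<Rightarrow>\<^sub>0 'k) set)"
        using h by (auto simp: arrow_ideal_def paths_Cons_iff)
      have 2: "Poly_Mapping.single (head G b, p, v) (Poly_Mapping.lookup x q) \<in>
        {a. Poly_Mapping.keys a \<subseteq> ?L n}"
        using h p by auto
      show ?thesis using ideal_prod.prod[OF 2 1, of ?A] by (simp add: p(1))
    qed
    then have "(\<Sum>q\<in>Poly_Mapping.keys x. scale (Poly_Mapping.lookup x q) (Poly_Mapping.single q 1)) \<in> ?P"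
      by (intro ideal_prod_sum z) auto
    then have "x \<in> ?P"
      unfolding sum_single_expand[OF finite_keys subset_refl, symmetric] .
    then show "x \<in> ideal_power ?A (arrow_ideal G) (Suc n)"
      using Suc by simp
  qed
qed

lemma semigroup_mult_ext_eq:
  "semigroup_mult_ext = bilin_ext (\<lambda>s t. Poly_Mapping.single (s * t) 1)"
  by (simp add: semigroup_mult_ext_def bilin_ext_def fun_eq_iff)

lemma semigroup_mult_ext_assoc:
  "semigroup_mult_ext (semigroup_mult_ext a b) c = semigroup_mult_ext a (semigroup_mult_ext b c)"
  unfolding semigroup_mult_ext_eq by (rule bilin_ext_assoc) (simp add: mult.assoc)

lemma semigroup_algebra_simps [simp]:
  "carrier semigroup_algebra = UNIV"
  "mult semigroup_algebra = semigroup_mult_ext"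
  "zero semigroup_algebra = 0"
  "add semigroup_algebra = (+)"
  "smult semigroup_algebra = scale"
  by (simp_all add: semigroup_algebra_def)

lemma one_semigroup_algebra:
  assumes "\<And>x. semigroup_mult_ext u x = x" "\<And>x. semigroup_mult_ext x u = x"
  shows "one semigroup_algebra = u"
  unfolding semigroup_algebra_def using assms by (auto intro!: the_equality) (metis assms)

text \<open>The field \<open>one\<close> is a definite description, so the ring axioms are available
  only once a two-sided unit has been exhibited.\<close>

lemma ring_semigroup_algebra:
  fixes u :: "'a::semigroup_mult \<Rightarrow>\<^sub>0 'k::comm_ring_1"
  assumes "\<And>x. semigroup_mult_ext u x = x" "\<And>x. semigroup_mult_ext x u = x"
  shows "ring (semigroup_algebra :: ('k, 'a \<Rightarrow>\<^sub>0 'k) module)"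
proof (rule ringI)
  let ?A = "semigroup_algebra :: ('k, 'a \<Rightarrow>\<^sub>0 'k) module"
  note one = one_semigroup_algebra[of u, OF assms]
  show "monoid ?A"
    by (rule monoidI) (simp_all add: one assms semigroup_mult_ext_assoc)
  show "abelian_group ?A"
  proof (rule abelian_groupI)
    fix x assume "x \<in> carrier ?A"
    then show "\<exists>y\<in>carrier ?A. y \<oplus>\<^bsub>?A\<^esub> x = \<zero>\<^bsub>?A\<^esub>" by (intro bexI[of _ "- x"]) auto
  qed (simp_all add: ac_simps)
  show "(x \<oplus>\<^bsub>?A\<^esub> y) \<otimes>\<^bsub>?A\<^esub> z = x \<otimes>\<^bsub>?A\<^esub> z \<oplus>\<^bsub>?A\<^esub> y \<otimes>\<^bsub>?A\<^esub> z"
    "z \<otimes>\<^bsub>?A\<^esub> (x \<oplus>\<^bsub>?A\<^esub> y) = z \<otimes>\<^bsub>?A\<^esub> x \<oplus>\<^bsub>?A\<^esub> z \<otimes>\<^bsub>?A\<^esub> y" for x y z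
    by (simp_all add: bilin_ext_simps semigroup_mult_ext_eq)
qed


section \<open>Presentations by path algebras\<close>

text \<open>Evaluates the scalar multiplication on cosets, which is defined as a union over all
  representatives.\<close>

lemma UN_constant_on: "a \<in> C \<Longrightarrow> (\<And>x. x \<in> C \<Longrightarrow> F x = D) \<Longrightarrow> (\<Union>x\<in>C. F x) = D"
  by blast

text \<open>First isomorphism theorem, read backwards: the isomorphism sends \<open>b\<close> to its
  fibre under \<open>h\<close>, and the fibres of \<open>h\<close> are exactly the cosets of the
  kernel.\<close>

lemma algebra_isomorphic_quotient_kernel:
  fixes A :: "('k, 'b, 'x) module_scheme" and B :: "('k, 'c, 'y) module_scheme"
  assumes "ring_hom_ring A B h" and surj: "h ` carrier A = carrier B"
    and closed: "\<And>c a. a \<in> carrier A \<Longrightarrow> c \<odot>\<^bsub>A\<^esub> a \<in> carrier A"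
    and lin: "\<And>c a. a \<in> carrier A \<Longrightarrow> h (c \<odot>\<^bsub>A\<^esub> a) = c \<odot>\<^bsub>B\<^esub> h a"
  shows "algebra_isomorphic B (quotient_algebra A (a_kernel A B h))"
proof -
  interpret ring_hom_ring A B h by fact
  let ?I = "a_kernel A B h" and ?g = "\<lambda>b. {x \<in> carrier A. h x = b}"
  let ?M = "quotient_algebra A ?I"
  interpret I: ideal ?I A by (rule kernel_is_ideal)
  have fib: "?g (h a) = ?I +>\<^bsub>A\<^esub> a" if "a \<in> carrier A" for a
    using rcos_eq_homeq[OF that] by simp
  have lift: "\<exists>a\<in>carrier A. b = h a" if "b \<in> carrier B" for b
    using that surj by blast
  have iso: "?g \<in> ring_iso B ?M"
  proof (rule ring_iso_memI)
    fix b assume "b \<in> carrier B"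
    then obtain a where a: "a \<in> carrier A" "b = h a" using lift by blast
    then show "?g b \<in> carrier ?M"
      using fib[OF a(1)] by (auto simp: quotient_algebra_def FactRing_def A_RCOSETS_def')
  next
    fix b b' assume "b \<in> carrier B" "b' \<in> carrier B"
    then obtain a a' where a: "a \<in> carrier A" "b = h a" "a' \<in> carrier A" "b' = h a'"
      using lift by metis
    have "?g (b \<otimes>\<^bsub>B\<^esub> b') = ?g (h (a \<otimes>\<^bsub>A\<^esub> a'))" using a by simp
    also have "\<dots> = ?I +>\<^bsub>A\<^esub> (a \<otimes>\<^bsub>A\<^esub> a')" using a by (intro fib) simp
    also have "\<dots> = ?g b \<otimes>\<^bsub>?M\<^esub> ?g b'"
      unfolding a fib[OF a(1)] fib[OF a(3)]
      by (simp add: quotient_algebra_def FactRing_def I.rcoset_mult_add[OF a(1,3)])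
    finally show "?g (b \<otimes>\<^bsub>B\<^esub> b') = ?g b \<otimes>\<^bsub>?M\<^esub> ?g b'" .
    have "?g (b \<oplus>\<^bsub>B\<^esub> b') = ?g (h (a \<oplus>\<^bsub>A\<^esub> a'))" using a by simp
    also have "\<dots> = ?I +>\<^bsub>A\<^esub> (a \<oplus>\<^bsub>A\<^esub> a')" using a by (intro fib) simp
    also have "\<dots> = ?g b \<oplus>\<^bsub>?M\<^esub> ?g b'"
      unfolding a fib[OF a(1)] fib[OF a(3)]
      by (simp add: quotient_algebra_def FactRing_def I.a_rcos_sum[OF a(1,3)])
    finally show "?g (b \<oplus>\<^bsub>B\<^esub> b') = ?g b \<oplus>\<^bsub>?M\<^esub> ?g b'" .
  next
    show "?g \<one>\<^bsub>B\<^esub> = \<one>\<^bsub>?M\<^esub>"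
      using fib[of "\<one>\<^bsub>A\<^esub>"] by (simp add: quotient_algebra_def FactRing_def)
  next
    show "bij_betw ?g (carrier B) (carrier ?M)"
    proof (rule bij_betw_imageI)
      show "inj_on ?g (carrier B)"
        using lift by (auto simp: inj_on_def)
      show "?g ` carrier B = carrier ?M"
      proof (intro equalityI subsetI)
        fix x assume "x \<in> ?g ` carrier B"
        then obtain a where "a \<in> carrier A" "x = ?g (h a)" using lift by blast
        then show "x \<in> carrier ?M"
          using fib[of a] by (auto simp: quotient_algebra_def FactRing_def A_RCOSETS_def')
      next
        fix x assume "x \<in> carrier ?M"
        then obtain a where "a \<in> carrier A" "x = ?I +>\<^bsub>A\<^esub> a"
          by (auto simp: quotient_algebra_def FactRing_def A_RCOSETS_def')
        then show "x \<in> ?g ` carrier B"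
          using fib[of a] by (intro image_eqI[of _ _ "h a"]) auto
      qed
    qed
  qed
  have smult: "?g (c \<odot>\<^bsub>B\<^esub> b) = c \<odot>\<^bsub>?M\<^esub> ?g b" if b: "b \<in> carrier B" for b c
  proof -
    obtain a where a: "a \<in> carrier A" "b = h a" using lift[OF b] by blast
    have "?I +>\<^bsub>A\<^esub> (c \<odot>\<^bsub>A\<^esub> x) = ?g (c \<odot>\<^bsub>B\<^esub> b)" if "x \<in> ?g b" for x
    proof -
      have x: "x \<in> carrier A" "h x = b" using that by auto
      show ?thesis using fib[OF closed[OF x(1), of c]] unfolding lin[OF x(1)] x(2) by (rule sym)
    qed
    moreover have "a \<in> ?g b" using a by simp
    ultimately show ?thesis
      unfolding quotient_algebra_def module.simps by (intro UN_constant_on[symmetric])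
  qed
  show ?thesis
    unfolding algebra_isomorphic_def by (rule bexI[OF _ iso]) (intro allI ballI smult)
qed

text \<open>The semigroup algebra is free on the semigroup. The section \<open>i\<close> writes an
  element of \<open>M\<close> as a formal combination of the images of the basis; \<open>r\<close>
  evaluates formal combinations of elements of \<open>M\<close>, after pulling them back along the
  inverse \<open>j\<close> of the isomorphism.\<close>

lemma projective_module_if_algebra_isomorphic:
  assumes "algebra_isomorphic (semigroup_algebra :: ('k::comm_ring_1, 'a::{semigroup_mult,finite} \<Rightarrow>\<^sub>0 'k) module) M"
  shows "projective_module M"
proof -
  obtain g where g: "g \<in> ring_iso (semigroup_algebra :: ('k, 'a \<Rightarrow>\<^sub>0 'k) module) M"
    and sm: "\<And>c x. g (scale c x) = c \<odot>\<^bsub>M\<^esub> g x"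
    using assms unfolding algebra_isomorphic_def by auto
  have bij: "bij_betw g UNIV (carrier M)" and add: "g (x + y) = g x \<oplus>\<^bsub>M\<^esub> g y"
    and carr: "g x \<in> carrier M" for x y
    using ring_iso_memE[OF g] by auto
  define j where "j m = (if m \<in> carrier M then inv_into UNIV g m else 0)" for m
  have gj: "g (j m) = m" if "m \<in> carrier M" for m
    using that bij by (simp add: j_def bij_betw_inv_into_right)
  have jg: "j (g x) = x" for x
    using bij carr by (simp add: j_def bij_betw_inv_into_left)
  define i where "i m = lin_ext (\<lambda>s. Poly_Mapping.single (g (Poly_Mapping.single s 1)) 1) (j m)" for m
  define r where "r v = g (lin_ext j v)" for v
  have jadd: "j (x \<oplus>\<^bsub>M\<^esub> y) = j x + j y" if "x \<in> carrier M" "y \<in> carrier M" for x y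
    using jg[of "j x + j y"] that by (simp add: add gj)
  have jsm: "j (c \<odot>\<^bsub>M\<^esub> x) = scale c (j x)" if "x \<in> carrier M" for x c
    using jg[of "scale c (j x)"] that by (simp add: sm gj)
  have "lin_ext j (lin_ext (\<lambda>s. Poly_Mapping.single (g (Poly_Mapping.single s 1)) 1) a) = a" for a
    by (rule linear_pm_eqI[where a = a and G = "\<lambda>a. a" and
          F = "\<lambda>a. lin_ext j (lin_ext (\<lambda>s. Poly_Mapping.single (g (Poly_Mapping.single s 1)) 1) a)"])
      (simp_all add: linear_pm_comp[OF lin_ext_linear lin_ext_linear] jg, simp add: linear_pm_def)
  then have "\<forall>x\<in>carrier M. r (i x) = x" by (simp add: r_def i_def gj)
  moreover have "\<forall>x\<in>carrier M. \<forall>y\<in>carrier M. i (x \<oplus>\<^bsub>M\<^esub> y) = i x + i y"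
    by (simp add: i_def jadd linear_pm_add[OF lin_ext_linear])
  moreover have "\<forall>c. \<forall>x\<in>carrier M. i (c \<odot>\<^bsub>M\<^esub> x) = scale c (i x)"
    by (simp add: i_def jsm linear_pm_scale[OF lin_ext_linear])
  moreover have "\<forall>v. r v \<in> carrier M" by (simp add: r_def carr)
  moreover have "\<forall>v w. r (v + w) = r v \<oplus>\<^bsub>M\<^esub> r w"
    by (simp add: r_def linear_pm_add[OF lin_ext_linear] add)
  moreover have "\<forall>c v. r (scale c v) = c \<odot>\<^bsub>M\<^esub> r v"
    by (simp add: r_def linear_pm_scale[OF lin_ext_linear] sm)
  ultimately show ?thesis unfolding projective_module_def by (intro exI[of _ i] exI[of _ r] conjI)
qed

text \<open>A surjective unital algebra homomorphism, encoded by its values on paths alone. In this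
  form it can be moved to another ring by changing the coefficients of the values.\<close>

definition presents ::
  "('v, 'e) pre_digraph \<Rightarrow> (('v, 'e) path \<Rightarrow> ('a::semigroup_mult \<Rightarrow>\<^sub>0 'k::comm_ring_1)) \<Rightarrow> bool" where
  "presents Q \<pi> \<longleftrightarrow>
     (\<forall>p\<in>paths Q. \<forall>q\<in>paths Q. lin_ext \<pi> (path_mult p q) = semigroup_mult_ext (\<pi> p) (\<pi> q)) \<and>
     (\<forall>x. semigroup_mult_ext (\<Sum>v\<in>verts Q. \<pi> (v, [], v)) x = x \<and>
          semigroup_mult_ext x (\<Sum>v\<in>verts Q. \<pi> (v, [], v)) = x) \<and>
     lin_ext \<pi> ` {a. Poly_Mapping.keys a \<subseteq> paths Q} = UNIV"

definition path_kernel ::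
  "('v, 'e) pre_digraph \<Rightarrow> (('v, 'e) path \<Rightarrow> ('a \<Rightarrow>\<^sub>0 'k::comm_ring_1)) \<Rightarrow> (('v, 'e) path \<Rightarrow>\<^sub>0 'k) set" where
  "path_kernel Q \<pi> = {a. Poly_Mapping.keys a \<subseteq> paths Q \<and> lin_ext \<pi> a = 0}"

context fin_digraph
begin

lemma lin_ext_one:
  "lin_ext \<pi> (one (path_algebra G :: ('k::comm_ring_1, _) module)) = (\<Sum>v\<in>verts G. \<pi> (v, [], v))"
  by (simp add: one_path_algebra linear_pm_sum[OF lin_ext_linear])

lemma
  fixes \<pi> :: "('a, 'b) path \<Rightarrow> ('s::semigroup_mult \<Rightarrow>\<^sub>0 'k::comm_ring_1)"
  assumes "presents G \<pi>"
  shows ideal_path_kernel: "ideal (path_kernel G \<pi>) (path_algebra G)"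
    and algebra_isomorphic_path_kernel:
      "algebra_isomorphic (semigroup_algebra :: ('k, 's \<Rightarrow>\<^sub>0 'k) module)
         (quotient_algebra (path_algebra G) (path_kernel G \<pi>))"
proof -
  let ?A = "path_algebra G :: ('k, _) module"
  let ?B = "semigroup_algebra :: ('k, 's \<Rightarrow>\<^sub>0 'k) module"
  let ?u = "\<Sum>v\<in>verts G. \<pi> (v, [], v)"
  have u: "semigroup_mult_ext ?u x = x" "semigroup_mult_ext x ?u = x" for x
    using assms by (auto simp: presents_def)
  have hom: "ring_hom_ring ?A ?B (lin_ext \<pi>)"
  proof (rule ring_hom_ringI)
    show "ring ?A" by (rule ring_path_algebra)
    show "ring ?B" by (rule ring_semigroup_algebra[OF u])
    show "lin_ext \<pi> \<one>\<^bsub>?A\<^esub> = \<one>\<^bsub>?B\<^esub>"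
      by (simp add: lin_ext_one one_semigroup_algebra[OF u])
    fix x y assume "x \<in> carrier ?A" "y \<in> carrier ?A"
    then have "p \<in> paths G" "q \<in> paths G" if "p \<in> Poly_Mapping.keys x" "q \<in> Poly_Mapping.keys y" for p q
      using that by auto
    then show "lin_ext \<pi> (x \<otimes>\<^bsub>?A\<^esub> y) = lin_ext \<pi> x \<otimes>\<^bsub>?B\<^esub> lin_ext \<pi> y"
      using assms unfolding path_algebra_simps semigroup_algebra_simps semigroup_mult_ext_eq presents_def
      by (intro lin_ext_mult_hom) blast
  qed (simp_all add: linear_pm_add[OF lin_ext_linear])
  have ker: "path_kernel G \<pi> = a_kernel ?A ?B (lin_ext \<pi>)"
    by (auto simp: path_kernel_def a_kernel_def')
  show "ideal (path_kernel G \<pi>) ?A"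
    unfolding ker by (rule ring_hom_ring.kernel_is_ideal[OF hom])
  show "algebra_isomorphic ?B (quotient_algebra ?A (path_kernel G \<pi>))"
    unfolding ker
  proof (rule algebra_isomorphic_quotient_kernel[OF hom])
    fix c and a :: "('a, 'b) path \<Rightarrow>\<^sub>0 'k" assume "a \<in> carrier ?A"
    then show "c \<odot>\<^bsub>?A\<^esub> a \<in> carrier ?A" using keys_scale[of c a] by auto
  qed (use assms in \<open>auto simp: presents_def linear_pm_scale[OF lin_ext_linear]\<close>)
qed

text \<open>The second half of the theorem speaks of every suitable ideal \<open>I\<close>, not only
  of a constructed one. The presentation is recovered from the given isomorphism by sending a path
  to the preimage of its coset.\<close>

lemma presentation_exists:
  fixes I :: "(('a, 'b) path \<Rightarrow>\<^sub>0 'k::comm_ring_1) set"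
  assumes I: "ideal I (path_algebra G)"
    and iso: "algebra_isomorphic (semigroup_algebra :: ('k, 's::semigroup_mult \<Rightarrow>\<^sub>0 'k) module)
      (quotient_algebra (path_algebra G) I)"
  obtains \<pi> :: "('a, 'b) path \<Rightarrow> ('s::semigroup_mult \<Rightarrow>\<^sub>0 'k)" where "presents G \<pi>" "I = path_kernel G \<pi>"
proof -
  let ?A = "path_algebra G :: ('k, _) module"
  let ?B = "semigroup_algebra :: ('k, 's \<Rightarrow>\<^sub>0 'k) module"
  let ?M = "quotient_algebra ?A I"
  interpret A: ring ?A by (rule ring_path_algebra)
  interpret I: ideal I ?A by (rule I)
  obtain h where h: "h \<in> ring_iso ?B ?M" and sm: "\<And>c x. h (scale c x) = c \<odot>\<^bsub>?M\<^esub> h x"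
    using iso unfolding algebra_isomorphic_def by auto
  have bij: "bij_betw h UNIV (carrier ?M)" and hadd: "h (x + y) = h x \<oplus>\<^bsub>?M\<^esub> h y"
    and hmult: "h (semigroup_mult_ext x y) = h x \<otimes>\<^bsub>?M\<^esub> h y" for x y
    using ring_iso_memE[OF h] by auto
  have inj: "h x = h y \<Longrightarrow> x = y" for x y
    using bij by (auto simp: bij_betw_def inj_on_def)
  have coset: "I +>\<^bsub>?A\<^esub> a \<in> carrier ?M" if "a \<in> carrier ?A" for a
    using that by (auto simp: quotient_algebra_def FactRing_def A_RCOSETS_def')
  have cadd: "(I +>\<^bsub>?A\<^esub> a) \<oplus>\<^bsub>?M\<^esub> (I +>\<^bsub>?A\<^esub> b) = I +>\<^bsub>?A\<^esub> (a + b)"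
    if "a \<in> carrier ?A" "b \<in> carrier ?A" for a b
    using I.a_rcos_sum[OF that] by (simp add: quotient_algebra_def FactRing_def)
  have cmult: "(I +>\<^bsub>?A\<^esub> a) \<otimes>\<^bsub>?M\<^esub> (I +>\<^bsub>?A\<^esub> b) = I +>\<^bsub>?A\<^esub> (bilin_ext path_mult a b)"
    if "a \<in> carrier ?A" "b \<in> carrier ?A" for a b
    using I.rcoset_mult_add[OF that] by (simp add: quotient_algebra_def FactRing_def)
  have sc: "scale c a \<in> carrier ?A" if "a \<in> carrier ?A" for c a
    using that keys_scale[of c a] by auto
  have csm: "c \<odot>\<^bsub>?M\<^esub> (I +>\<^bsub>?A\<^esub> a) = I +>\<^bsub>?A\<^esub> scale c a" if a: "a \<in> carrier ?A" for c a
  proof -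
    have "I +>\<^bsub>?A\<^esub> scale c x = I +>\<^bsub>?A\<^esub> scale c a" if x: "x \<in> I +>\<^bsub>?A\<^esub> a" for x
    proof -
      obtain y where y: "y \<in> I" "x = y + a"
        using x unfolding a_r_coset_def' by auto
      have yc: "y \<in> carrier ?A" using I.Icarr[OF y(1)] .
      have one: "\<one>\<^bsub>?A\<^esub> \<in> carrier ?A" by (rule A.one_closed)
      \<comment> \<open>\<open>I\<close> is only assumed to be an ideal of the ring; closure under
        scalars follows by multiplying with the element \<open>scale c \<one>\<close>.\<close>
      have "scale c y = scale c \<one>\<^bsub>?A\<^esub> \<otimes>\<^bsub>?A\<^esub> y"
        using A.l_one[OF yc] by (simp add: bilin_ext_simps)
      also have "\<dots> \<in> I" by (rule I.I_l_closed[OF y(1) sc[OF one]])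
      finally have "scale c y \<in> I" .
      then have "scale c x \<in> I +>\<^bsub>?A\<^esub> scale c a"
        unfolding a_r_coset_def' y(2) by auto
      from A.a_repr_independence[OF this sc[OF a] I.a_subgroup] show ?thesis ..
    qed
    then show ?thesis
      unfolding quotient_algebra_def module.simps path_algebra_simps
      by (rule UN_constant_on[OF I.a_rcos_self[OF a]])
  qed
  have coset_0: "I +>\<^bsub>?A\<^esub> 0 = I" using A.a_coset_join2[OF A.zero_closed I.a_subgroup] I.zero_closed by simp
  have rep: "\<exists>a\<in>carrier ?A. h x = I +>\<^bsub>?A\<^esub> a" for x
  proof -
    have "h x \<in> carrier ?M" using bij by (auto simp: bij_betw_def)
    then show ?thesis by (auto simp: quotient_algebra_def FactRing_def A_RCOSETS_def')
  qed
  have h0: "h 0 = I"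
  proof -
    obtain z where "z \<in> carrier ?A" "h 0 = I +>\<^bsub>?A\<^esub> z" using rep by blast
    then show ?thesis using sm[of 0 0] csm[of z 0] coset_0 by simp
  qed
  define \<pi> where "\<pi> p = inv_into UNIV h (I +>\<^bsub>?A\<^esub> Poly_Mapping.single p 1)" for p
  have single: "Poly_Mapping.single p c \<in> carrier ?A" if "p \<in> paths G" for p and c :: 'k
    using that by simp
  have h\<pi>: "h (\<pi> p) = I +>\<^bsub>?A\<^esub> Poly_Mapping.single p 1" if "p \<in> paths G" for p
    unfolding \<pi>_def using coset[OF single[OF that]] bij by (simp add: bij_betw_inv_into_right)
  have hsum: "h (\<Sum>p\<in>P. scale (c p) (\<pi> p)) = I +>\<^bsub>?A\<^esub> (\<Sum>p\<in>P. scale (c p) (Poly_Mapping.single p 1))"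
    if "finite P" "P \<subseteq> paths G" for P c
    using that
  proof (induction P)
    case empty
    then show ?case using h0 coset_0 by simp
  next
    case (insert p P)
    have s: "(\<Sum>p\<in>P. scale (c p) (Poly_Mapping.single p 1)) \<in> carrier ?A"
      using keys_sum_subset[of "\<lambda>p. Poly_Mapping.single p (c p)" P] insert.prems by (fastforce split: if_splits)
    have p: "p \<in> paths G" and P: "P \<subseteq> paths G" using insert.prems by auto
    have "h (\<Sum>p\<in>insert p P. scale (c p) (\<pi> p)) = h (scale (c p) (\<pi> p) + (\<Sum>p\<in>P. scale (c p) (\<pi> p)))"
      unfolding sum.insert[OF insert.hyps] ..
    also have "\<dots> = (c p \<odot>\<^bsub>?M\<^esub> (I +>\<^bsub>?A\<^esub> Poly_Mapping.single p 1)) \<oplus>\<^bsub>?M\<^esub>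
        (I +>\<^bsub>?A\<^esub> (\<Sum>p\<in>P. scale (c p) (Poly_Mapping.single p 1)))"
      unfolding hadd sm h\<pi>[OF p] insert.IH[OF P] ..
    also have "\<dots> = I +>\<^bsub>?A\<^esub> (scale (c p) (Poly_Mapping.single p 1) +
        (\<Sum>p\<in>P. scale (c p) (Poly_Mapping.single p 1)))"
      unfolding csm[OF single[OF p]] cadd[OF sc[OF single[OF p]] s] ..
    also have "\<dots> = I +>\<^bsub>?A\<^esub> (\<Sum>p\<in>insert p P. scale (c p) (Poly_Mapping.single p 1))"
      unfolding sum.insert[OF insert.hyps] ..
    finally show ?case .
  qed
  have key: "h (lin_ext \<pi> a) = I +>\<^bsub>?A\<^esub> a" if "Poly_Mapping.keys a \<subseteq> paths G" for a
    using hsum[OF finite_keys that, of "Poly_Mapping.lookup a"]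
    unfolding lin_ext_def sum_single_expand[OF finite_keys subset_refl, symmetric] .
  have "presents G \<pi>"
    unfolding presents_def
  proof (intro conjI ballI allI)
    fix p q assume p: "p \<in> paths G" and q: "q \<in> paths G"
    have m: "path_mult p q = Poly_Mapping.single p 1 \<otimes>\<^bsub>?A\<^esub> Poly_Mapping.single q 1" by simp
    have "h (lin_ext \<pi> (path_mult p q)) = I +>\<^bsub>?A\<^esub> path_mult p q"
    proof (rule key)
      have "path_mult p q \<in> carrier ?A"
        unfolding m by (rule A.m_closed[OF single[OF p] single[OF q]])
      then show "Poly_Mapping.keys (path_mult p q :: _ \<Rightarrow>\<^sub>0 'k) \<subseteq> paths G" by simp
    qed
    also have "\<dots> = h (semigroup_mult_ext (\<pi> p) (\<pi> q))"
      unfolding hmult h\<pi>[OF p] h\<pi>[OF q] cmult[OF single[OF p] single[OF q]] by simp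
    finally show "lin_ext \<pi> (path_mult p q) = semigroup_mult_ext (\<pi> p) (\<pi> q)" by (rule inj)
  next
    fix x
    let ?u = "\<Sum>v\<in>verts G. \<pi> (v, [], v)"
    obtain a where a: "a \<in> carrier ?A" "h x = I +>\<^bsub>?A\<^esub> a" using rep by blast
    have u: "h ?u = I +>\<^bsub>?A\<^esub> \<one>\<^bsub>?A\<^esub>"
      using key[of "\<one>\<^bsub>?A\<^esub>"] A.one_closed by (simp add: lin_ext_one)
    have "h (semigroup_mult_ext ?u x) = h x"
      unfolding hmult u a(2) cmult[OF A.one_closed a(1)] using A.l_one[OF a(1)] by simp
    then show "semigroup_mult_ext ?u x = x" by (rule inj)
    have "h (semigroup_mult_ext x ?u) = h x"
      unfolding hmult u a(2) cmult[OF a(1) A.one_closed] using A.r_one[OF a(1)] by simp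
    then show "semigroup_mult_ext x ?u = x" by (rule inj)
  next
    have "x \<in> lin_ext \<pi> ` {a. Poly_Mapping.keys a \<subseteq> paths G}" for x
    proof -
      obtain a where a: "a \<in> carrier ?A" "h x = I +>\<^bsub>?A\<^esub> a" using rep by blast
      then have "h x = h (lin_ext \<pi> a)" using key by simp
      then have "x = lin_ext \<pi> a" by (rule inj)
      then show ?thesis using a(1) by simp
    qed
    then show "lin_ext \<pi> ` {a. Poly_Mapping.keys a \<subseteq> paths G} = UNIV" by blast
  qed
  moreover have "I = path_kernel G \<pi>"
  proof (intro equalityI subsetI)
    fix a assume a: "a \<in> I"
    then have c: "a \<in> carrier ?A" by (rule I.Icarr)
    have "h (lin_ext \<pi> a) = h 0"
      using key[of a] c A.a_coset_join2[OF c I.a_subgroup a] h0 by simp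
    from inj[OF this] c show "a \<in> path_kernel G \<pi>" by (simp add: path_kernel_def)
  next
    fix a assume "a \<in> path_kernel G \<pi>"
    then have a: "a \<in> carrier ?A" "lin_ext \<pi> a = 0" by (auto simp: path_kernel_def)
    then have "I +>\<^bsub>?A\<^esub> a = I" using key[of a] h0 by simp
    then show "a \<in> I" using I.a_rcos_self[OF a(1)] by simp
  qed
  ultimately show ?thesis by (rule that)
qed

end


section \<open>Change of the base ring\<close>

definition base_change :: "('b \<Rightarrow>\<^sub>0 int) \<Rightarrow> ('b \<Rightarrow>\<^sub>0 'k::comm_ring_1)" where
  "base_change a = Poly_Mapping.map of_int a"

lemma lookup_base_change [simp]: "Poly_Mapping.lookup (base_change a) x = of_int (Poly_Mapping.lookup a x)"
  unfolding base_change_def by transfer (auto simp: when_def)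

lemma keys_base_change: "Poly_Mapping.keys (base_change a) \<subseteq> Poly_Mapping.keys a"
  by (auto simp: in_keys_iff)

lemma base_change_0 [simp]: "base_change 0 = 0"
  by (rule poly_mapping_eqI) simp

lemma base_change_diff: "base_change (a - b) = base_change a - base_change b"
  by (rule poly_mapping_eqI) (simp add: lookup_minus)

lemma base_change_scale: "base_change (scale c a) = scale (of_int c) (base_change a)"
  by (rule poly_mapping_eqI) simp

lemma base_change_single [simp]: "base_change (Poly_Mapping.single x c) = Poly_Mapping.single x (of_int c)"
  by (rule poly_mapping_eqI) (simp add: lookup_single when_def)

lemma base_change_sum: "base_change (\<Sum>x\<in>A. g x) = (\<Sum>x\<in>A. base_change (g x))"
  by (rule poly_mapping_eqI) (simp add: lookup_sum)

lemma base_change_lin_ext: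
  "base_change (lin_ext \<phi> a) = lin_ext (\<lambda>p. base_change (\<phi> p)) (base_change a)"
  unfolding lin_ext_superset[OF finite_keys keys_base_change]
  by (simp add: lin_ext_def base_change_sum base_change_scale)

lemma base_change_semigroup_mult_ext:
  "base_change (semigroup_mult_ext a b) = semigroup_mult_ext (base_change a) (base_change b)"
  unfolding semigroup_mult_ext_eq bilin_ext_left by (simp add: base_change_lin_ext)

lemma base_change_path_mult: "base_change (path_mult p q) = path_mult p q"
  by (simp add: path_mult_eq)

lemma base_change_in_extend_scalars: "a \<in> I \<Longrightarrow> base_change a \<in> extend_scalars I"
  unfolding extend_scalars_def base_change_def
  by (rule CollectI, rule exI[of _ "{a}"], rule exI[of _ "\<lambda>_. 1"]) simp

lemma zero_in_extend_scalars: "0 \<in> extend_scalars I"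
  unfolding extend_scalars_def by (rule CollectI, rule exI[of _ "{}"]) simp

lemma add_in_extend_scalars:
  assumes "x \<in> extend_scalars I" "y \<in> extend_scalars I"
  shows "x + y \<in> extend_scalars I"
proof -
  obtain A c where A: "finite A" "A \<subseteq> I" "x = (\<Sum>a\<in>A. scale (c a) (Poly_Mapping.map of_int a))"
    using assms(1) unfolding extend_scalars_def by blast
  obtain B d where B: "finite B" "B \<subseteq> I" "y = (\<Sum>a\<in>B. scale (d a) (Poly_Mapping.map of_int a))"
    using assms(2) unfolding extend_scalars_def by blast
  let ?c = "\<lambda>a. if a \<in> A then c a else 0" and ?d = "\<lambda>a. if a \<in> B then d a else 0"
  have "x = (\<Sum>a\<in>A \<union> B. scale (?c a) (Poly_Mapping.map of_int a))"
    unfolding A(3) using A(1) B(1) by (intro sum.mono_neutral_cong_left) auto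
  moreover have "y = (\<Sum>a\<in>A \<union> B. scale (?d a) (Poly_Mapping.map of_int a))"
    unfolding B(3) using A(1) B(1) by (intro sum.mono_neutral_cong_left) auto
  ultimately have "x + y = (\<Sum>a\<in>A \<union> B. scale (?c a + ?d a) (Poly_Mapping.map of_int a))"
    by (simp only: scale_add_left sum.distrib)
  then show ?thesis
    unfolding extend_scalars_def using A(1,2) B(1,2)
    by (intro CollectI exI[of _ "A \<union> B"] exI[of _ "\<lambda>a. ?c a + ?d a"] conjI) auto
qed

lemma scale_in_extend_scalars:
  assumes "x \<in> extend_scalars I"
  shows "scale c x \<in> extend_scalars I"
proof -
  obtain A d where A: "finite A" "A \<subseteq> I" "x = (\<Sum>a\<in>A. scale (d a) (Poly_Mapping.map of_int a))"
    using assms(1) unfolding extend_scalars_def by blast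
  then have "scale c x = (\<Sum>a\<in>A. scale (c * d a) (Poly_Mapping.map of_int a))"
    by (simp add: scale_sum)
  then show ?thesis
    unfolding extend_scalars_def using A(1,2)
    by (intro CollectI exI[of _ A] exI[of _ "\<lambda>a. c * d a"] conjI) auto
qed

lemma sum_in_extend_scalars:
  "(\<And>x. x \<in> A \<Longrightarrow> g x \<in> extend_scalars I) \<Longrightarrow> (\<Sum>x\<in>A. g x) \<in> extend_scalars I"
  by (induction A rule: infinite_finite_induct) (auto simp: zero_in_extend_scalars add_in_extend_scalars)

lemma extend_scalars_subset:
  assumes "\<And>a. a \<in> I \<Longrightarrow> Poly_Mapping.keys a \<subseteq> K" and x: "x \<in> extend_scalars I"
  shows "Poly_Mapping.keys x \<subseteq> K"
proof -
  obtain A c where A: "finite A" "A \<subseteq> I" "x = (\<Sum>a\<in>A. scale (c a) (base_change a))"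
    using x unfolding extend_scalars_def base_change_def by blast
  have "Poly_Mapping.keys (scale (c a) (base_change a)) \<subseteq> K" if "a \<in> A" for a
    using that A(2) assms(1)[of a] keys_scale[of "c a" "base_change a"] keys_base_change[of a] by auto
  then have "(\<Union>a\<in>A. Poly_Mapping.keys (scale (c a) (base_change a))) \<subseteq> K" by (rule UN_least)
  then show ?thesis unfolding A(3) by (rule order_trans[OF keys_sum_subset])
qed

lemma linear_id: "linear_pm (\<lambda>a. a)"
  by (simp add: linear_pm_def)

text \<open>The target is free, so a surjection onto it splits linearly: \<open>a\<close> picks a
  preimage of each basis element. This splitting is the reason why forming the kernel commutes with
  base change.\<close>

lemma presents_section:
  assumes "presents Q \<pi>"
  obtains a where "\<And>s. Poly_Mapping.keys (a s) \<subseteq> paths Q" "\<And>z. lin_ext \<pi> (lin_ext a z) = z"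
proof -
  have "\<forall>s. \<exists>b. Poly_Mapping.keys b \<subseteq> paths Q \<and> lin_ext \<pi> b = Poly_Mapping.single s 1"
  proof
    fix s
    have "Poly_Mapping.single s 1 \<in> lin_ext \<pi> ` {a. Poly_Mapping.keys a \<subseteq> paths Q}"
      using assms unfolding presents_def by simp
    then show "\<exists>b. Poly_Mapping.keys b \<subseteq> paths Q \<and> lin_ext \<pi> b = Poly_Mapping.single s 1" by auto
  qed
  then obtain a where a: "\<And>s. Poly_Mapping.keys (a s) \<subseteq> paths Q" "\<And>s. lin_ext \<pi> (a s) = Poly_Mapping.single s 1"
    by metis
  have "lin_ext \<pi> (lin_ext a z) = z" for z
    by (rule linear_pm_eqI[OF linear_pm_comp[OF lin_ext_linear lin_ext_linear] linear_id]) (simp add: a)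
  with a(1) show ?thesis by (rule that)
qed

lemma presents_base_change:
  assumes "presents Q \<pi>"
  shows "presents Q (\<lambda>p. base_change (\<pi> p) :: _ \<Rightarrow>\<^sub>0 'k::comm_ring_1)"
proof -
  let ?\<pi> = "\<lambda>p. base_change (\<pi> p) :: _ \<Rightarrow>\<^sub>0 'k"
  let ?u = "\<Sum>v\<in>verts Q. \<pi> (v, [], v)"
  have "lin_ext ?\<pi> (path_mult p q) = semigroup_mult_ext (?\<pi> p) (?\<pi> q)"
    if "p \<in> paths Q" "q \<in> paths Q" for p q
  proof -
    have "lin_ext ?\<pi> (path_mult p q) = base_change (lin_ext \<pi> (path_mult p q))"
      by (simp add: base_change_lin_ext base_change_path_mult)
    also have "lin_ext \<pi> (path_mult p q) = semigroup_mult_ext (\<pi> p) (\<pi> q)"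
      using assms that by (auto simp: presents_def)
    finally show ?thesis by (simp add: base_change_semigroup_mult_ext)
  qed
  moreover have u: "semigroup_mult_ext ?u x = x" "semigroup_mult_ext x ?u = x" for x
    using assms by (auto simp: presents_def)
  have u': "(\<Sum>v\<in>verts Q. ?\<pi> (v, [], v)) = base_change ?u"
    by (simp add: base_change_sum)
  have "semigroup_mult_ext (base_change ?u) x = x" "semigroup_mult_ext x (base_change ?u) = x"
    for x :: "_ \<Rightarrow>\<^sub>0 'k"
  proof -
    have s: "Poly_Mapping.single s (1::'k) = base_change (Poly_Mapping.single s 1)" for s by simp
    show "semigroup_mult_ext (base_change ?u) x = x"
    proof (rule linear_pm_eqI[where F = "semigroup_mult_ext _", OF _ linear_id])
      show "linear_pm (semigroup_mult_ext (base_change ?u :: _ \<Rightarrow>\<^sub>0 'k))"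
        unfolding semigroup_mult_ext_eq by (rule linear_bilin_ext_right)
      show "semigroup_mult_ext (base_change ?u) (Poly_Mapping.single p (1::'k)) = Poly_Mapping.single p 1" for p
        unfolding s base_change_semigroup_mult_ext[symmetric] u ..
    qed
    show "semigroup_mult_ext x (base_change ?u) = x"
    proof (rule linear_pm_eqI[where F = "\<lambda>x. semigroup_mult_ext x _", OF _ linear_id])
      show "linear_pm (\<lambda>x. semigroup_mult_ext x (base_change ?u :: _ \<Rightarrow>\<^sub>0 'k))"
        unfolding semigroup_mult_ext_eq by (rule linear_bilin_ext_left)
      show "semigroup_mult_ext (Poly_Mapping.single p (1::'k)) (base_change ?u) = Poly_Mapping.single p 1" for p
        unfolding s base_change_semigroup_mult_ext[symmetric] u ..
    qed
  qed
  moreover have "x \<in> lin_ext ?\<pi> ` {a. Poly_Mapping.keys a \<subseteq> paths Q}" for x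
  proof -
    obtain a where a: "\<And>s. Poly_Mapping.keys (a s) \<subseteq> paths Q" "\<And>z. lin_ext \<pi> (lin_ext a z) = z"
      using presents_section[OF assms] by blast
    let ?a = "\<lambda>s. base_change (a s) :: _ \<Rightarrow>\<^sub>0 'k"
    have "lin_ext ?\<pi> (lin_ext ?a x) = x"
    proof (rule linear_pm_eqI[OF linear_pm_comp[OF lin_ext_linear lin_ext_linear] linear_id])
      fix s
      have "lin_ext ?\<pi> (lin_ext ?a (Poly_Mapping.single s 1)) = base_change (lin_ext \<pi> (lin_ext a (Poly_Mapping.single s 1)))"
        unfolding base_change_lin_ext by simp
      then show "lin_ext ?\<pi> (lin_ext ?a (Poly_Mapping.single s 1)) = Poly_Mapping.single s 1"
        unfolding a(2) by simp
    qed
    moreover have "Poly_Mapping.keys (lin_ext ?a x) \<subseteq> paths Q"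
      using order_trans[OF keys_base_change a(1)] by (intro order_trans[OF keys_lin_ext] UN_least)
    ultimately show ?thesis by (intro image_eqI[of _ _ "lin_ext ?a x"]) simp_all
  qed
  ultimately show ?thesis unfolding presents_def u' by blast
qed

text \<open>For every path p the element \<open>r p\<close>, which is p minus the chosen lift of its
  value, lies in the integral kernel. Over \<open>'k\<close> the base changes of these elements span
  the kernel.\<close>

lemma path_kernel_base_change:
  assumes "presents Q \<pi>"
  shows "path_kernel Q (\<lambda>p. base_change (\<pi> p) :: _ \<Rightarrow>\<^sub>0 'k::comm_ring_1) = extend_scalars (path_kernel Q \<pi>)"
proof (intro equalityI subsetI)
  let ?\<pi> = "\<lambda>p. base_change (\<pi> p) :: _ \<Rightarrow>\<^sub>0 'k"
  obtain a where a: "\<And>s. Poly_Mapping.keys (a s) \<subseteq> paths Q" "\<And>z. lin_ext \<pi> (lin_ext a z) = z"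
    using presents_section[OF assms] by blast
  let ?a = "\<lambda>s. base_change (a s) :: _ \<Rightarrow>\<^sub>0 'k"
  define r where "r p = Poly_Mapping.single p 1 - lin_ext a (\<pi> p)" for p
  fix x assume "x \<in> path_kernel Q ?\<pi>"
  then have x: "Poly_Mapping.keys x \<subseteq> paths Q" "lin_ext ?\<pi> x = 0" by (auto simp: path_kernel_def)
  have r: "r p \<in> path_kernel Q \<pi>" if "p \<in> paths Q" for p
  proof -
    have "Poly_Mapping.keys (lin_ext a (\<pi> p)) \<subseteq> paths Q"
      using a(1) by (intro order_trans[OF keys_lin_ext] UN_least)
    moreover have "Poly_Mapping.keys (r p) \<subseteq> {p} \<union> Poly_Mapping.keys (lin_ext a (\<pi> p))"
      by (auto simp: r_def in_keys_iff lookup_minus lookup_single when_def split: if_splits)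
    ultimately have "Poly_Mapping.keys (r p) \<subseteq> paths Q" using that by blast
    then show ?thesis
      by (simp add: path_kernel_def r_def linear_pm_minus[OF lin_ext_linear] a(2))
  qed
  \<comment> \<open>Subtracting the lift of the value 0 rewrites x as the combination of the
    elements \<open>r p\<close> with the coefficients of x.\<close>
  have "x = x - lin_ext ?a (lin_ext ?\<pi> x)"
    by (simp add: x(2) linear_pm_0[OF lin_ext_linear])
  also have "\<dots> = lin_ext (\<lambda>p. base_change (r p)) x"
  proof (rule linear_pm_eqI[OF _ lin_ext_linear])
    show "linear_pm (\<lambda>x. x - lin_ext ?a (lin_ext ?\<pi> x))"
      using linear_pm_comp[OF lin_ext_linear lin_ext_linear, of ?a ?\<pi>]
      by (auto simp: linear_pm_def algebra_simps poly_mapping_eq_iff fun_eq_iff lookup_add lookup_minus)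
  qed (simp add: r_def base_change_diff base_change_lin_ext)
  also have "\<dots> \<in> extend_scalars (path_kernel Q \<pi>)"
    unfolding lin_ext_def using x(1) r
    by (intro sum_in_extend_scalars scale_in_extend_scalars base_change_in_extend_scalars) auto
  finally show "x \<in> extend_scalars (path_kernel Q \<pi>)" .
next
  let ?\<pi> = "\<lambda>p. base_change (\<pi> p) :: _ \<Rightarrow>\<^sub>0 'k"
  fix x :: "_ \<Rightarrow>\<^sub>0 'k" assume x: "x \<in> extend_scalars (path_kernel Q \<pi>)"
  then obtain A c where A: "finite A" "A \<subseteq> path_kernel Q \<pi>" "x = (\<Sum>a\<in>A. scale (c a) (base_change a))"
    unfolding extend_scalars_def base_change_def by blast
  have z: "lin_ext ?\<pi> (base_change a) = 0" if "a \<in> A" for a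
  proof -
    have "lin_ext \<pi> a = 0" using that A(2) by (auto simp: path_kernel_def)
    then show ?thesis using base_change_lin_ext[of \<pi> a] by simp
  qed
  have "lin_ext ?\<pi> x = (\<Sum>a\<in>A. scale (c a) (lin_ext ?\<pi> (base_change a)))"
    unfolding A(3) linear_pm_sum[OF lin_ext_linear] linear_pm_scale[OF lin_ext_linear] ..
  also have "\<dots> = 0" by (simp add: z)
  finally show "x \<in> path_kernel Q ?\<pi>"
    using extend_scalars_subset[OF _ x, of "paths Q"] by (auto simp: path_kernel_def)
qed

lemma (in fin_digraph) admissible_base_change:
  fixes I :: "(('a, 'b) path \<Rightarrow>\<^sub>0 int) set"
  assumes adm: "admissible G I"
    and iso: "algebra_isomorphic (semigroup_algebra :: (int, 's::{semigroup_mult,finite} \<Rightarrow>\<^sub>0 int) module)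
      (quotient_algebra (path_algebra G) I)"
  shows "algebra_isomorphic (semigroup_algebra :: ('k::comm_ring_1, 's \<Rightarrow>\<^sub>0 'k) module)
      (quotient_algebra (path_algebra G) (extend_scalars I))"
    and "admissible G (extend_scalars I :: (('a, 'b) path \<Rightarrow>\<^sub>0 'k) set)"
proof -
  have "ideal I (path_algebra G)" using adm by (simp add: admissible_def)
  then obtain \<pi> :: "('a, 'b) path \<Rightarrow> ('s \<Rightarrow>\<^sub>0 int)" where pi: "presents G \<pi>" and I: "I = path_kernel G \<pi>"
    using presentation_exists[OF _ iso] by blast
  let ?\<pi> = "\<lambda>p. base_change (\<pi> p) :: _ \<Rightarrow>\<^sub>0 'k"
  have pi': "presents G ?\<pi>" and I': "extend_scalars I = path_kernel G ?\<pi>"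
    unfolding I using presents_base_change[OF pi] path_kernel_base_change[OF pi] by auto
  show iso': "algebra_isomorphic (semigroup_algebra :: ('k, 's \<Rightarrow>\<^sub>0 'k) module)
      (quotient_algebra (path_algebra G) (extend_scalars I))"
    unfolding I' by (rule algebra_isomorphic_path_kernel[OF pi'])
  obtain n where n: "n \<ge> 2" "ideal_power (path_algebra G) (arrow_ideal G) n \<subseteq> I"
    using adm by (auto simp: admissible_def)
  have le: "I \<subseteq> ideal_power (path_algebra G) (arrow_ideal G) 2"
    using adm by (simp add: admissible_def)
  show "admissible G (extend_scalars I :: (('a, 'b) path \<Rightarrow>\<^sub>0 'k) set)"
    unfolding admissible_def
  proof (intro conjI)
    show "ideal (extend_scalars I :: (('a, 'b) path \<Rightarrow>\<^sub>0 'k) set) (path_algebra G)"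
      unfolding I' by (rule ideal_path_kernel[OF pi'])
    show "projective_module (quotient_algebra (path_algebra G) (extend_scalars I :: (('a, 'b) path \<Rightarrow>\<^sub>0 'k) set))"
      by (rule projective_module_if_algebra_isomorphic[OF iso'])
    show "extend_scalars I \<subseteq> ideal_power (path_algebra G :: ('k, _) module) (arrow_ideal G) 2"
    proof
      fix x :: "('a, 'b) path \<Rightarrow>\<^sub>0 'k" assume x: "x \<in> extend_scalars I"
      show "x \<in> ideal_power (path_algebra G :: ('k, _) module) (arrow_ideal G) 2"
        unfolding ideal_power_arrow_ideal
        by (rule CollectI, rule extend_scalars_subset[OF _ x]) (use le ideal_power_arrow_ideal in blast)
    qed
    show "\<exists>n\<ge>2. ideal_power (path_algebra G) (arrow_ideal G) n \<subseteq> (extend_scalars I :: (('a, 'b) path \<Rightarrow>\<^sub>0 'k) set)"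
    proof (intro exI[of _ n] conjI n(1) subsetI)
      fix x :: "('a, 'b) path \<Rightarrow>\<^sub>0 'k"
      assume "x \<in> ideal_power (path_algebra G) (arrow_ideal G) n"
      then have x: "Poly_Mapping.keys x \<subseteq> {(u, p, v) \<in> paths G. n \<le> length p}"
        unfolding ideal_power_arrow_ideal by simp
      \<comment> \<open>Each path of length at least n is itself an element of \<open>I\<close> over
        the integers, and x is a combination of such paths.\<close>
      have "Poly_Mapping.single p (1::'k) \<in> extend_scalars I" if "p \<in> Poly_Mapping.keys x" for p
      proof -
        have "Poly_Mapping.single p (1::int) \<in> I"
        proof (rule subsetD[OF n(2)])
          have "p \<in> {(u, p, v) \<in> paths G. n \<le> length p}" using x that by (rule subsetD)
          then show "Poly_Mapping.single p (1::int) \<in> ideal_power (path_algebra G) (arrow_ideal G) n"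
            unfolding ideal_power_arrow_ideal by simp
        qed
        from base_change_in_extend_scalars[OF this] show ?thesis by simp
      qed
      then have "(\<Sum>p\<in>Poly_Mapping.keys x. scale (Poly_Mapping.lookup x p) (Poly_Mapping.single p 1)) \<in> extend_scalars I"
        by (intro sum_in_extend_scalars scale_in_extend_scalars)
      then show "x \<in> extend_scalars I"
        unfolding sum_single_expand[OF finite_keys subset_refl, symmetric] .
    qed
  qed
qed


section \<open>Content in R-trivial semigroups\<close>

text \<open>The elements x and \<open>x * s\<close> generate the same right ideal, so antisymmetry
  identifies them.\<close>

lemma R_trivial_absorb:
  fixes x s t :: "'a::{semigroup_mult,finite}"
  assumes "R_trivial TYPE('a)" "x * s * t = x"
  shows "x * s = x"
proof -
  have "antisym (R_le :: 'a rel)"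
    using assms(1) by (simp add: R_trivial_def partial_order_on_def)
  moreover have "(x * s, x) \<in> R_le"
    by (auto simp: R_le_def right_ideal1_def mult.assoc)
  moreover have "(x, x * s) \<in> R_le"
  proof -
    have "x \<in> right_ideal1 (x * s)"
      using assms(2) by (auto simp: right_ideal1_def intro: exI[of _ t])
    moreover have "x * y \<in> right_ideal1 (x * s)" for y
    proof -
      have "x * y = x * s * (t * y)" using assms(2) by (simp flip: mult.assoc)
      then show ?thesis by (auto simp: right_ideal1_def)
    qed
    ultimately show ?thesis by (auto simp: R_le_def right_ideal1_def)
  qed
  ultimately show ?thesis by (rule antisymD)
qed

text \<open>Exponents are shifted by one, as in \<open>omega\<close>; this is the source of the
  extra successor in \<open>spow_add\<close>.\<close>

definition spow :: "'a::semigroup_mult \<Rightarrow> nat \<Rightarrow> 'a" where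
  "spow s n = ((*) s ^^ n) s"

lemma spow_simps [simp]: "spow s 0 = s" "spow s (Suc n) = s * spow s n"
  by (simp_all add: spow_def)

lemma spow_Suc': "spow s (Suc n) = spow s n * s"
proof (induction n)
  case (Suc n)
  have "spow s (Suc (Suc n)) = s * spow s (Suc n)" by simp
  also have "\<dots> = s * (spow s n * s)" unfolding Suc ..
  finally show ?case by (simp add: mult.assoc)
qed simp

lemma spow_add: "spow s m * spow s n = spow s (Suc (m + n))"
  by (induction m) (simp_all add: mult.assoc)

lemma mult_spow_fixed: "x * s = x \<Longrightarrow> x * spow s n = x"
  by (induction n) (simp_all flip: mult.assoc)

text \<open>An idempotent power of s returns to itself after multiplication by s and a further power
  of s; R-triviality then makes s alone act trivially on it.\<close>

lemma idempotent_spow_absorb: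
  assumes "R_trivial TYPE('a::{semigroup_mult,finite})" "is_idempotent (spow (s::'a) n)"
  shows "spow s n * s = spow s n"
proof (cases n)
  case 0
  then show ?thesis using assms(2) by (simp add: is_idempotent_def)
next
  case (Suc m)
  then have "spow s n * s * spow s m = spow s n"
    using assms(2) by (simp add: is_idempotent_def mult.assoc)
  then show ?thesis by (rule R_trivial_absorb[OF assms(1)])
qed

text \<open>By finiteness two powers of s coincide. R-triviality shows that the smaller of them
  already absorbs s, hence every power of s, in particular itself.\<close>

lemma idempotent_spow_exists:
  fixes s :: "'a::{semigroup_mult,finite}"
  assumes "R_trivial TYPE('a)"
  shows "\<exists>n. is_idempotent (spow s n)"
proof -
  have "\<not> inj (spow s)"
    using finite_imageD[where f = "spow s" and A = UNIV] infinite_UNIV_nat by auto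
  then obtain i j where ij: "i < j" "spow s i = spow s j"
    unfolding inj_on_def by (metis linorder_neqE_nat)
  have "spow s i * s = spow s i"
  proof (cases "j = Suc i")
    case True
    then show ?thesis using ij(2) spow_Suc'[of s i] by metis
  next
    case False
    then obtain k where "j = Suc (i + Suc k)"
      using ij(1) by (metis less_imp_Suc_add add_Suc_right not0_implies_Suc add_0_right)
    then have "spow s i * s * spow s k = spow s i"
      using ij(2) spow_add[of s i "Suc k"] by (simp add: mult.assoc)
    then show ?thesis by (rule R_trivial_absorb[OF assms])
  qed
  then have "is_idempotent (spow s i)"
    unfolding is_idempotent_def by (rule mult_spow_fixed)
  then show ?thesis ..
qed

text \<open>For uniqueness, two idempotent powers commute and each absorbs s, hence absorbs the
  other. This justifies the definite description in \<open>omega\<close>.\<close>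

lemma omega_eq_spow:
  fixes s :: "'a::{semigroup_mult,finite}"
  assumes rt: "R_trivial TYPE('a)"
  shows "is_idempotent (omega s) \<and> (\<exists>n. omega s = spow s n)"
  unfolding omega_def spow_def[symmetric]
proof (rule theI')
  obtain n where n: "is_idempotent (spow s n)"
    using idempotent_spow_exists[OF rt] by blast
  show "\<exists>!e. is_idempotent e \<and> (\<exists>n. e = spow s n)"
  proof (rule ex1I[of _ "spow s n"])
    fix e assume "is_idempotent e \<and> (\<exists>m. e = spow s m)"
    then obtain m where m: "is_idempotent (spow s m)" "e = spow s m" by blast
    have "spow s m = spow s m * spow s n"
      by (rule mult_spow_fixed[OF idempotent_spow_absorb[OF rt m(1)], symmetric])
    also have "\<dots> = spow s n * spow s m" by (simp only: spow_add add.commute)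
    also have "\<dots> = spow s n"
      by (rule mult_spow_fixed[OF idempotent_spow_absorb[OF rt n]])
    finally show "e = spow s n" by (simp add: m(2))
  qed (use n in auto)
qed

text \<open>\<open>omega s\<close> is a power of s that absorbs s on the right: elements
  \<open>y * omega s\<close> are therefore fixed by s, and an element fixed by s is fixed by all its
  powers.\<close>

lemma in_content_iff:
  fixes s :: "'a::{semigroup_mult,finite}"
  assumes rt: "R_trivial TYPE('a)"
  shows "x \<in> content s \<longleftrightarrow> x * s = x"
proof -
  obtain n where n: "is_idempotent (spow s n)" "omega s = spow s n"
    using omega_eq_spow[OF rt, of s] by auto
  have "spow s n * s = spow s n" by (rule idempotent_spow_absorb[OF rt n(1)])
  then have "y * spow s n * s = y * spow s n" for y by (simp add: mult.assoc)
  moreover have "\<exists>y. x = y * spow s n" if "x * s = x"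
    using mult_spow_fixed[OF that, of n] by metis
  ultimately show ?thesis unfolding content_def left_ideal_def n(2) by auto
qed

text \<open>If x is fixed by \<open>s * t\<close>, then x is fixed by s by R-triviality, and
  therefore also by t.\<close>

lemma content_mult:
  fixes s t :: "'a::{semigroup_mult,finite}"
  assumes rt: "R_trivial TYPE('a)"
  shows "content (s * t) = content s \<inter> content t"
proof -
  have "x * (s * t) = x \<longleftrightarrow> x * s = x \<and> x * t = x" for x
    using R_trivial_absorb[OF rt, of x s t] by (metis mult.assoc)
  then show ?thesis by (auto simp: in_content_iff[OF rt])
qed

lemma content_idempotent:
  fixes e :: "'a::{semigroup_mult,finite}"
  assumes rt: "R_trivial TYPE('a)" and e: "is_idempotent e"
  shows "content e = left_ideal e"
  using e by (auto simp: in_content_iff[OF rt] left_ideal_def is_idempotent_def mult.assoc) metis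

lemma content_in_Lam: "R_trivial TYPE('a::{semigroup_mult,finite}) \<Longrightarrow> content (s::'a) \<in> Lam"
  unfolding Lam_def content_def using omega_eq_spow[of s] by blast

lemma finite_Lam: "finite (Lam :: 'a::{semigroup_mult,finite} set set)"
  by (rule finite_subset[of _ UNIV]) auto


section \<open>The integral semigroup ring\<close>

text \<open>A type copy on which the semigroup product can be the class operation \<open>*\<close>.
  The class \<open>ring\<close> does not demand a unit, whose existence is established only
  later.\<close>

typedef 'a salg = "UNIV :: ('a \<Rightarrow>\<^sub>0 int) set" morphisms pm_of_salg salg_of_pm ..

setup_lifting type_definition_salg

lemma semigroup_mult_ext_simps:
  "semigroup_mult_ext (a + b) c = semigroup_mult_ext a c + semigroup_mult_ext b c"
  "semigroup_mult_ext a (b + c) = semigroup_mult_ext a b + semigroup_mult_ext a c"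
  "semigroup_mult_ext (scale r a) c = scale r (semigroup_mult_ext a c)"
  "semigroup_mult_ext a (scale r c) = scale r (semigroup_mult_ext a c)"
  "semigroup_mult_ext (Poly_Mapping.single s x) (Poly_Mapping.single t y) = Poly_Mapping.single (s * t) (x * y)"
  unfolding semigroup_mult_ext_eq bilin_ext_simps bilin_ext_single by simp_all

instantiation salg :: (semigroup_mult) ring
begin

lift_definition zero_salg :: "'a salg" is 0 .
lift_definition plus_salg :: "'a salg \<Rightarrow> 'a salg \<Rightarrow> 'a salg" is "(+)" .
lift_definition minus_salg :: "'a salg \<Rightarrow> 'a salg \<Rightarrow> 'a salg" is "(-)" .
lift_definition uminus_salg :: "'a salg \<Rightarrow> 'a salg" is uminus .
lift_definition times_salg :: "'a salg \<Rightarrow> 'a salg \<Rightarrow> 'a salg" is semigroup_mult_ext .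

instance
  by standard
    (transfer, simp add: semigroup_mult_ext_assoc semigroup_mult_ext_simps algebra_simps)+

end

lift_definition int_scale :: "int \<Rightarrow> 'a salg \<Rightarrow> 'a salg" is scale .
lift_definition gen :: "'a \<Rightarrow> 'a salg" is "\<lambda>s. Poly_Mapping.single s 1" .
lift_definition coef :: "'a salg \<Rightarrow> 'a \<Rightarrow> int" is Poly_Mapping.lookup .

lemma salg_eqI: "(\<And>s. coef a s = coef b s) \<Longrightarrow> a = b"
  by transfer (rule poly_mapping_eqI)

lemma coef_simps [simp]:
  "coef 0 s = 0" "coef (a + b) s = coef a s + coef b s" "coef (a - b) s = coef a s - coef b s"
  "coef (- a) s = - coef a s" "coef (int_scale c a) s = c * coef a s"
  by (transfer, simp add: lookup_add lookup_minus)+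

lemma coef_gen: "coef (gen s) t = (if s = t then 1 else 0)"
  by transfer (simp add: lookup_single when_def)

lemma coef_sum: "coef (\<Sum>x\<in>A. g x) s = (\<Sum>x\<in>A. coef (g x) s)"
  by (induction A rule: infinite_finite_induct) auto

lemma int_scale_simps:
  "int_scale c (a + b) = int_scale c a + int_scale c b" "int_scale c (a - b) = int_scale c a - int_scale c b"
  "int_scale (c + d) a = int_scale c a + int_scale d a" "int_scale c (int_scale d a) = int_scale (c * d) a"
  "int_scale 1 a = a" "int_scale 0 a = 0" "int_scale c 0 = 0" "int_scale (- c) a = - int_scale c a"
  by (rule salg_eqI, simp add: algebra_simps)+

lemma int_scale_mult: "int_scale c a * b = int_scale c (a * b)" "a * int_scale c b = int_scale c (a * b)"
  by (transfer, simp add: semigroup_mult_ext_simps)+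

lemma int_scale_sum_left: "(\<Sum>x\<in>A. int_scale (g x) b) = int_scale (\<Sum>x\<in>A. g x) b"
  by (rule salg_eqI) (simp add: coef_sum sum_distrib_right)

lemma gen_mult: "gen s * gen t = gen (s * t)"
  by transfer (simp add: semigroup_mult_ext_simps)

lemma salg_expand: "(a :: 'a::{semigroup_mult,finite} salg) = (\<Sum>s\<in>UNIV. int_scale (coef a s) (gen s))"
  by (rule salg_eqI) (simp add: coef_sum coef_gen if_distrib cong: if_cong)

lemma mult_expand:
  fixes a b :: "'a::{semigroup_mult,finite} salg"
  shows "a * b = (\<Sum>s\<in>UNIV. \<Sum>t\<in>UNIV. int_scale (coef a s * coef b t) (gen (s * t)))"
proof -
  have "a * b = (\<Sum>s\<in>UNIV. int_scale (coef a s) (gen s)) * (\<Sum>t\<in>UNIV. int_scale (coef b t) (gen t))"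
    using salg_expand[of a] salg_expand[of b] by metis
  also have "\<dots> = (\<Sum>s\<in>UNIV. \<Sum>t\<in>UNIV. int_scale (coef a s * coef b t) (gen (s * t)))"
    by (simp only: sum_product int_scale_mult int_scale_simps gen_mult mult.commute)
  finally show ?thesis .
qed

text \<open>Additive subgroups serve as induction predicates: a property is shown for all of
  \<open>rad\<close> by checking that the elements having it form a subgroup that contains
  generators.\<close>

definition subgrp :: "'a::ab_group_add set \<Rightarrow> bool" where
  "subgrp H \<longleftrightarrow> 0 \<in> H \<and> (\<forall>a\<in>H. \<forall>b\<in>H. a - b \<in> H)"

lemma
  assumes "subgrp H"
  shows subgrp_0: "0 \<in> H"
    and subgrp_diff: "a \<in> H \<Longrightarrow> b \<in> H \<Longrightarrow> a - b \<in> H"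
    and subgrp_uminus: "a \<in> H \<Longrightarrow> - a \<in> H"
    and subgrp_add: "a \<in> H \<Longrightarrow> b \<in> H \<Longrightarrow> a + b \<in> H"
proof -
  show 0: "0 \<in> H" and d: "a \<in> H \<Longrightarrow> b \<in> H \<Longrightarrow> a - b \<in> H" for a b
    using assms by (auto simp: subgrp_def)
  show u: "- a \<in> H" if "a \<in> H" for a using d[OF 0 that] by simp
  show "a \<in> H \<Longrightarrow> b \<in> H \<Longrightarrow> a + b \<in> H" using d[of a "- b"] u[of b] by simp
qed

lemma subgrp_sum: "subgrp H \<Longrightarrow> (\<And>x. x \<in> A \<Longrightarrow> g x \<in> H) \<Longrightarrow> (\<Sum>x\<in>A. g x) \<in> H"
  by (induction A rule: infinite_finite_induct) (auto simp: subgrp_0 subgrp_add)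

lemma subgrp_int_scale:
  assumes H: "subgrp H" and a: "a \<in> H"
  shows "int_scale c a \<in> H"
proof -
  have n: "int_scale (int n) a \<in> H" for n
    by (induction n) (auto simp: int_scale_simps subgrp_0[OF H] subgrp_add[OF H] a)
  show ?thesis
  proof (cases "c \<ge> 0")
    case True
    then show ?thesis using n[of "nat c"] by simp
  next
    case False
    then have "int_scale c a = - int_scale (int (nat (- c))) a" by (simp flip: int_scale_simps(8))
    then show ?thesis using subgrp_uminus[OF H n[of "nat (- c)"]] by simp
  qed
qed

text \<open>Linear functionals that are 0/1-valued on the basis \<open>S\<close>; both the characters of \<open>\<int>S\<close>
  and the coordinates on \<open>Z_set\<close> are of this form.\<close>

definition weight :: "('a \<Rightarrow> bool) \<Rightarrow> 'a::{semigroup_mult,finite} salg \<Rightarrow> int" where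
  "weight P a = (\<Sum>s\<in>{s. P s}. coef a s)"

lemma weight_simps [simp]:
  "weight P 0 = 0" "weight P (a + b) = weight P a + weight P b"
  "weight P (a - b) = weight P a - weight P b" "weight P (- a) = - weight P a"
  "weight P (int_scale c a) = c * weight P a"
  by (simp_all add: weight_def sum.distrib sum_subtractf sum_negf sum_distrib_left)

lemma weight_sum: "weight P (\<Sum>x\<in>A. g x) = (\<Sum>x\<in>A. weight P (g x))"
  by (induction A rule: infinite_finite_induct) auto

lemma weight_gen [simp]: "weight P (gen s) = of_bool (P s)"
  by (simp add: weight_def coef_gen)

definition chi :: "'a::{semigroup_mult,finite} set \<Rightarrow> 'a salg \<Rightarrow> int" where
  "chi X = weight (\<lambda>s. X \<subseteq> content s)"

lemma chi_simps [simp]: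
  "chi X 0 = 0" "chi X (a + b) = chi X a + chi X b"
  "chi X (a - b) = chi X a - chi X b" "chi X (- a) = - chi X a"
  "chi X (int_scale c a) = c * chi X a" "chi X (gen s) = of_bool (X \<subseteq> content s)"
  by (simp_all add: chi_def)

lemma chi_sum: "chi X (\<Sum>x\<in>A. g x) = (\<Sum>x\<in>A. chi X (g x))"
  by (simp add: chi_def weight_sum)

lemma chi_expand: "chi X a = (\<Sum>s\<in>UNIV. coef a s * of_bool (X \<subseteq> content s))"
  by (subst salg_expand) (simp add: chi_sum)

lemma chi_mult:
  fixes a b :: "'a::{semigroup_mult,finite} salg"
  assumes "R_trivial TYPE('a)"
  shows "chi X (a * b) = chi X a * chi X b"
proof -
  have "chi X (a * b) = (\<Sum>s\<in>UNIV. \<Sum>t\<in>UNIV. (coef a s * of_bool (X \<subseteq> content s)) * (coef b t * of_bool (X \<subseteq> content t)))"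
    unfolding mult_expand[of a b] chi_sum chi_simps content_mult[OF assms]
    by (intro sum.cong refl) auto
  also have "\<dots> = chi X a * chi X b"
    unfolding chi_expand sum_product ..
  finally show ?thesis .
qed

text \<open>The kernel of \<open>\<int>S \<rightarrow> \<int>\<Lambda>(S)\<close>; by Moebius inversion this is the intersection of the kernels of
  all characters.\<close>

definition rad :: "'a::{semigroup_mult,finite} salg set" where
  "rad = {a. \<forall>X\<in>Lam. chi X a = 0}"

lemma subgrp_rad: "subgrp rad"
  by (simp add: rad_def subgrp_def)

lemma
  assumes "R_trivial TYPE('a::{semigroup_mult,finite})" "(a :: 'a salg) \<in> rad"
  shows rad_mult_left: "b * a \<in> rad" and rad_mult_right: "a * b \<in> rad"
  using assms(2) by (auto simp: rad_def chi_mult[OF assms(1)])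

lemma gen_diff_in_rad: "content s = content t \<Longrightarrow> gen s - gen t \<in> rad"
  by (simp add: rad_def)

text \<open>Moebius inversion as an induction from the largest contents downwards:
  \<open>chi X\<close> adds up the sums over the fibres above X, and all of these except the one at
  X vanish by the induction hypothesis.\<close>

lemma fibre_sum_rad:
  fixes a :: "'a::{semigroup_mult,finite} salg"
  assumes rt: "R_trivial TYPE('a)" and a: "a \<in> rad" and X: "X \<in> Lam"
  shows "(\<Sum>s\<in>{s. content s = X}. coef a s) = 0"
  using X
proof (induction "card (- X)" arbitrary: X rule: less_induct)
  case less
  let ?T = "{Y \<in> Lam. X \<subseteq> Y}"
  have "chi X a = (\<Sum>s\<in>{s. X \<subseteq> content s}. coef a s)" by (simp add: chi_def weight_def)
  also have "\<dots> = (\<Sum>Y\<in>?T. \<Sum>s\<in>{s \<in> {s. X \<subseteq> content s}. content s = Y}. coef a s)"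
    by (rule sum.group[symmetric]) (auto simp: content_in_Lam[OF rt] intro: finite_subset[OF _ finite_Lam])
  also have "\<dots> = (\<Sum>Y\<in>?T. \<Sum>s\<in>{s. content s = Y}. coef a s)"
    by (intro sum.cong) auto
  also have "\<dots> = (\<Sum>Y\<in>{X}. \<Sum>s\<in>{s. content s = Y}. coef a s)"
  proof (rule sum.mono_neutral_right)
    show "\<forall>Y\<in>?T - {X}. (\<Sum>s\<in>{s. content s = Y}. coef a s) = 0"
    proof
      fix Y assume Y: "Y \<in> ?T - {X}"
      then have "- Y \<subset> - X" by auto
      then have "card (- Y) < card (- X)" by (intro psubset_card_mono) auto
      then show "(\<Sum>s\<in>{s. content s = Y}. coef a s) = 0" using less.hyps Y by auto
    qed
  qed (use less.prems in \<open>auto intro: finite_subset[OF _ finite_Lam]\<close>)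
  finally show ?case using a less.prems by (simp add: rad_def)
qed

text \<open>Comparing each s with a fixed representative of its content leaves over, for each
  content, a multiple of the representative by the fibre sum, which is zero.\<close>

lemma rad_induct:
  fixes a :: "'a::{semigroup_mult,finite} salg"
  assumes rt: "R_trivial TYPE('a)" and a: "a \<in> rad" and H: "subgrp H"
    and gens: "\<And>s t. content s = content t \<Longrightarrow> gen s - gen t \<in> H"
  shows "a \<in> H"
proof -
  define r where "r X = (SOME s::'a. content s = X)" for X
  have r: "content (r (content s)) = content s" for s
    unfolding r_def by (rule someI[of _ s]) simp
  have "(\<Sum>s\<in>UNIV. int_scale (coef a s) (gen s - gen (r (content s)))) \<in> H"
    by (intro subgrp_sum[OF H] subgrp_int_scale[OF H] gens) (simp add: r)
  also have "(\<Sum>s\<in>UNIV. int_scale (coef a s) (gen s - gen (r (content s)))) =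
      a - (\<Sum>s\<in>UNIV. int_scale (coef a s) (gen (r (content s))))"
    by (subst (2) salg_expand) (simp add: int_scale_simps sum_subtractf)
  also have "(\<Sum>s\<in>UNIV. int_scale (coef a s) (gen (r (content s)))) =
      (\<Sum>X\<in>Lam. \<Sum>s\<in>{s\<in>UNIV. content s = X}. int_scale (coef a s) (gen (r (content s))))"
    by (rule sum.group[symmetric]) (auto simp: content_in_Lam[OF rt] finite_Lam)
  also have "\<dots> = (\<Sum>X\<in>Lam. int_scale (\<Sum>s\<in>{s. content s = X}. coef a s) (gen (r X)))"
  proof (rule sum.cong[OF refl])
    fix X :: "'a set"
    have "(\<Sum>s\<in>{s\<in>UNIV. content s = X}. int_scale (coef a s) (gen (r (content s)))) =
        (\<Sum>s\<in>{s. content s = X}. int_scale (coef a s) (gen (r X)))"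
      by (rule sum.cong) auto
    then show "(\<Sum>s\<in>{s\<in>UNIV. content s = X}. int_scale (coef a s) (gen (r (content s)))) =
        int_scale (\<Sum>s\<in>{s. content s = X}. coef a s) (gen (r X))"
      by (simp only: int_scale_sum_left)
  qed
  also have "\<dots> = 0"
    by (simp add: fibre_sum_rad[OF rt a] int_scale_simps)
  finally show ?thesis by simp
qed

text \<open>Used to reduce statements about a factor killed by one character to basis elements below
  or above X.\<close>

lemma chi_kernel_induct:
  fixes a :: "'a::{semigroup_mult,finite} salg"
  assumes e: "X \<subseteq> content e" and a: "chi X a = 0" and H: "subgrp H"
    and "\<And>s. \<not> X \<subseteq> content s \<Longrightarrow> gen s \<in> H"
    and "\<And>s t. X \<subseteq> content s \<Longrightarrow> X \<subseteq> content t \<Longrightarrow> gen s - gen t \<in> H"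
  shows "a \<in> H"
proof -
  \<comment> \<open>The subtracted term is zero; it distributes one copy of \<open>gen e\<close> to
    every s above X.\<close>
  have "a = (\<Sum>s\<in>UNIV. int_scale (coef a s) (gen s)) - int_scale (chi X a) (gen e)"
    using salg_expand[of a] by (simp add: a int_scale_simps)
  also have "\<dots> = (\<Sum>s\<in>UNIV. int_scale (coef a s) (gen s - int_scale (of_bool (X \<subseteq> content s)) (gen e)))"
  proof -
    have "int_scale (chi X a) (gen e) = (\<Sum>s\<in>UNIV. int_scale (coef a s) (int_scale (of_bool (X \<subseteq> content s)) (gen e)))"
      unfolding chi_expand int_scale_simps(4) int_scale_sum_left ..
    then show ?thesis by (simp add: int_scale_simps(2) sum_subtractf)
  qed
  also have "\<dots> \<in> H"
    by (intro subgrp_sum[OF H] subgrp_int_scale[OF H]) (use assms in \<open>auto simp: of_bool_def int_scale_simps\<close>)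
  finally show ?thesis .
qed


section \<open>Filtration by the R-order and lifting of idempotents\<close>

definition R_height :: "'a::semigroup_mult \<Rightarrow> nat" where
  "R_height s = card (right_ideal1 s)"

lemma R_height_mult_less:
  fixes x s :: "'a::{semigroup_mult,finite}"
  assumes rt: "R_trivial TYPE('a)" and ne: "x * s \<noteq> x"
  shows "R_height (x * s) < R_height x"
proof -
  have sub: "right_ideal1 (x * s) \<subseteq> right_ideal1 x"
    by (auto simp: right_ideal1_def mult.assoc)
  have "right_ideal1 (x * s) \<noteq> right_ideal1 x"
  proof
    assume eq: "right_ideal1 (x * s) = right_ideal1 x"
    have "antisym (R_le :: 'a rel)"
      using rt by (simp add: R_trivial_def partial_order_on_def)
    then have "x * s = x"
      by (rule antisymD) (simp_all add: R_le_def eq)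
    with ne show False ..
  qed
  with sub show ?thesis
    unfolding R_height_def by (intro psubset_card_mono) auto
qed

lemma R_height_pos: "0 < R_height (s :: 'a::{semigroup_mult,finite})"
  unfolding R_height_def by (subst card_gt_0_iff) (auto simp: right_ideal1_def)

text \<open>Heights range from 1 to the number of elements of the semigroup, so the chain starts at
  zero and exhausts everything at that index.\<close>

definition low :: "nat \<Rightarrow> 'a::semigroup_mult salg set" where
  "low i = {a. \<forall>s. coef a s \<noteq> 0 \<longrightarrow> R_height s \<le> i}"

lemma subgrp_low: "subgrp (low i)"
  by (auto simp: subgrp_def low_def) (metis diff_0_right)

lemma low_0: "(a :: 'a::{semigroup_mult,finite} salg) \<in> low 0 \<Longrightarrow> a = 0"
proof (rule salg_eqI)
  fix s assume "a \<in> low 0"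
  then show "coef a s = coef 0 s"
    using R_height_pos[of s] by (cases "coef a s = 0") (auto simp: low_def)
qed

lemma low_top: "(a :: 'a::{semigroup_mult,finite} salg) \<in> low (card (UNIV :: 'a set))"
  by (auto simp: low_def R_height_def intro: card_mono)

lemma low_mono: "i \<le> j \<Longrightarrow> low i \<subseteq> low j"
  by (auto simp: low_def)

lemma gen_low: "R_height s \<le> i \<Longrightarrow> gen s \<in> low i"
  by (auto simp: low_def coef_gen)

lemma left_mult_expand:
  fixes a b :: "'a::{semigroup_mult,finite} salg"
  shows "a * b = (\<Sum>x\<in>UNIV. int_scale (coef a x) (gen x * b))"
  by (subst salg_expand[of a]) (simp add: sum_distrib_right int_scale_mult)

lemma low_mult_subgrp:
  fixes a b :: "'a::{semigroup_mult,finite} salg"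
  assumes a: "a \<in> low i" and H: "subgrp H" and g: "\<And>x. R_height x \<le> i \<Longrightarrow> gen x * b \<in> H"
  shows "a * b \<in> H"
  unfolding left_mult_expand[of a b]
proof (rule subgrp_sum[OF H])
  fix x
  show "int_scale (coef a x) (gen x * b) \<in> H"
    by (cases "coef a x = 0") (use a g in \<open>auto simp: int_scale_simps subgrp_0[OF H] low_def intro: subgrp_int_scale[OF H]\<close>)
qed

text \<open>If s and t have equal content, an element x is fixed on the right by both, and the two
  products cancel, or by neither, and both products have smaller height.\<close>

lemma low_mult_rad:
  fixes a n :: "'a::{semigroup_mult,finite} salg"
  assumes rt: "R_trivial TYPE('a)" and a: "a \<in> low i" and n: "n \<in> rad"
  shows "a * n \<in> low (i - 1)"
proof -
  have "n \<in> {n. a * n \<in> low (i - 1)}"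
  proof (rule rad_induct[OF rt n])
    show "subgrp {n. a * n \<in> low (i - 1)}"
      using subgrp_low[of "i - 1"] by (auto simp: subgrp_def right_diff_distrib)
    fix s t :: 'a assume st: "content s = content t"
    have "a * (gen s - gen t) \<in> low (i - 1)"
    proof (rule low_mult_subgrp[OF a subgrp_low])
      fix x :: 'a assume x: "R_height x \<le> i"
      show "gen x * (gen s - gen t) \<in> low (i - 1)"
      proof (cases "x \<in> content s")
        case True
        then have "x * s = x" "x * t = x" using st by (auto simp: in_content_iff[OF rt])
        then show ?thesis by (simp add: right_diff_distrib gen_mult subgrp_0[OF subgrp_low])
      next
        case False
        then have "x * s \<noteq> x" "x * t \<noteq> x" using st by (auto simp: in_content_iff[OF rt])
        then have "R_height (x * s) \<le> i - 1" "R_height (x * t) \<le> i - 1"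
          using R_height_mult_less[OF rt, of x s] R_height_mult_less[OF rt, of x t] x by auto
        then show ?thesis
          by (auto simp: right_diff_distrib gen_mult intro!: subgrp_diff[OF subgrp_low] gen_low)
      qed
    qed
    then show "gen s - gen t \<in> {n. a * n \<in> low (i - 1)}" by simp
  qed
  then show ?thesis by simp
qed

text \<open>A multiplicative filtration by the amount by which right multiplication lowers heights.
  It replaces the powers of \<open>rad\<close>: it contains \<open>rad\<close> in degree 1, degrees
  add under products, and elements of degree at least the size of the semigroup act as zero.\<close>

definition fil :: "nat \<Rightarrow> 'a::semigroup_mult salg set" where
  "fil k = {a. \<forall>i. \<forall>x\<in>low i. x * a \<in> low (i - k)}"

lemma subgrp_fil: "subgrp (fil k)"
  using subgrp_low by (fastforce simp: subgrp_def fil_def right_diff_distrib)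

lemma fil_mult: "a \<in> fil k \<Longrightarrow> b \<in> fil l \<Longrightarrow> a * b \<in> fil (k + l)"
  unfolding fil_def by (auto simp: mult.assoc[symmetric]) (metis diff_diff_left)

lemma fil_mono: "k \<le> l \<Longrightarrow> fil l \<subseteq> fil k"
  unfolding fil_def using low_mono[OF diff_le_mono2] by blast

lemma rad_subset_fil: "R_trivial TYPE('a::{semigroup_mult,finite}) \<Longrightarrow> (rad :: 'a salg set) \<subseteq> fil 1"
  unfolding fil_def using low_mult_rad by blast

text \<open>The conclusion concerns products only; \<open>a = 0\<close> follows once a left unit is
  available.\<close>

lemma fil_top: "a \<in> fil (card (UNIV :: 'a set)) \<Longrightarrow> x * (a :: 'a::{semigroup_mult,finite} salg) = 0"
  unfolding fil_def using low_top[of x] by (intro low_0) force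

text \<open>One Newton step for the equation \<open>e\<^sup>2 = e\<close>, written without a unit:
  \<open>e + d - 2 e d = 3 e\<^sup>2 - 2 e\<^sup>3\<close>.\<close>

lemma newton_step:
  fixes e :: "'r::ring"
  defines "d \<equiv> e * e - e"
  defines "e' \<equiv> e + d - e * d - e * d"
  shows "e' * e' - e' = d * d * d + d * d * d + d * d * d + d * d * d - d * d - d * d - d * d"
  unfolding e'_def d_def by (simp add: algebra_simps)

text \<open>Newton iteration: by \<open>newton_step\<close> the new error is a polynomial in the old
  one without terms of degree below 2, so its degree in \<open>fil\<close> grows. The iterates are
  polynomials in a without constant term, and this gives the two annihilation clauses, which later
  yield orthogonality.\<close>

lemma lift_idempotent:
  fixes a :: "'a::{semigroup_mult,finite} salg"
  assumes rt: "R_trivial TYPE('a)" and a: "a * a - a \<in> rad"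
  obtains e where "e * e = e" "e - a \<in> rad"
    "\<And>x. a * x = 0 \<Longrightarrow> e * x = 0" "\<And>x. x * a = 0 \<Longrightarrow> x * e = 0"
proof -
  let ?P = "\<lambda>e. e * e - e \<in> rad \<and> e - a \<in> rad \<and> (\<forall>x. a * x = 0 \<longrightarrow> e * x = 0) \<and> (\<forall>x. x * a = 0 \<longrightarrow> x * e = 0)"
  let ?n = "\<lambda>e. e + (e * e - e) - e * (e * e - e) - e * (e * e - e)"
  note R = subgrp_rad[where 'a = 'a]
  have step: "?P (?n e)" if e: "?P e" for e
  proof -
    let ?d = "e * e - e"
    have d: "?d \<in> rad" using e by simp
    have "?n e * ?n e - ?n e \<in> rad"
      unfolding newton_step by (intro subgrp_add[OF R] subgrp_diff[OF R] rad_mult_left[OF rt] d)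
    moreover have "?n e - a \<in> rad"
    proof -
      have eq: "?n e - a = (e - a) + ?d - e * ?d - e * ?d" by simp
      have "e - a \<in> rad" using e by blast
      then show ?thesis
        unfolding eq
        by (rule subgrp_diff[OF R subgrp_diff[OF R subgrp_add[OF R _ d] rad_mult_left[OF rt d]]
              rad_mult_left[OF rt d]])
    qed
    moreover have "?n e * x = 0" if "a * x = 0" for x
    proof -
      have "e * x = 0" using e that by blast
      then show ?thesis by (simp add: algebra_simps)
    qed
    moreover have "x * ?n e = 0" if "x * a = 0" for x
    proof -
      have "x * e = 0" using e that by blast
      then show ?thesis by (simp add: algebra_simps flip: mult.assoc)
    qed
    ultimately show ?thesis by blast
  qed
  have "\<exists>e. ?P e \<and> e * e - e \<in> fil (Suc k)" for k
  proof (induction k)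
    case 0
    then show ?case using a rad_subset_fil[OF rt] by (intro exI[of _ a]) (auto simp: subgrp_0[OF R])
  next
    case (Suc k)
    then obtain e where e: "?P e" "e * e - e \<in> fil (Suc k)" by blast
    note F = subgrp_fil[where 'a = 'a]
    have dd: "(e * e - e) * (e * e - e) \<in> fil (Suc (Suc k))"
      using fil_mult[OF e(2) e(2)] fil_mono[of "Suc (Suc k)" "Suc k + Suc k"] by auto
    have ddd: "(e * e - e) * (e * e - e) * (e * e - e) \<in> fil (Suc (Suc k))"
      using fil_mult[OF dd e(2)] fil_mono[of "Suc (Suc k)" "Suc (Suc k) + Suc k"] by auto
    have "?n e * ?n e - ?n e \<in> fil (Suc (Suc k))"
      unfolding newton_step by (intro subgrp_add[OF F] subgrp_diff[OF F] dd ddd)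
    then show ?case using step[OF e(1)] by blast
  qed
  then obtain e where e: "?P e" "e * e - e \<in> fil (Suc (card (UNIV :: 'a set)))" by blast
  then have "e * e - e \<in> fil (card (UNIV :: 'a set))" using fil_mono[of "card (UNIV :: 'a set)" "Suc (card (UNIV :: 'a set))"] by auto
  note z = fil_top[OF this]
  \<comment> \<open>It is only known that products with right factor \<open>e * e - e\<close>
    vanish. The error after one more step consists of such products, so it is exactly zero.\<close>
  have "?n e * ?n e - ?n e = 0" by (rule trans[OF newton_step]) (simp only: z, simp)
  then show ?thesis using step[OF e(1)] by (intro that[of "?n e"]) auto
qed

section \<open>Integral orthogonal idempotents indexed by the contents\<close>

lemma Lam_content:
  assumes "R_trivial TYPE('a::{semigroup_mult,finite})" "X \<in> (Lam :: 'a set set)"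
  obtains s where "content s = X"
  using assms content_idempotent[OF assms(1)] unfolding Lam_def by blast

text \<open>For s of content X the characters of \<open>gen s\<close> are 1 exactly at the contents
  below X; subtracting the elements already built for the strictly smaller contents leaves X alone.
  No division occurs.\<close>

lemma moebius_element:
  assumes rt: "R_trivial TYPE('a::{semigroup_mult,finite})" and "X \<in> (Lam :: 'a set set)"
  shows "\<exists>\<epsilon>. \<forall>Z\<in>Lam. chi Z \<epsilon> = of_bool (Z = X)"
  using assms(2)
proof (induction "card X" arbitrary: X rule: less_induct)
  case less
  let ?T = "{Y \<in> Lam. Y \<subset> X}"
  have "\<forall>Y\<in>?T. \<exists>\<epsilon>. \<forall>Z\<in>Lam. chi Z \<epsilon> = of_bool (Z = Y)"
  proof
    fix Y assume Y: "Y \<in> ?T"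
    then have "card Y < card X" by (intro psubset_card_mono) auto
    then show "\<exists>\<epsilon>. \<forall>Z\<in>Lam. chi Z \<epsilon> = of_bool (Z = Y)" using less.hyps Y by blast
  qed
  then obtain \<epsilon> where eps: "\<And>Y Z. Y \<in> ?T \<Longrightarrow> Z \<in> Lam \<Longrightarrow> chi Z (\<epsilon> Y) = of_bool (Z = Y)" by metis
  obtain s where s: "content s = X" using Lam_content[OF rt less.prems] by blast
  have fin: "finite ?T" by (rule finite_subset[OF _ finite_Lam]) auto
  have "chi Z (gen s - (\<Sum>Y\<in>?T. \<epsilon> Y)) = of_bool (Z = X)" if Z: "Z \<in> Lam" for Z
  proof -
    have "(\<Sum>Y\<in>?T. chi Z (\<epsilon> Y)) = (\<Sum>Y\<in>?T. if Z = Y then 1 else 0)"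
      by (intro sum.cong refl) (simp add: eps Z)
    also have "\<dots> = of_bool (Z \<in> ?T)" using fin by simp
    finally show ?thesis using Z by (auto simp: chi_sum s)
  qed
  then show ?case by blast
qed

text \<open>Idempotents are added one at a time. The new candidate is first made orthogonal to the
  sum \<open>E\<close> of the old ones and then lifted; the annihilation clauses of
  \<open>lift_idempotent\<close> keep it orthogonal.\<close>

lemma orthogonal_idempotents:
  assumes rt: "R_trivial TYPE('a::{semigroup_mult,finite})" and "finite F" "F \<subseteq> (Lam :: 'a set set)"
  shows "\<exists>e :: 'a set \<Rightarrow> 'a salg. (\<forall>X\<in>F. \<forall>Y\<in>F. e X * e Y = (if X = Y then e X else 0)) \<and>
    (\<forall>X\<in>F. \<forall>Z\<in>Lam. chi Z (e X) = of_bool (Z = X))"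
  using assms(2,3)
proof (induction F)
  case (insert X F)
  then obtain e :: "'a set \<Rightarrow> 'a salg" where
    *: "(\<forall>X\<in>F. \<forall>Y\<in>F. e X * e Y = (if X = Y then e X else 0)) \<and> (\<forall>X\<in>F. \<forall>Z\<in>Lam. chi Z (e X) = of_bool (Z = X))"
    by blast
  then have e: "e Y * e Z = (if Y = Z then e Y else 0)" if "Y \<in> F" "Z \<in> F" for Y Z
    using that by blast
  from * have chi: "chi Z (e Y) = of_bool (Z = Y)" if "Y \<in> F" "Z \<in> Lam" for Y Z
    using that by blast
  define E where "E = (\<Sum>Y\<in>F. e Y)"
  have eE: "e Y * E = e Y" if "Y \<in> F" for Y
  proof -
    have "e Y * E = (\<Sum>Z\<in>F. if Y = Z then e Y else 0)"
      unfolding E_def sum_distrib_left by (intro sum.cong refl) (simp add: e that)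
    then show ?thesis using insert.hyps that by simp
  qed
  have Ee: "E * e Y = e Y" if "Y \<in> F" for Y
  proof -
    have "E * e Y = (\<Sum>Z\<in>F. if Y = Z then e Y else 0)"
      unfolding E_def sum_distrib_right by (intro sum.cong refl) (auto simp add: e that)
    then show ?thesis using insert.hyps that by simp
  qed
  have chiE: "chi Z E = of_bool (Z \<in> F)" if "Z \<in> Lam" for Z
  proof -
    have "chi Z E = (\<Sum>Y\<in>F. if Z = Y then 1 else 0)"
      unfolding E_def chi_sum by (intro sum.cong refl) (simp add: chi that)
    then show ?thesis using insert.hyps by simp
  qed
  obtain \<epsilon> where eps: "\<And>Z. Z \<in> Lam \<Longrightarrow> chi Z \<epsilon> = of_bool (Z = X)"
    using moebius_element[OF rt, of X] insert.prems by auto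
  \<comment> \<open>This is (1 - E) \<epsilon> (1 - E), expanded because no unit is
    available.\<close>
  define a where "a = \<epsilon> - E * \<epsilon> - \<epsilon> * E + E * \<epsilon> * E"
  have chia: "chi Z a = of_bool (Z = X)" if "Z \<in> Lam" for Z
    using insert.hyps that by (auto simp: a_def chi_mult[OF rt] eps chiE)
  have "a * a - a \<in> rad" by (simp add: rad_def chi_mult[OF rt] chia)
  then obtain g where g: "g * g = g" "g - a \<in> rad"
    "\<And>x. a * x = 0 \<Longrightarrow> g * x = 0" "\<And>x. x * a = 0 \<Longrightarrow> x * g = 0"
    using lift_idempotent[OF rt] by metis
  have chig: "chi Z g = of_bool (Z = X)" if "Z \<in> Lam" for Z
    using g(2) that by (auto simp: rad_def chia)
  have ga: "e Y * g = 0" if "Y \<in> F" for Y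
  proof (rule g(4))
    have "e Y * (E * b) = e Y * b" for b using eE[OF that] by (metis mult.assoc)
    then show "e Y * a = 0" by (simp add: a_def distrib_left right_diff_distrib mult.assoc)
  qed
  have ag: "g * e Y = 0" if "Y \<in> F" for Y
  proof (rule g(3))
    show "a * e Y = 0" by (simp add: a_def distrib_right left_diff_distrib mult.assoc Ee[OF that])
  qed
  have "X \<notin> F" by (rule insert.hyps)
  then show ?case
    by (intro exI[of _ "e(X := g)"]) (use e chi ga ag g(1) chig in auto)
qed simp

section \<open>The sum of the idempotents is a unit\<close>

text \<open>If \<open>s = s * x\<close>, then s - s E equals s (x - x E), whose right factor is in
  \<open>rad\<close>, so its height is below that of s.\<close>

lemma right_unit:
  fixes E :: "'a::{semigroup_mult,finite} salg"
  assumes rt: "R_trivial TYPE('a)" and r: "\<And>s::'a. \<exists>x. s = s * x"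
    and E: "E * E = E" "\<And>Z. Z \<in> Lam \<Longrightarrow> chi Z E = 1"
  shows "a * E = a"
proof -
  have lower: "a - a * E \<in> low (i - 1)" if a: "a \<in> low i" for a i
  proof -
    have "a - a * E = (\<Sum>s\<in>UNIV. int_scale (coef a s) (gen s - gen s * E))"
      unfolding int_scale_simps sum_subtractf left_mult_expand[symmetric] salg_expand[symmetric] ..
    also have "\<dots> \<in> low (i - 1)"
    proof (rule subgrp_sum[OF subgrp_low])
      fix s
      show "int_scale (coef a s) (gen s - gen s * E) \<in> low (i - 1)"
      proof (cases "coef a s = 0")
        case True
        then show ?thesis by (simp add: int_scale_simps subgrp_0[OF subgrp_low])
      next
        case False
        then have s: "gen s \<in> low i" using a by (intro gen_low) (auto simp: low_def)
        obtain x where x: "s = s * x" using r by blast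
        have "gen x - gen x * E \<in> rad" by (simp add: rad_def chi_mult[OF rt] E)
        then have "gen s * (gen x - gen x * E) \<in> low (i - 1)" by (rule low_mult_rad[OF rt s])
        also have "gen s * (gen x - gen x * E) = gen s - gen s * E"
          using x by (simp add: right_diff_distrib gen_mult flip: mult.assoc)
        finally show ?thesis by (rule subgrp_int_scale[OF subgrp_low])
      qed
    qed
    finally show ?thesis .
  qed
  have "a - a * E = 0" if "a \<in> low i" for i a
    using that
  proof (induction i arbitrary: a)
    case 0
    then show ?case using low_0 by fastforce
  next
    case (Suc i)
    then have "a - a * E \<in> low i" using lower[of a "Suc i"] by simp
    \<comment> \<open>As \<open>(a - a * E) * E = 0\<close>, applying the operation to
      \<open>a - a * E\<close> changes nothing, so the induction hypothesis for this element is the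
      claim for a.\<close>
    from Suc.IH[OF this] show ?case by (simp add: left_diff_distrib mult.assoc E)
  qed
  from this[OF low_top] show ?thesis by simp
qed

text \<open>Connectedness improves the generating set of the radical to differences with a common
  left stabilizer.\<close>

lemma rad_induct_connected:
  fixes a :: "'a::{semigroup_mult,finite} salg"
  assumes c: "connected_R_trivial TYPE('a)" and a: "a \<in> rad" and H: "subgrp H"
    and gens: "\<And>s t x. content s = content t \<Longrightarrow> x * s = s \<Longrightarrow> x * t = t \<Longrightarrow> gen s - gen t \<in> H"
  shows "a \<in> H"
proof (rule rad_induct[OF _ a H])
  show "R_trivial TYPE('a)" using c by (simp add: connected_R_trivial_def)
  fix s t :: 'a assume st: "content s = content t"
  let ?r = "{(s::'a, t). content s = content t \<and> (\<exists>x. x * s = s \<and> x * t = t)}"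
  \<comment> \<open>Membership of the difference in a subgroup is an equivalence relation, so it
    contains the relation generated by its known instances.\<close>
  let ?e = "{(s::'a, t). gen s - gen t \<in> H}"
  have "equiv UNIV ?e"
  proof (intro equivI)
    show "refl ?e" by (simp add: refl_on_def subgrp_0[OF H])
    show "sym ?e" using subgrp_uminus[OF H] by (fastforce simp: sym_def)
    show "trans ?e" using subgrp_add[OF H] by (fastforce simp: trans_def)
  qed auto
  moreover have "?r \<subseteq> ?e" using gens by auto
  ultimately have "generated_equiv UNIV ?r \<subseteq> ?e" unfolding generated_equiv_def by (intro Inter_lower) simp
  moreover have "(s, t) \<in> generated_equiv UNIV ?r"
    using c st unfolding connected_R_trivial_def by blast
  ultimately show "gen s - gen t \<in> H" by auto
qed

text \<open>To lower heights a radical factor is needed on the right. If x fixes s and t from the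
  left, (s - t) - E (s - t) equals (x - E x) (s - t): the left factor is bounded by the induction
  hypothesis, applied to x, and the right factor lies in \<open>rad\<close>. This is where
  connectedness enters.\<close>

lemma left_unit:
  fixes E :: "'a::{semigroup_mult,finite} salg"
  assumes c: "connected_R_trivial TYPE('a)"
    and E: "E * E = E" "\<And>Z. Z \<in> Lam \<Longrightarrow> chi Z E = 1"
  shows "E * a = a"
proof -
  have rt: "R_trivial TYPE('a)" using c by (simp add: connected_R_trivial_def)
  have "a - E * a \<in> low ((card (UNIV :: 'a set)) - j)" for j a
  proof (induction j arbitrary: a)
    case 0
    then show ?case using low_top by simp
  next
    case (Suc j)
    let ?H = "{n. n - E * n \<in> low ((card (UNIV :: 'a set)) - Suc j)}"
    have "a - E * a \<in> ?H"
    proof (rule rad_induct_connected[OF c])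
      show "a - E * a \<in> rad" by (simp add: rad_def chi_mult[OF rt] E)
      show "subgrp ?H"
        unfolding subgrp_def
      proof (intro conjI ballI)
        fix m n assume "m \<in> ?H" "n \<in> ?H"
        then have "(m - E * m) - (n - E * n) \<in> low ((card (UNIV :: 'a set)) - Suc j)"
          by (auto intro: subgrp_diff[OF subgrp_low])
        then show "m - n \<in> ?H" by (simp add: algebra_simps)
      qed (simp add: subgrp_0[OF subgrp_low])
      fix s t x :: 'a assume st: "content s = content t" "x * s = s" "x * t = t"
      have "(gen x - E * gen x) * (gen s - gen t) \<in> low ((card (UNIV :: 'a set)) - j - 1)"
        by (rule low_mult_rad[OF rt Suc gen_diff_in_rad[OF st(1)]])
      also have "(gen x - E * gen x) * (gen s - gen t) = (gen s - gen t) - E * (gen s - gen t)"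
        using st by (simp add: left_diff_distrib right_diff_distrib gen_mult mult.assoc)
      finally show "gen s - gen t \<in> ?H" by simp
    qed
    then show ?case by (simp add: right_diff_distrib E flip: mult.assoc)
  qed
  from this[of a "card (UNIV :: 'a set)"] have "a - E * a = 0" by (intro low_0) simp
  then show ?thesis by simp
qed

lemma unital_orthogonal_idempotents:
  assumes c: "connected_R_trivial TYPE('a::{semigroup_mult,finite})"
  obtains e :: "'a::{semigroup_mult,finite} set \<Rightarrow> 'a salg" where
    "\<And>X Y. X \<in> Lam \<Longrightarrow> Y \<in> Lam \<Longrightarrow> e X * e Y = (if X = Y then e X else 0)"
    "\<And>X Z. X \<in> Lam \<Longrightarrow> Z \<in> Lam \<Longrightarrow> chi Z (e X) = of_bool (Z = X)"
    "\<And>a. (\<Sum>X\<in>Lam. e X) * a = a" "\<And>a. a * (\<Sum>X\<in>Lam. e X) = a"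
proof -
  have rt: "R_trivial TYPE('a)" and r: "\<And>s::'a. \<exists>x. s = s * x"
    using c by (auto simp: connected_R_trivial_def)
  obtain e :: "'a set \<Rightarrow> 'a salg" where
    e: "\<And>X Y. X \<in> Lam \<Longrightarrow> Y \<in> Lam \<Longrightarrow> e X * e Y = (if X = Y then e X else 0)"
    and chi: "\<And>X Z. X \<in> Lam \<Longrightarrow> Z \<in> Lam \<Longrightarrow> chi Z (e X) = of_bool (Z = X)"
    using orthogonal_idempotents[OF rt finite_Lam subset_refl] by metis
  let ?E = "\<Sum>X\<in>Lam. e X"
  have "?E * ?E = (\<Sum>X\<in>Lam. \<Sum>Y\<in>Lam. if X = Y then e X else 0)"
    unfolding sum_product by (intro sum.cong refl) (simp add: e)
  then have EE: "?E * ?E = ?E" by (simp add: finite_Lam)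
  have chiE: "chi Z ?E = 1" if "Z \<in> Lam" for Z
  proof -
    have "chi Z ?E = (\<Sum>X\<in>Lam. if Z = X then 1 else 0)"
      unfolding chi_sum by (intro sum.cong refl) (simp add: chi that)
    then show ?thesis using that by (simp add: finite_Lam)
  qed
  show ?thesis
    by (rule that[OF e chi left_unit[OF c EE chiE] right_unit[OF rt r EE chiE]])
qed


section \<open>Generators of the radical modulo its square\<close>

definition rad2 :: "'a::{semigroup_mult,finite} salg set" where
  "rad2 = \<Inter> {H. subgrp H \<and> (\<forall>a\<in>rad. \<forall>b\<in>rad. a * b \<in> H)}"

lemma subgrp_rad2: "subgrp rad2"
  by (auto simp: rad2_def subgrp_def)

lemma mult_in_rad2: "a \<in> rad \<Longrightarrow> b \<in> rad \<Longrightarrow> a * b \<in> rad2"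
  by (auto simp: rad2_def)

lemma rad2_induct: "x \<in> rad2 \<Longrightarrow> subgrp H \<Longrightarrow> (\<And>a b. a \<in> rad \<Longrightarrow> b \<in> rad \<Longrightarrow> a * b \<in> H) \<Longrightarrow> x \<in> H"
  by (auto simp: rad2_def)

lemma equiv_generated_equiv:
  assumes "r \<subseteq> A \<times> A"
  shows "equiv A (generated_equiv A r)"
proof -
  have "equiv A (A \<times> A)" by (auto simp: equiv_def refl_on_def sym_def trans_def)
  then have AA: "A \<times> A \<in> {e. equiv A e \<and> r \<subseteq> e}" using assms by simp
  show ?thesis
    unfolding generated_equiv_def
  proof (intro equivI)
    show "\<Inter> {e. equiv A e \<and> r \<subseteq> e} \<subseteq> A \<times> A" by (rule Inter_lower[OF AA])
    show "refl_on A (\<Inter> {e. equiv A e \<and> r \<subseteq> e})"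
      by (simp add: equiv_def refl_on_def)
    show "sym (\<Inter> {e. equiv A e \<and> r \<subseteq> e})"
    proof (intro symI InterI)
      fix x y e assume "(x, y) \<in> \<Inter> {e. equiv A e \<and> r \<subseteq> e}" "e \<in> {e. equiv A e \<and> r \<subseteq> e}"
      then have "(x, y) \<in> e" "sym e" by (auto simp: equiv_def)
      then show "(y, x) \<in> e" by (meson symE)
    qed
    show "trans (\<Inter> {e. equiv A e \<and> r \<subseteq> e})"
    proof (intro transI InterI)
      fix x y z e assume "(x, y) \<in> \<Inter> {e. equiv A e \<and> r \<subseteq> e}" "(y, z) \<in> \<Inter> {e. equiv A e \<and> r \<subseteq> e}"
        "e \<in> {e. equiv A e \<and> r \<subseteq> e}"
      then have "(x, y) \<in> e" "(y, z) \<in> e" "trans e" by (auto simp: equiv_def)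
      then show "(x, z) \<in> e" by (meson transE)
    qed
  qed
qed

lemma equiv_restrict:
  assumes "equiv UNIV E"
  shows "equiv A (E \<inter> A \<times> A)"
proof (intro equivI)
  show "refl_on A (E \<inter> A \<times> A)" using assms by (simp add: equiv_def refl_on_def)
  show "sym (E \<inter> A \<times> A)"
  proof (rule symI)
    fix x y assume "(x, y) \<in> E \<inter> A \<times> A"
    moreover have "sym E" using assms by (simp add: equiv_def)
    ultimately show "(y, x) \<in> E \<inter> A \<times> A" by (auto dest: symD)
  qed
  show "trans (E \<inter> A \<times> A)"
  proof (rule transI)
    fix x y z assume "(x, y) \<in> E \<inter> A \<times> A" "(y, z) \<in> E \<inter> A \<times> A"
    moreover have "trans E" using assms by (simp add: equiv_def)
    ultimately show "(x, z) \<in> E \<inter> A \<times> A" by (auto dest: transD)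
  qed
qed simp

lemma subset_generated_equiv: "r \<subseteq> generated_equiv A r"
  by (auto simp: generated_equiv_def)

lemma generated_equiv_least: "equiv A e \<Longrightarrow> r \<subseteq> e \<Longrightarrow> generated_equiv A r \<subseteq> e"
  by (auto simp: generated_equiv_def)

locale connected_semigroup =
  fixes f :: "'a::{semigroup_mult,finite} set \<Rightarrow> 'a" and e :: "'a set \<Rightarrow> 'a salg"
  assumes connected: "connected_R_trivial TYPE('a)"
    and f: "\<And>X. X \<in> Lam \<Longrightarrow> is_idempotent (f X) \<and> left_ideal (f X) = X"
    and e_orth: "\<And>X Y. X \<in> Lam \<Longrightarrow> Y \<in> Lam \<Longrightarrow> e X * e Y = (if X = Y then e X else 0)"
    and chi_e: "\<And>X Z. X \<in> Lam \<Longrightarrow> Z \<in> Lam \<Longrightarrow> chi Z (e X) = of_bool (Z = X)"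
    and unit_left: "\<And>a. (\<Sum>X\<in>Lam. e X) * a = a"
    and unit_right: "\<And>a. a * (\<Sum>X\<in>Lam. e X) = a"
begin

lemma rt: "R_trivial TYPE('a)"
  using connected by (simp add: connected_R_trivial_def)

lemmas content_mult = content_mult[OF rt]
  and chi_mult = chi_mult[OF rt]
  and rad_mult_left = rad_mult_left[OF rt]
  and rad_mult_right = rad_mult_right[OF rt]
  and content_in_Lam = content_in_Lam[OF rt]

lemma content_f: "X \<in> Lam \<Longrightarrow> content (f X) = X"
  using f[of X] content_idempotent[OF rt, of "f X"] by simp

lemma f_idem: "X \<in> Lam \<Longrightarrow> f X * f X = f X"
  using f[of X] by (simp add: is_idempotent_def)

lemma f_absorb_iff: "X \<in> Lam \<Longrightarrow> f X * s = f X \<longleftrightarrow> X \<subseteq> content s"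
proof
  assume X: "X \<in> Lam"
  show "f X * s = f X" if "X \<subseteq> content s"
  proof -
    have "f X \<in> content (f X)" using f_idem[OF X] by (simp add: in_content_iff[OF rt])
    then have "f X \<in> content s" using that content_f[OF X] by auto
    then show ?thesis by (simp add: in_content_iff[OF rt])
  qed
  assume fs: "f X * s = f X"
  show "X \<subseteq> content s"
  proof
    fix x assume "x \<in> X"
    then have "x * f X = x" using content_f[OF X] in_content_iff[OF rt, of x "f X"] by simp
    then have "x * s = x" using fs by (metis mult.assoc)
    then show "x \<in> content s" by (simp add: in_content_iff[OF rt])
  qed
qed

section \<open>Corners and their equivalence classes\<close>

definition proj :: "'a set \<Rightarrow> 'a set \<Rightarrow> 'a \<Rightarrow> 'a" where
  "proj X Y s = f Y * s * f X"

lemma corner_eq: "corner f X Y = range (proj X Y)"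
  by (auto simp: corner_def proj_def)

lemma proj_in_corner: "proj X Y s \<in> corner f X Y"
  by (auto simp: corner_eq)

lemma content_proj: "X \<in> Lam \<Longrightarrow> Y \<in> Lam \<Longrightarrow> content (proj X Y s) = Y \<inter> content s \<inter> X"
  by (simp add: proj_def content_mult content_f)

lemma proj_corner:
  assumes "X \<in> Lam" "Y \<in> Lam" "w \<in> corner f X Y"
  shows "proj X Y w = w"
proof -
  obtain s where w: "w = f Y * s * f X" using assms(3) by (auto simp: corner_eq proj_def)
  have "proj X Y w = (f Y * f Y) * s * (f X * f X)" by (simp add: proj_def w mult.assoc)
  then show ?thesis by (simp add: f_idem assms w)
qed

lemma corner_rel_generators:
  assumes X: "X \<in> Lam" and Y: "Y \<in> Lam"
  shows "({(f Y * s * t * f X, f Y * s * f X) | s t. \<not> Y \<subseteq> content s \<and> X \<subseteq> content t} \<union>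
      {(s, t). s \<in> I_prod Y X \<inter> corner f X Y \<and> t \<in> I_prod Y X \<inter> corner f X Y}) \<subseteq> corner f X Y \<times> corner f X Y"
proof -
  have "f Y * s * t * f X \<in> corner f X Y" for s t
    using proj_in_corner[of X Y "s * t"] by (simp add: proj_def mult.assoc)
  moreover have "f Y * s * f X \<in> corner f X Y" for s
    using proj_in_corner[of X Y s] by (simp add: proj_def)
  ultimately show ?thesis by auto
qed

lemma equiv_corner_rel: "X \<in> Lam \<Longrightarrow> Y \<in> Lam \<Longrightarrow> equiv (corner f X Y) (corner_rel f X Y)"
  unfolding corner_rel_def by (rule equiv_generated_equiv[OF corner_rel_generators])

lemma corner_rel_I:
  assumes "\<not> Y \<subseteq> content s" "X \<subseteq> content t"
  shows "(proj X Y (s * t), proj X Y s) \<in> corner_rel f X Y"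
proof -
  have "(f Y * s * t * f X, f Y * s * f X) \<in> corner_rel f X Y"
    unfolding corner_rel_def using assms by (intro subsetD[OF subset_generated_equiv]) blast
  then show ?thesis by (simp add: proj_def mult.assoc)
qed

lemma corner_rel_I_prod:
  assumes "s \<in> I_prod Y X \<inter> corner f X Y" "t \<in> I_prod Y X \<inter> corner f X Y"
  shows "(s, t) \<in> corner_rel f X Y"
  unfolding corner_rel_def using assms by (intro subsetD[OF subset_generated_equiv]) blast

text \<open>Induction principle for the relation: a candidate relation may be given on the whole
  semigroup, since its restriction to the corner is again an equivalence.\<close>

lemma corner_rel_least:
  assumes X: "X \<in> Lam" and Y: "Y \<in> Lam" and E: "equiv UNIV E"
    and "\<And>s t. \<not> Y \<subseteq> content s \<Longrightarrow> X \<subseteq> content t \<Longrightarrow> (proj X Y (s * t), proj X Y s) \<in> E"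
    and "\<And>w w'. w \<in> I_prod Y X \<Longrightarrow> w' \<in> I_prod Y X \<Longrightarrow> (w, w') \<in> E"
    and ww: "(w, w') \<in> corner_rel f X Y"
  shows "(w, w') \<in> E"
proof -
  let ?E = "E \<inter> corner f X Y \<times> corner f X Y"
  have "equiv (corner f X Y) ?E"
    by (rule equiv_restrict[OF E])
  moreover have "(f Y * s * t * f X, f Y * s * f X) \<in> E" if "\<not> Y \<subseteq> content s" "X \<subseteq> content t" for s t
    using assms(4)[OF that] by (simp add: proj_def mult.assoc)
  then have "({(f Y * s * t * f X, f Y * s * f X) | s t. \<not> Y \<subseteq> content s \<and> X \<subseteq> content t} \<union>
      {(s, t). s \<in> I_prod Y X \<inter> corner f X Y \<and> t \<in> I_prod Y X \<inter> corner f X Y}) \<subseteq> E"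
    using assms(5) by blast
  ultimately have "corner_rel f X Y \<subseteq> ?E"
    unfolding corner_rel_def using corner_rel_generators[OF X Y]
    by (intro generated_equiv_least) blast+
  then show ?thesis using ww by blast
qed

lemma proj_mult_I_prod:
  assumes "X \<in> Lam" "Y \<in> Lam" "\<not> Y \<subseteq> content s" "\<not> X \<subseteq> content t"
  shows "proj X Y (s * t) \<in> I_prod Y X \<inter> corner f X Y"
proof -
  have "f Y * s \<in> I_ideal Y" "t * f X \<in> I_ideal X"
    using assms by (auto simp: I_ideal_def content_mult)
  then have "(f Y * s) * (t * f X) \<in> I_prod Y X" unfolding I_prod_def by blast
  then show ?thesis using proj_in_corner[of X Y "s * t"] by (simp add: proj_def mult.assoc)
qed

lemma I_prod_content:
  fixes w :: 'a
  assumes "w \<in> I_prod Y X"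
  shows "\<not> Y \<subseteq> content w" "\<not> X \<subseteq> content w"
  using assms by (auto simp: I_prod_def I_ideal_def content_mult)

lemma class_mem_iff:
  assumes "X \<in> Lam" "Y \<in> Lam" "D \<in> corner f X Y // corner_rel f X Y" "(w, w') \<in> corner_rel f X Y"
  shows "w \<in> D \<longleftrightarrow> w' \<in> D"
proof -
  note E = equiv_corner_rel[OF assms(1,2)]
  have "(w', w) \<in> corner_rel f X Y" using E assms(4) by (meson equivE symE)
  then show ?thesis
    using in_quotient_imp_closed[OF E assms(3)] assms(4) by blast
qed

lemma Z_set_quotient: "D \<in> Z_set f X Y \<Longrightarrow> D \<in> corner f X Y // corner_rel f X Y"
  by (auto simp: Z_set_def split: if_splits)

text \<open>By the second generating clause these elements form part of a single class, which is the
  one that \<open>Z_set\<close> leaves out.\<close>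

lemma I_prod_not_in_Z_set:
  assumes "X \<in> Lam" "Y \<in> Lam" "D \<in> Z_set f X Y" "w \<in> I_prod Y X \<inter> corner f X Y"
  shows "w \<notin> D"
proof
  assume "w \<in> D"
  then have "I_prod Y X \<inter> corner f X Y \<subseteq> D"
    using class_mem_iff[OF assms(1,2) Z_set_quotient[OF assms(3)] corner_rel_I_prod[OF assms(4)]] by blast
  moreover have "I_prod Y X \<noteq> {}" using assms(4) by blast
  ultimately show False using assms(3) by (simp add: Z_set_def)
qed

section \<open>Coordinates that vanish on the square of the radical\<close>

text \<open>The coefficient at the class D after applying \<open>proj X Y\<close> to the basis
  elements and collecting them by classes.\<close>

definition psi :: "'a set \<Rightarrow> 'a set \<Rightarrow> 'a set \<Rightarrow> 'a salg \<Rightarrow> int" where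
  "psi X Y D = weight (\<lambda>s. proj X Y s \<in> D)"

lemma psi_simps [simp]:
  "psi X Y D 0 = 0" "psi X Y D (a + b) = psi X Y D a + psi X Y D b"
  "psi X Y D (a - b) = psi X Y D a - psi X Y D b" "psi X Y D (- a) = - psi X Y D a"
  "psi X Y D (int_scale c a) = c * psi X Y D a" "psi X Y D (gen s) = of_bool (proj X Y s \<in> D)"
  by (simp_all add: psi_def)

lemma psi_sum: "psi X Y D (\<Sum>x\<in>A. g x) = (\<Sum>x\<in>A. psi X Y D (g x))"
  by (simp add: psi_def weight_sum)

lemma proj_absorb:
  assumes "X \<in> Lam" "Y \<in> Lam"
  shows "Y \<subseteq> content s \<Longrightarrow> proj X Y (s * t) = proj X Y t"
  using f_absorb_iff[OF assms(2), of s] by (simp add: proj_def flip: mult.assoc)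

text \<open>Take s not above Y and t, t' of equal content. If t is above X, the first clause relates
  both \<open>s * t\<close> and \<open>s * t'\<close> to s after projection; otherwise both
  projections lie in \<open>I_prod Y X\<close>, where D has no elements. Elements s above Y are
  absorbed by \<open>f Y\<close>, so their differences contribute nothing.\<close>

lemma psi_mult_left:
  assumes X: "X \<in> Lam" and Y: "Y \<in> Lam" and D: "D \<in> Z_set f X Y"
    and k: "chi Y k = 0" and n: "n \<in> rad"
  shows "psi X Y D (k * n) = 0"
proof -
  have "k \<in> {k. psi X Y D (k * n) = 0}"
  proof (rule chi_kernel_induct[of Y "f Y"])
    show "Y \<subseteq> content (f Y)" by (simp add: content_f Y)
    show "chi Y k = 0" by (rule k)
    show "subgrp {k. psi X Y D (k * n) = 0}" by (auto simp: subgrp_def left_diff_distrib)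
  next
    fix s assume s: "\<not> Y \<subseteq> content s"
    have "n \<in> {n. psi X Y D (gen s * n) = 0}"
    proof (rule rad_induct[OF rt n])
      show "subgrp {n. psi X Y D (gen s * n) = 0}" by (auto simp: subgrp_def right_diff_distrib)
      fix t t' :: 'a assume tt: "content t = content t'"
      have "proj X Y (s * t) \<in> D \<longleftrightarrow> proj X Y (s * t') \<in> D"
      proof (cases "X \<subseteq> content t")
        case True
        then show ?thesis
          using class_mem_iff[OF X Y Z_set_quotient[OF D] corner_rel_I[OF s]] tt by metis
      next
        case False
        then show ?thesis
          using I_prod_not_in_Z_set[OF X Y D proj_mult_I_prod[OF X Y s]] tt by metis
      qed
      then show "gen t - gen t' \<in> {n. psi X Y D (gen s * n) = 0}"
        by (simp add: right_diff_distrib gen_mult)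
    qed
    then show "gen s \<in> {k. psi X Y D (k * n) = 0}" by simp
  next
    fix s s' :: 'a assume s: "Y \<subseteq> content s" "Y \<subseteq> content s'"
    have "psi X Y D (gen r * n) = psi X Y D n" if "Y \<subseteq> content r" for r
    proof -
      have "psi X Y D (gen r * n) = psi X Y D (\<Sum>t\<in>UNIV. int_scale (coef n t) (gen (r * t)))"
        by (subst salg_expand[of n]) (simp add: sum_distrib_left int_scale_mult gen_mult)
      also have "\<dots> = psi X Y D (\<Sum>t\<in>UNIV. int_scale (coef n t) (gen t))"
        by (simp only: psi_sum psi_simps proj_absorb[OF X Y that])
      finally show ?thesis by (simp only: salg_expand[symmetric])
    qed
    then show "gen s - gen s' \<in> {k. psi X Y D (k * n) = 0}"
      using s by (simp add: left_diff_distrib)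
  qed
  then show ?thesis by simp
qed

text \<open>Not a mirror image: for t above X one has \<open>f X * t = f X\<close>, but
  \<open>t * f X\<close> need not equal \<open>f X\<close>. For two such t, t' the mixed second
  difference vanishes instead: if s is above Y it is absorbed by \<open>f Y\<close>, and otherwise
  the first clause removes t and t'.\<close>

lemma psi_mult_right:
  assumes X: "X \<in> Lam" and Y: "Y \<in> Lam" and D: "D \<in> Z_set f X Y"
    and k: "chi X k = 0" and n: "n \<in> rad"
  shows "psi X Y D (n * k) = 0"
proof -
  have "k \<in> {k. psi X Y D (n * k) = 0}"
  proof (rule chi_kernel_induct[of X "f X"])
    show "X \<subseteq> content (f X)" by (simp add: content_f X)
    show "chi X k = 0" by (rule k)
    show "subgrp {k. psi X Y D (n * k) = 0}" by (auto simp: subgrp_def right_diff_distrib)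
  next
    fix t assume t: "\<not> X \<subseteq> content t"
    have "n \<in> {n. psi X Y D (n * gen t) = 0}"
    proof (rule rad_induct[OF rt n])
      show "subgrp {n. psi X Y D (n * gen t) = 0}" by (auto simp: subgrp_def left_diff_distrib)
      fix s s' :: 'a assume ss: "content s = content s'"
      have "proj X Y (s * t) \<in> D \<longleftrightarrow> proj X Y (s' * t) \<in> D"
      proof (cases "Y \<subseteq> content s")
        case True
        then show ?thesis using proj_absorb[OF X Y, of s t] proj_absorb[OF X Y, of s' t] ss by simp
      next
        case False
        then show ?thesis
          using I_prod_not_in_Z_set[OF X Y D proj_mult_I_prod[OF X Y _ t]] ss by metis
      qed
      then show "gen s - gen s' \<in> {n. psi X Y D (n * gen t) = 0}"
        by (simp add: left_diff_distrib gen_mult)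
    qed
    then show "gen t \<in> {k. psi X Y D (n * k) = 0}" by simp
  next
    fix t t' assume t: "X \<subseteq> content t" "X \<subseteq> content t'"
    have "n \<in> {n. psi X Y D (n * (gen t - gen t')) = 0}"
    proof (rule rad_induct[OF rt n])
      show "subgrp {n. psi X Y D (n * (gen t - gen t')) = 0}" by (auto simp: subgrp_def left_diff_distrib)
      fix s s' :: 'a assume ss: "content s = content s'"
      have "psi X Y D (gen (s * t)) - psi X Y D (gen (s * t')) - psi X Y D (gen (s' * t)) + psi X Y D (gen (s' * t')) = 0"
      proof (cases "Y \<subseteq> content s")
        case True
        then show ?thesis
          using ss by (simp add: proj_absorb[OF X Y])
      next
        case False
        have "proj X Y (r * t) \<in> D \<longleftrightarrow> proj X Y (r * t') \<in> D" if "\<not> Y \<subseteq> content r" for r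
          using class_mem_iff[OF X Y Z_set_quotient[OF D] corner_rel_I[OF that t(1)]]
            class_mem_iff[OF X Y Z_set_quotient[OF D] corner_rel_I[OF that t(2)]] by simp
        from this[of s] this[of s'] show ?thesis using False ss by simp
      qed
      then show "gen s - gen s' \<in> {n. psi X Y D (n * (gen t - gen t')) = 0}"
        by (simp add: left_diff_distrib right_diff_distrib gen_mult)
    qed
    then show "gen t - gen t' \<in> {k. psi X Y D (n * k) = 0}" by simp
  qed
  then show ?thesis by simp
qed

lemma chi_unit: "Z \<in> Lam \<Longrightarrow> chi Z (\<Sum>X\<in>Lam. e X) = 1"
proof -
  assume Z: "Z \<in> Lam"
  have "chi Z (\<Sum>X\<in>Lam. e X) = (\<Sum>X\<in>Lam. if Z = X then 1 else 0)"
    unfolding chi_sum by (intro sum.cong refl) (simp add: chi_e Z)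
  then show ?thesis using Z by (simp add: finite_Lam)
qed

text \<open>The unit minus \<open>e Y\<close> is killed by \<open>chi Y\<close>, and so is
  \<open>e Y'\<close> for another Y'; the same holds for X on the right. The coordinates therefore
  see only the block of \<open>rad\<close> that belongs to X and Y.\<close>

lemma psi_e:
  assumes X: "X \<in> Lam" and Y: "Y \<in> Lam" and D: "D \<in> Z_set f X Y" and n: "n \<in> rad"
    and X': "X' \<in> Lam" and Y': "Y' \<in> Lam"
  shows "psi X Y D (e Y' * n * e X') = (if X' = X \<and> Y' = Y then psi X Y D n else 0)"
proof (cases "Y' = Y")
  case False
  have "psi X Y D (e Y' * (n * e X')) = 0"
    by (rule psi_mult_left[OF X Y D _ rad_mult_right[OF n]]) (use False Y Y' in \<open>simp add: chi_e\<close>)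
  then show ?thesis using False by (simp add: mult.assoc)
next
  case True
  note Y' = True
  show ?thesis
  proof (cases "X' = X")
    case False
    have "psi X Y D ((e Y' * n) * e X') = 0"
      by (rule psi_mult_right[OF X Y D _ rad_mult_left[OF n]]) (use False X X' in \<open>simp add: chi_e\<close>)
    then show ?thesis using False by simp
  next
    case True
    let ?E = "\<Sum>X\<in>Lam. e X"
    have "psi X Y D ((?E - e Y) * n) = 0"
      by (rule psi_mult_left[OF X Y D _ n]) (simp add: chi_e chi_unit Y)
    then have 1: "psi X Y D n = psi X Y D (e Y * n)"
      unfolding left_diff_distrib unit_left by simp
    have "psi X Y D ((e Y * n) * (?E - e X)) = 0"
      by (rule psi_mult_right[OF X Y D _ rad_mult_left[OF n]]) (simp add: chi_e chi_unit X)
    then have "psi X Y D (e Y * n) = psi X Y D (e Y * n * e X)"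
      unfolding right_diff_distrib unit_right by simp
    then show ?thesis using 1 True Y' by simp
  qed
qed

section \<open>The distinguished class for comparable vertices\<close>

text \<open>For w in the corner this means that X and Y are comparable and w has the largest
  possible content \<open>X \<inter> Y\<close>. It marks the classes on which
  \<open>chi (X \<inter> Y)\<close> takes the value 1.\<close>

definition full_content :: "'a set \<Rightarrow> 'a set \<Rightarrow> 'a \<Rightarrow> bool" where
  "full_content X Y w \<longleftrightarrow> X \<subseteq> content w \<or> Y \<subseteq> content w"

text \<open>The first clause multiplies by some t above X, which leaves the content of the projected
  element unchanged; elements of \<open>I_prod Y X\<close> never have full content.\<close>

lemma full_content_corner_rel:
  assumes X: "X \<in> Lam" and Y: "Y \<in> Lam" and "(w, w') \<in> corner_rel f X Y"
  shows "full_content X Y w \<longleftrightarrow> full_content X Y w'"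
proof -
  have "(w, w') \<in> {(w, w'). full_content X Y w \<longleftrightarrow> full_content X Y w'}"
  proof (rule corner_rel_least[OF X Y _ _ _ assms(3)])
    show "equiv UNIV {(w, w'). full_content X Y w \<longleftrightarrow> full_content X Y w'}"
      by (auto simp: equiv_def refl_on_def sym_def trans_def)
    show "(proj X Y (s * t), proj X Y s) \<in> {(w, w'). full_content X Y w \<longleftrightarrow> full_content X Y w'}"
      if "X \<subseteq> content t" for s t
      using that by (auto simp: full_content_def content_proj X Y content_mult)
  qed (use I_prod_content in \<open>auto simp: full_content_def\<close>)
  then show ?thesis by simp
qed

lemma full_content_proj_iff:
  assumes X: "X \<in> Lam" and Y: "Y \<in> Lam"
  shows "full_content X Y (proj X Y s) \<longleftrightarrow> (X \<subseteq> Y \<or> Y \<subseteq> X) \<and> X \<inter> Y \<subseteq> content s"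
  by (auto simp: full_content_def content_proj X Y)

text \<open>On \<open>rad\<close> the coordinates at the classes of full content sum to
  \<open>chi (X \<inter> Y)\<close>, that is, to zero. One of them is redundant, and this class is
  chosen to be dropped.\<close>

definition base_class :: "'a set \<Rightarrow> 'a set \<Rightarrow> 'a set" where
  "base_class X Y = corner_rel f X Y `` {f Y * f X}"

definition arrow_classes :: "'a set \<Rightarrow> 'a set \<Rightarrow> 'a set set" where
  "arrow_classes X Y = (if X \<subseteq> Y \<or> Y \<subseteq> X then Z_set f X Y - {base_class X Y} else Z_set f X Y)"

lemma ff_proj: "X \<in> Lam \<Longrightarrow> Y \<in> Lam \<Longrightarrow> f Y * f X = proj X Y (f Y)"
  by (simp add: proj_def f_idem)

lemma full_content_ff: "X \<in> Lam \<Longrightarrow> Y \<in> Lam \<Longrightarrow> X \<subseteq> Y \<or> Y \<subseteq> X \<Longrightarrow> full_content X Y (f Y * f X)"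
  by (auto simp: full_content_def content_mult content_f)

lemma ff_base_class: "X \<in> Lam \<Longrightarrow> Y \<in> Lam \<Longrightarrow> f Y * f X \<in> base_class X Y"
  unfolding base_class_def
  by (rule equiv_class_self[OF equiv_corner_rel]) (simp_all add: ff_proj proj_in_corner)

text \<open>Full content separates \<open>f Y * f X\<close> from \<open>I_prod Y X\<close>. Hence
  \<open>Z_set\<close> is nonempty for comparable X and Y, and subtracting 1 in the arrow count is
  meaningful.\<close>

lemma base_class_in_Z_set:
  assumes X: "X \<in> Lam" and Y: "Y \<in> Lam" and c: "X \<subseteq> Y \<or> Y \<subseteq> X"
  shows "base_class X Y \<in> Z_set f X Y"
proof -
  have q: "base_class X Y \<in> corner f X Y // corner_rel f X Y"
    unfolding base_class_def by (rule quotientI) (simp add: ff_proj[OF X Y] proj_in_corner)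
  moreover have "\<not> I_prod Y X \<inter> corner f X Y \<subseteq> base_class X Y" if ne: "I_prod Y X \<noteq> {}"
  proof -
    obtain a b where ab: "a \<in> I_ideal Y" "b \<in> I_ideal X" using ne by (auto simp: I_prod_def)
    let ?z = "proj X Y (a * b)"
    have z: "?z \<in> I_prod Y X \<inter> corner f X Y"
      using ab by (intro proj_mult_I_prod X Y) (auto simp: I_ideal_def)
    then have "\<not> full_content X Y ?z" using I_prod_content[of ?z Y X] by (auto simp: full_content_def)
    then have "(f Y * f X, ?z) \<notin> corner_rel f X Y"
      using full_content_corner_rel[OF X Y] full_content_ff[OF X Y c] by blast
    then have "?z \<notin> base_class X Y" by (simp add: base_class_def)
    then show ?thesis using z by blast
  qed
  ultimately show ?thesis by (simp add: Z_set_def)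
qed

lemma card_arrow_classes:
  assumes X: "X \<in> Lam" and Y: "Y \<in> Lam"
  shows "int (card (arrow_classes X Y)) =
    (if X \<subseteq> Y \<or> Y \<subseteq> X then int (card (Z_set f X Y)) - 1 else int (card (Z_set f X Y)))"
proof (cases "X \<subseteq> Y \<or> Y \<subseteq> X")
  case True
  have fin: "finite (Z_set f X Y)" by (rule finite_subset[of _ UNIV]) auto
  note b = base_class_in_Z_set[OF X Y True]
  have pos: "1 \<le> card (Z_set f X Y)" using b fin by (metis One_nat_def Suc_leI card_gt_0_iff empty_iff)
  have c: "card (arrow_classes X Y) = card (Z_set f X Y) - 1"
    using True b by (simp add: arrow_classes_def card_Diff_singleton)
  show ?thesis unfolding c of_nat_diff[OF pos] using True by simp
qed (simp add: arrow_classes_def)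

definition rep :: "'a set \<Rightarrow> 'a" where
  "rep C = (SOME w. w \<in> C)"

lemma rep_in_class:
  assumes "X \<in> Lam" "Y \<in> Lam" "C \<in> corner f X Y // corner_rel f X Y"
  shows "rep C \<in> C" "rep C \<in> corner f X Y"
proof -
  show 1: "rep C \<in> C"
    unfolding rep_def using in_quotient_imp_non_empty[OF equiv_corner_rel[OF assms(1,2)] assms(3)]
    by (simp add: some_in_eq)
  show "rep C \<in> corner f X Y"
    using in_quotient_imp_subset[OF equiv_corner_rel[OF assms(1,2)] assms(3)] 1 by blast
qed

text \<open>The lift to the radical of the basis vector of an arrow class; both correction terms are
  invisible to the coordinates indexed by \<open>arrow_classes\<close>.\<close>

definition lift :: "'a set \<Rightarrow> 'a set \<Rightarrow> 'a set \<Rightarrow> 'a salg" where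
  "lift X Y C = (if full_content X Y (rep C) then gen (rep C) - gen (f Y * f X)
     else gen (rep C) - gen (rep C * rep C))"

lemma arrow_classes_Z_set: "C \<in> arrow_classes X Y \<Longrightarrow> C \<in> Z_set f X Y"
  by (auto simp: arrow_classes_def split: if_splits)

lemma lift_in_rad:
  assumes X: "X \<in> Lam" and Y: "Y \<in> Lam" and C: "C \<in> Z_set f X Y"
  shows "lift X Y C \<in> rad"
proof (cases "full_content X Y (rep C)")
  case True
  have w: "proj X Y (rep C) = rep C"
    by (rule proj_corner[OF X Y rep_in_class(2)[OF X Y Z_set_quotient[OF C]]])
  have "content (rep C) = Y \<inter> X"
    using True content_proj[OF X Y, of "rep C"] unfolding w full_content_def by blast
  also have "\<dots> = content (f Y * f X)" by (simp add: content_mult content_f X Y)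
  finally show ?thesis using True by (simp add: lift_def gen_diff_in_rad)
next
  case False
  then show ?thesis by (simp add: lift_def gen_diff_in_rad content_mult)
qed

lemma psi_lift:
  assumes X: "X \<in> Lam" and Y: "Y \<in> Lam" and C: "C \<in> arrow_classes X Y" and D: "D \<in> arrow_classes X Y"
  shows "psi X Y D (lift X Y C) = of_bool (C = D)"
proof -
  let ?w = "rep C"
  note CZ = arrow_classes_Z_set[OF C] and DZ = arrow_classes_Z_set[OF D]
  note r = rep_in_class[OF X Y Z_set_quotient[OF CZ]]
  have w: "proj X Y ?w = ?w" by (rule proj_corner[OF X Y r(2)])
  have "?w \<in> D \<longleftrightarrow> C = D"
    using quotient_disj[OF equiv_corner_rel[OF X Y] Z_set_quotient[OF CZ] Z_set_quotient[OF DZ]] r(1) by blast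
  then have 1: "psi X Y D (gen ?w) = of_bool (C = D)" by (simp add: w)
  show ?thesis
  proof (cases "full_content X Y ?w")
    case True
    then have c: "X \<subseteq> Y \<or> Y \<subseteq> X" using full_content_proj_iff[OF X Y, of ?w] w by simp
    have "f Y * f X \<notin> D"
    proof
      assume "f Y * f X \<in> D"
      then have "D = base_class X Y"
        using quotient_disj[OF equiv_corner_rel[OF X Y] Z_set_quotient[OF DZ]
            Z_set_quotient[OF base_class_in_Z_set[OF X Y c]]] ff_base_class[OF X Y] by blast
      then show False using D c by (simp add: arrow_classes_def)
    qed
    moreover have "proj X Y (f Y * f X) = f Y * f X"
      by (rule proj_corner[OF X Y]) (simp add: ff_proj[OF X Y] proj_in_corner)
    ultimately show ?thesis using True 1 by (simp add: lift_def)
  next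
    case False
    \<comment> \<open>Without full content the representative is neither above Y nor above X, so its
      square has one factor in \<open>I_ideal Y\<close> and one in \<open>I_ideal X\<close>.\<close>
    then have "proj X Y (?w * ?w) \<in> I_prod Y X \<inter> corner f X Y"
      by (intro proj_mult_I_prod X Y) (auto simp: full_content_def)
    from I_prod_not_in_Z_set[OF X Y DZ this] show ?thesis using False 1 by (simp add: lift_def)
  qed
qed

section \<open>The coordinates determine a block of the radical modulo \<open>rad2\<close>\<close>

text \<open>Modulo H each projected element may be replaced by the representative of its class; the
  coefficients collected at a class are then the coordinate \<open>psi\<close>.\<close>

lemma corner_sum_group:
  assumes X: "X \<in> Lam" and Y: "Y \<in> Lam" and H: "subgrp H"
    and h: "\<And>w w'. (w, w') \<in> corner_rel f X Y \<Longrightarrow> h w - h w' \<in> H"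
    and z: "\<And>C. C \<in> corner f X Y // corner_rel f X Y \<Longrightarrow> int_scale (psi X Y C n) (h (rep C)) \<in> H"
  shows "(\<Sum>s\<in>UNIV. int_scale (coef n s) (h (proj X Y s))) \<in> H"
proof -
  let ?R = "corner_rel f X Y" and ?Q = "corner f X Y // corner_rel f X Y"
  let ?c = "\<lambda>s. corner_rel f X Y `` {proj X Y s}"
  note E = equiv_corner_rel[OF X Y]
  have cQ: "?c s \<in> ?Q" for s by (rule quotientI[OF proj_in_corner])
  have mem: "C = ?c s \<longleftrightarrow> proj X Y s \<in> C" if C: "C \<in> ?Q" for C s
    using quotient_disj[OF E C cQ[of s]] equiv_class_self[OF E proj_in_corner[of X Y s]] by blast
  have fin: "finite ?Q" by (rule finite_subset[of _ UNIV]) auto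
  have "(\<Sum>s\<in>UNIV. int_scale (coef n s) (h (rep (?c s)))) =
      (\<Sum>C\<in>?Q. \<Sum>s\<in>{s \<in> UNIV. ?c s = C}. int_scale (coef n s) (h (rep (?c s))))"
    by (rule sum.group[symmetric]) (use cQ fin in auto)
  also have "\<dots> = (\<Sum>C\<in>?Q. int_scale (psi X Y C n) (h (rep C)))"
  proof (rule sum.cong[OF refl])
    fix C assume C: "C \<in> ?Q"
    have "(\<Sum>s\<in>{s \<in> UNIV. ?c s = C}. int_scale (coef n s) (h (rep (?c s)))) =
        (\<Sum>s\<in>{s. proj X Y s \<in> C}. int_scale (coef n s) (h (rep C)))"
    proof (rule sum.cong)
      show "{s \<in> UNIV. ?c s = C} = {s. proj X Y s \<in> C}" using mem[OF C] by blast
      fix s assume "s \<in> {s. proj X Y s \<in> C}"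
      then have "?c s = C" using mem[OF C, of s] by blast
      then show "int_scale (coef n s) (h (rep (?c s))) = int_scale (coef n s) (h (rep C))" by (simp only:)
    qed
    then show "(\<Sum>s\<in>{s \<in> UNIV. ?c s = C}. int_scale (coef n s) (h (rep (?c s)))) = int_scale (psi X Y C n) (h (rep C))"
      by (simp only: int_scale_sum_left psi_def weight_def)
  qed
  also have "\<dots> \<in> H" by (intro subgrp_sum[OF H] z)
  finally have 1: "(\<Sum>s\<in>UNIV. int_scale (coef n s) (h (rep (?c s)))) \<in> H" .
  have "(\<Sum>s\<in>UNIV. int_scale (coef n s) (h (proj X Y s) - h (rep (?c s)))) \<in> H"
  proof (intro subgrp_sum[OF H] subgrp_int_scale[OF H] h)
    fix s
    show "(proj X Y s, rep (?c s)) \<in> ?R" using rep_in_class(1)[OF X Y cQ[of s]] by simp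
  qed
  from subgrp_add[OF H this 1] show ?thesis by (simp add: int_scale_simps sum_subtractf)
qed

text \<open>Since a is not above Y, every character vanishes on \<open>e Y * gen a\<close>; likewise
  for \<open>gen b * e X\<close>. So the element is a product of two elements of
  \<open>rad\<close>.\<close>

lemma theta_I_prod:
  assumes X: "X \<in> Lam" and Y: "Y \<in> Lam" and w: "w \<in> I_prod Y X"
  shows "e Y * gen w * e X \<in> rad2"
proof -
  obtain a b where ab: "w = a * b" "\<not> Y \<subseteq> content a" "\<not> X \<subseteq> content b"
    using w by (auto simp: I_prod_def I_ideal_def)
  have 1: "e Y * gen a \<in> rad" and 2: "gen b * e X \<in> rad"
    using ab(2,3) by (auto simp: rad_def chi_mult chi_e X Y)
  show ?thesis using mult_in_rad2[OF 1 2] by (simp add: ab(1) mult.assoc flip: gen_mult)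
qed

text \<open>For the first clause the difference factors with \<open>e Y * gen (f Y * s)\<close> on
  the left and \<open>gen (t * f X) * e X - gen (f X) * e X\<close> on the right, both in
  \<open>rad\<close>.\<close>

lemma theta_corner_rel:
  assumes X: "X \<in> Lam" and Y: "Y \<in> Lam" and "(w, w') \<in> corner_rel f X Y"
  shows "e Y * gen w * e X - e Y * gen w' * e X \<in> rad2"
proof -
  let ?T = "\<lambda>w. e Y * gen w * e X"
  have "(w, w') \<in> {(w, w'). ?T w - ?T w' \<in> rad2}"
  proof (rule corner_rel_least[OF X Y _ _ _ assms(3)])
    show "equiv UNIV {(w, w'). ?T w - ?T w' \<in> rad2}"
    proof (intro equivI)
      show "refl {(w, w'). ?T w - ?T w' \<in> rad2}" by (simp add: refl_on_def subgrp_0[OF subgrp_rad2])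
      show "sym {(w, w'). ?T w - ?T w' \<in> rad2}"
        using subgrp_uminus[OF subgrp_rad2] by (fastforce simp: sym_def)
      show "trans {(w, w'). ?T w - ?T w' \<in> rad2}"
        using subgrp_add[OF subgrp_rad2] by (fastforce simp: trans_def)
    qed auto
  next
    fix s t assume st: "\<not> Y \<subseteq> content s" "X \<subseteq> content t"
    have 1: "e Y * gen (f Y * s) \<in> rad"
      using st(1) by (auto simp: rad_def chi_mult chi_e Y content_mult)
    have 2: "gen (t * f X) * e X - gen (f X) * e X \<in> rad"
      using st(2) by (auto simp: rad_def chi_mult chi_e X content_mult)
    have "?T (proj X Y (s * t)) - ?T (proj X Y s) = (e Y * gen (f Y * s)) * (gen (t * f X) * e X - gen (f X) * e X)"
      by (simp add: proj_def right_diff_distrib mult.assoc flip: gen_mult)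
    with mult_in_rad2[OF 1 2] show "(proj X Y (s * t), proj X Y s) \<in> {(w, w'). ?T w - ?T w' \<in> rad2}" by simp
  next
    have "?T w \<in> rad2" if w: "w \<in> I_prod Y X" for w by (rule theta_I_prod[OF X Y w])
    then show "(w, w') \<in> {(w, w'). ?T w - ?T w' \<in> rad2}" if "w \<in> I_prod Y X" "w' \<in> I_prod Y X" for w w'
      using that by (simp add: subgrp_diff[OF subgrp_rad2])
  qed
  then show ?thesis by simp
qed

text \<open>The classes inside the arrow set contribute nothing by hypothesis, the class meeting
  \<open>I_prod Y X\<close> is already in \<open>rad2\<close>, and the base class is neutralised by
  a correction whose total is zero on \<open>rad\<close>.\<close>

lemma corner_in_rad2:
  assumes X: "X \<in> Lam" and Y: "Y \<in> Lam" and n: "n \<in> rad"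
    and psi: "\<And>C. C \<in> arrow_classes X Y \<Longrightarrow> psi X Y C n = 0"
  shows "e Y * n * e X \<in> rad2"
proof -
  note R = subgrp_rad2[where 'a = 'a]
  let ?T = "\<lambda>w. e Y * gen w * e X"
  \<comment> \<open>The correction makes \<open>h\<close> vanish modulo \<open>rad2\<close> on the
    base class, whose coordinate is not assumed to be zero.\<close>
  define h where "h w = ?T w - int_scale (of_bool (full_content X Y w)) (?T (f Y * f X))" for w
  have "(\<Sum>s\<in>UNIV. int_scale (coef n s) (h (proj X Y s))) \<in> rad2"
  proof (rule corner_sum_group[OF X Y R])
    fix w w' assume "(w, w') \<in> corner_rel f X Y"
    then show "h w - h w' \<in> rad2"
      using theta_corner_rel[OF X Y] full_content_corner_rel[OF X Y] by (simp add: h_def)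
  next
    fix C assume C: "C \<in> corner f X Y // corner_rel f X Y"
    note r = rep_in_class[OF X Y C]
    show "int_scale (psi X Y C n) (h (rep C)) \<in> rad2"
    proof (cases "C \<in> Z_set f X Y")
      case False
      then have ne: "I_prod Y X \<noteq> {}" and sub: "I_prod Y X \<inter> corner f X Y \<subseteq> C"
        using C by (auto simp: Z_set_def split: if_splits)
      obtain a b where ab: "a \<in> I_ideal Y" "b \<in> I_ideal X" using ne by (auto simp: I_prod_def)
      have z: "proj X Y (a * b) \<in> I_prod Y X \<inter> corner f X Y"
        using ab by (intro proj_mult_I_prod X Y) (auto simp: I_ideal_def)
      then have rel: "(rep C, proj X Y (a * b)) \<in> corner_rel f X Y"
        using sub r(1) quotient_eq_iff[OF equiv_corner_rel[OF X Y] C C] by blast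
      have "\<not> full_content X Y (rep C)"
        using full_content_corner_rel[OF X Y rel] I_prod_content[of "proj X Y (a * b)" Y X] z by (auto simp: full_content_def)
      moreover have "?T (rep C) \<in> rad2"
      proof -
        have "proj X Y (a * b) \<in> I_prod Y X" using z by blast
        from subgrp_add[OF R theta_corner_rel[OF X Y rel] theta_I_prod[OF X Y this]] show ?thesis by simp
      qed
      ultimately show ?thesis by (simp add: h_def int_scale_simps subgrp_int_scale[OF R])
    next
      case True
      show ?thesis
      proof (cases "C \<in> arrow_classes X Y")
        case True
        then show ?thesis by (simp add: psi int_scale_simps subgrp_0[OF R])
      next
        case False
        then have c: "X \<subseteq> Y \<or> Y \<subseteq> X" and Cb: "C = base_class X Y"
          using True by (auto simp: arrow_classes_def split: if_splits)
        then have rel: "(f Y * f X, rep C) \<in> corner_rel f X Y"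
          using r(1) by (simp add: base_class_def)
        have "full_content X Y (rep C)" using full_content_corner_rel[OF X Y rel] full_content_ff[OF X Y c] by simp
        then have "h (rep C) = - (?T (f Y * f X) - ?T (rep C))" by (simp add: h_def int_scale_simps)
        also have "\<dots> \<in> rad2" by (rule subgrp_uminus[OF R theta_corner_rel[OF X Y rel]])
        finally show ?thesis by (rule subgrp_int_scale[OF R])
      qed
    qed
  qed
  moreover have "(\<Sum>s\<in>UNIV. int_scale (coef n s) (h (proj X Y s))) = e Y * gen (f Y) * n * gen (f X) * e X"
  proof -
    \<comment> \<open>The total weight of the correction is \<open>chi (X \<inter> Y) n\<close> if X
      and Y are comparable, and an empty count otherwise.\<close>
    have "(\<Sum>s\<in>UNIV. coef n s * of_bool (full_content X Y (proj X Y s))) = 0"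
    proof (cases "X \<subseteq> Y \<or> Y \<subseteq> X")
      case True
      then have XY: "X \<inter> Y \<in> Lam" using X Y by (metis inf.absorb1 inf.absorb2)
      have "(\<Sum>s\<in>UNIV. coef n s * of_bool (full_content X Y (proj X Y s))) = chi (X \<inter> Y) n"
        unfolding chi_expand full_content_proj_iff[OF X Y] using True by simp
      then show ?thesis using n XY by (simp add: rad_def)
    next
      case False
      then show ?thesis by (simp add: full_content_proj_iff[OF X Y])
    qed
    then have 0: "(\<Sum>s\<in>UNIV. int_scale (coef n s) (int_scale (of_bool (full_content X Y (proj X Y s))) (?T (f Y * f X)))) = 0"
      unfolding int_scale_simps(4) int_scale_sum_left by (simp add: int_scale_simps)
    have "(\<Sum>s\<in>UNIV. int_scale (coef n s) (h (proj X Y s))) = (\<Sum>s\<in>UNIV. int_scale (coef n s) (?T (proj X Y s)))"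
      using 0 by (simp add: h_def int_scale_simps(2) sum_subtractf)
    also have "\<dots> = (\<Sum>s\<in>UNIV. e Y * gen (f Y) * int_scale (coef n s) (gen s) * gen (f X) * e X)"
      by (simp add: proj_def int_scale_mult mult.assoc flip: gen_mult)
    also have "\<dots> = e Y * gen (f Y) * (\<Sum>s\<in>UNIV. int_scale (coef n s) (gen s)) * gen (f X) * e X"
      by (simp add: sum_distrib_left sum_distrib_right)
    finally show ?thesis by (simp only: salg_expand[symmetric])
  qed
  ultimately have 1: "e Y * gen (f Y) * n * gen (f X) * e X \<in> rad2" by simp
  \<comment> \<open>Inserting \<open>f Y\<close> and \<open>f X\<close> next to the idempotents
    costs only terms in \<open>rad2\<close>, because \<open>e Y - e Y * gen (f Y)\<close> and
    \<open>e X - gen (f X) * e X\<close> are in \<open>rad\<close>.\<close>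
  have "e Y - e Y * gen (f Y) \<in> rad"
    by (auto simp: rad_def chi_mult chi_e Y content_f)
  from mult_in_rad2[OF this rad_mult_right[OF n, of "e X"]]
  have 2: "(e Y - e Y * gen (f Y)) * (n * e X) \<in> rad2" .
  have "e X - gen (f X) * e X \<in> rad"
    by (auto simp: rad_def chi_mult chi_e X content_f)
  from mult_in_rad2[OF rad_mult_left[OF n, of "e Y * gen (f Y)"] this]
  have 3: "(e Y * gen (f Y) * n) * (e X - gen (f X) * e X) \<in> rad2" .
  have "e Y * n * e X = (e Y - e Y * gen (f Y)) * (n * e X) +
      (e Y * gen (f Y) * n) * (e X - gen (f X) * e X) + e Y * gen (f Y) * n * gen (f X) * e X"
    by (simp add: left_diff_distrib right_diff_distrib mult.assoc)
  then show ?thesis using subgrp_add[OF R subgrp_add[OF R 2 3] 1] by simp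
qed

end


section \<open>The quiver presentation\<close>

text \<open>Arcs are listed in the order of traversal while products compose from right to left, so
  the first arc gives the rightmost factor.\<close>

primrec path_value :: "('v \<Rightarrow> 'r::times) \<Rightarrow> ('e \<Rightarrow> 'r) \<Rightarrow> ('e \<Rightarrow> 'v) \<Rightarrow> 'v \<Rightarrow> 'e list \<Rightarrow> 'r" where
  "path_value e n h u [] = e u"
| "path_value e n h u (a # p) = path_value e n h (h a) p * n a"

locale quiver_of_semigroup = connected_semigroup f e
  for f :: "'a::{semigroup_mult,finite} set \<Rightarrow> 'a" and e +
  fixes Q :: "('a set, 'e) pre_digraph" and cl :: "'e \<Rightarrow> 'a set"
  assumes fin_Q: "fin_digraph Q" and verts_Q: "verts Q = Lam"
    and cl: "\<And>X Y. X \<in> Lam \<Longrightarrow> Y \<in> Lam \<Longrightarrow>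
      bij_betw cl {a \<in> arcs Q. tail Q a = X \<and> head Q a = Y} (arrow_classes X Y)"
begin

sublocale Q: fin_digraph Q by (rule fin_Q)

definition arrow_value :: "'e \<Rightarrow> 'a salg" where
  "arrow_value a = e (head Q a) * lift (tail Q a) (head Q a) (cl a) * e (tail Q a)"

abbreviation val :: "'a set \<Rightarrow> 'e list \<Rightarrow> 'a salg" where
  "val \<equiv> path_value e arrow_value (head Q)"

lemma ends_Lam: "a \<in> arcs Q \<Longrightarrow> tail Q a \<in> Lam \<and> head Q a \<in> Lam"
  using Q.tail_in_verts Q.head_in_verts verts_Q by auto

lemma cl_arrow_classes: "a \<in> arcs Q \<Longrightarrow> cl a \<in> arrow_classes (tail Q a) (head Q a)"
  using cl[of "tail Q a" "head Q a"] ends_Lam[of a] by (auto simp: bij_betw_def)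

lemma arrow_value_in_rad: "a \<in> arcs Q \<Longrightarrow> arrow_value a \<in> rad"
  unfolding arrow_value_def using ends_Lam[of a] arrow_classes_Z_set[OF cl_arrow_classes[of a]]
  by (intro rad_mult_left rad_mult_right lift_in_rad) auto

lemma arrow_value_e: "a \<in> arcs Q \<Longrightarrow> arrow_value a * e (tail Q a) = arrow_value a"
  using ends_Lam[of a] by (simp add: arrow_value_def mult.assoc e_orth)

lemma e_arrow_value: "a \<in> arcs Q \<Longrightarrow> e (head Q a) * arrow_value a = arrow_value a"
proof -
  assume "a \<in> arcs Q"
  then have "e (head Q a) * e (head Q a) = e (head Q a)" using ends_Lam[of a] by (simp add: e_orth)
  then show ?thesis by (simp add: arrow_value_def flip: mult.assoc)
qed

lemma val_e: "(u, p, v) \<in> paths Q \<Longrightarrow> val u p * e u = val u p"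
  by (cases p) (auto simp: Q.paths_Cons_iff verts_Q e_orth mult.assoc arrow_value_e)

lemma e_val: "(u, p, v) \<in> paths Q \<Longrightarrow> e v * val u p = val u p"
proof (induction p arbitrary: u)
  case (Cons a p)
  then show ?case by (simp add: Q.paths_Cons_iff flip: mult.assoc)
qed (simp add: verts_Q e_orth)

lemma val_append:
  "(u, q, w) \<in> paths Q \<Longrightarrow> (w, p, v) \<in> paths Q \<Longrightarrow> val u (q @ p) = val w p * val u q"
proof (induction q arbitrary: u)
  case (Cons a q)
  then show ?case by (simp add: Q.paths_Cons_iff mult.assoc)
qed (simp add: val_e)

lemma val_in_rad: "(u, p, v) \<in> paths Q \<Longrightarrow> p \<noteq> [] \<Longrightarrow> val u p \<in> rad"
  by (cases p) (auto simp: Q.paths_Cons_iff intro: rad_mult_left arrow_value_in_rad)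

lemma val_in_rad2:
  assumes "(u, p, v) \<in> paths Q" "2 \<le> length p"
  shows "val u p \<in> rad2"
proof -
  obtain a q where p: "p = a # q" "q \<noteq> []" using assms(2) by (cases p; cases "tl p") auto
  then have "val (head Q a) q \<in> rad" "arrow_value a \<in> rad"
    using assms(1) by (auto simp: Q.paths_Cons_iff intro: val_in_rad arrow_value_in_rad)
  then show ?thesis unfolding p(1) path_value.simps by (rule mult_in_rad2)
qed

text \<open>Right multiplication never raises the height; this covers the empty paths in
  \<open>val_in_fil\<close>.\<close>

lemma fil_0: "(a :: 'a salg) \<in> fil 0"
proof -
  have "x * a \<in> low i" if x: "x \<in> low i" for x i
  proof (rule low_mult_subgrp[OF x subgrp_low])
    fix s :: 'a assume s: "R_height s \<le> i"
    have "gen s * a = (\<Sum>t\<in>UNIV. int_scale (coef a t) (gen (s * t)))"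
      by (subst salg_expand[of a]) (simp add: sum_distrib_left int_scale_mult gen_mult)
    also have "\<dots> \<in> low i"
    proof (intro subgrp_sum[OF subgrp_low] subgrp_int_scale[OF subgrp_low] gen_low)
      fix t show "R_height (s * t) \<le> i" using R_height_mult_less[OF rt, of s t] s by (cases "s * t = s") auto
    qed
    finally show "gen s * a \<in> low i" .
  qed
  then show ?thesis by (simp add: fil_def)
qed

lemma val_in_fil: "(u, p, v) \<in> paths Q \<Longrightarrow> val u p \<in> fil (length p)"
proof (induction p arbitrary: u)
  case Nil
  then show ?case by (simp add: fil_0)
next
  case (Cons a p)
  then have "val (head Q a) p \<in> fil (length p)" "arrow_value a \<in> fil 1"
    using rad_subset_fil[OF rt] arrow_value_in_rad by (auto simp: Q.paths_Cons_iff)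
  from fil_mult[OF this] show ?case by simp
qed

text \<open>The left unit turns the vanishing of all products in \<open>fil_top\<close> into the
  vanishing of the element.\<close>

lemma fil_card_eq_0:
  assumes "(a :: 'a salg) \<in> fil n" "card (UNIV :: 'a set) \<le> n"
  shows "a = 0"
proof -
  have "a \<in> fil (card (UNIV :: 'a set))" using assms fil_mono by blast
  then have "(\<Sum>X\<in>Lam. e X) * a = 0" by (rule fil_top)
  then show ?thesis by (simp add: unit_left)
qed

section \<open>Evaluation of paths and surjectivity\<close>

definition pathmap :: "('a set, 'e) path \<Rightarrow> ('a \<Rightarrow>\<^sub>0 int)" where
  "pathmap p = pm_of_salg (val (fst p) (fst (snd p)))"

definition path_eval :: "(('a set, 'e) path \<Rightarrow>\<^sub>0 int) \<Rightarrow> 'a salg" where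
  "path_eval a = (\<Sum>p\<in>Poly_Mapping.keys a. int_scale (Poly_Mapping.lookup a p) (val (fst p) (fst (snd p))))"

lemma pm_of_salg_sum: "pm_of_salg (\<Sum>x\<in>A. g x) = (\<Sum>x\<in>A. pm_of_salg (g x))"
  by (induction A rule: infinite_finite_induct) (auto simp: zero_salg.rep_eq plus_salg.rep_eq)

lemma lin_ext_pathmap: "lin_ext pathmap a = pm_of_salg (path_eval a)"
  by (simp add: lin_ext_def path_eval_def pm_of_salg_sum int_scale.rep_eq pathmap_def)

lemma pathmap_mult:
  assumes "p \<in> paths Q" "q \<in> paths Q"
  shows "lin_ext pathmap (path_mult p q) = semigroup_mult_ext (pathmap p) (pathmap q)"
proof -
  obtain u p' v u' q' v' where p: "p = (u, p', v)" and q: "q = (u', q', v')" by (cases p, cases q)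
  have P: "(u, p', v) \<in> paths Q" "(u', q', v') \<in> paths Q" using assms p q by auto
  have "pm_of_salg (val u p' * val u' q') = semigroup_mult_ext (pathmap p) (pathmap q)"
    by (simp add: p q pathmap_def times_salg.rep_eq)
  moreover have "lin_ext pathmap (path_mult p q) = pm_of_salg (val u p' * val u' q')"
  proof (cases "u = v'")
    case True
    then show ?thesis using val_append[of u' q' u p' v] P by (simp add: p q pathmap_def)
  next
    case False
    have "val u p' * val u' q' = val u p' * e u * (e v' * val u' q')"
      using P by (simp add: val_e e_val)
    also have "\<dots> = val u p' * (e u * e v') * val u' q'" by (simp add: mult.assoc)
    also have "\<dots> = 0" using False P Q.paths_verts[OF P(1)] Q.paths_verts[OF P(2)] by (simp add: e_orth verts_Q)
    finally show ?thesis using False by (simp add: p q linear_pm_0[OF lin_ext_linear] zero_salg.rep_eq)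
  qed
  ultimately show ?thesis by simp
qed

definition path_image :: "'a salg set" where
  "path_image = {x. \<exists>a. Poly_Mapping.keys a \<subseteq> paths Q \<and> lin_ext pathmap a = pm_of_salg x}"

lemma subgrp_path_image: "subgrp path_image"
  unfolding subgrp_def
proof (intro conjI ballI)
  show "0 \<in> path_image"
    unfolding path_image_def by (rule CollectI, rule exI[of _ 0]) (simp add: linear_pm_0[OF lin_ext_linear] zero_salg.rep_eq)
  fix x y assume "x \<in> path_image" "y \<in> path_image"
  then obtain a b where "Poly_Mapping.keys a \<subseteq> paths Q" "lin_ext pathmap a = pm_of_salg x"
    "Poly_Mapping.keys b \<subseteq> paths Q" "lin_ext pathmap b = pm_of_salg y" by (auto simp: path_image_def)
  moreover have "Poly_Mapping.keys (a - b) \<subseteq> Poly_Mapping.keys a \<union> Poly_Mapping.keys b"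
    by (auto simp: in_keys_iff lookup_minus)
  ultimately show "x - y \<in> path_image"
    unfolding path_image_def
    by (intro CollectI exI[of _ "a - b"]) (auto simp: linear_pm_minus[OF lin_ext_linear] minus_salg.rep_eq)
qed

lemma path_image_mult:
  assumes "x \<in> path_image" "y \<in> path_image"
  shows "x * y \<in> path_image"
proof -
  interpret A: ring "path_algebra Q :: (int, _) module" by (rule Q.ring_path_algebra)
  obtain a b where a: "Poly_Mapping.keys a \<subseteq> paths Q" "lin_ext pathmap a = pm_of_salg x"
    and b: "Poly_Mapping.keys b \<subseteq> paths Q" "lin_ext pathmap b = pm_of_salg y"
    using assms by (auto simp: path_image_def)
  have "Poly_Mapping.keys (bilin_ext path_mult a b) \<subseteq> paths Q"
    using A.m_closed[of a b] a(1) b(1) by simp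
  moreover have "lin_ext pathmap (bilin_ext path_mult a b) = pm_of_salg (x * y)"
    unfolding times_salg.rep_eq a(2)[symmetric] b(2)[symmetric] semigroup_mult_ext_eq
    by (rule lin_ext_mult_hom, rule pathmap_mult[unfolded semigroup_mult_ext_eq]) (use a(1) b(1) in blast)+
  ultimately show ?thesis by (auto simp: path_image_def)
qed

lemma val_in_path_image: "(u, p, v) \<in> paths Q \<Longrightarrow> val u p \<in> path_image"
  unfolding path_image_def
  by (rule CollectI, rule exI[of _ "Poly_Mapping.single (u, p, v) 1"]) (simp add: pathmap_def)

lemma arrow_value_in_path_image:
  assumes "a \<in> arcs Q"
  shows "arrow_value a \<in> path_image"
proof -
  have "val (tail Q a) [a] \<in> path_image"
    by (rule val_in_path_image[of _ _ "head Q a"]) (use assms in \<open>simp add: Q.paths_Cons_iff\<close>)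
  then show ?thesis using assms by (simp add: e_arrow_value)
qed

text \<open>In each block the combination of lifts with the coordinates of n is subtracted. By
  duality the remainder has coordinates zero, so \<open>corner_in_rad2\<close> applies, and the unit
  reassembles n from its blocks.\<close>

lemma rad_mod_rad2:
  assumes n: "n \<in> rad"
  obtains r where "r \<in> path_image" "r \<in> rad" "n - r \<in> rad2"
proof -
  let ?m = "\<lambda>X Y. \<Sum>C\<in>arrow_classes X Y. int_scale (psi X Y C n) (lift X Y C)"
  let ?r = "\<lambda>X Y. e Y * ?m X Y * e X"
  have m: "?m X Y \<in> rad" if "X \<in> Lam" "Y \<in> Lam" for X Y
    using that arrow_classes_Z_set by (intro subgrp_sum[OF subgrp_rad] subgrp_int_scale[OF subgrp_rad] lift_in_rad) auto
  have r2: "e Y * n * e X - ?r X Y \<in> rad2" if X: "X \<in> Lam" and Y: "Y \<in> Lam" for X Y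
  proof -
    have "e Y * (n - ?m X Y) * e X \<in> rad2"
    proof (rule corner_in_rad2[OF X Y])
      show "n - ?m X Y \<in> rad" by (rule subgrp_diff[OF subgrp_rad n m[OF X Y]])
      fix D assume D: "D \<in> arrow_classes X Y"
      have "psi X Y D (?m X Y) = (\<Sum>C\<in>arrow_classes X Y. if D = C then psi X Y C n else 0)"
        unfolding psi_sum by (intro sum.cong refl) (simp add: psi_lift[OF X Y _ D])
      also have "\<dots> = psi X Y D n"
        using D by (subst sum.delta') (auto intro: finite_subset[of _ UNIV])
      finally show "psi X Y D (n - ?m X Y) = 0" by simp
    qed
    then show ?thesis by (simp add: left_diff_distrib right_diff_distrib)
  qed
  have ri: "?r X Y \<in> path_image" if X: "X \<in> Lam" and Y: "Y \<in> Lam" for X Y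
  proof -
    have "e Y * lift X Y C * e X \<in> path_image" if C: "C \<in> arrow_classes X Y" for C
    proof -
      have "C \<in> cl ` {a \<in> arcs Q. tail Q a = X \<and> head Q a = Y}"
        using cl[OF X Y] C by (simp add: bij_betw_def)
      then obtain a where "a \<in> arcs Q" "tail Q a = X" "head Q a = Y" "cl a = C" by auto
      then show ?thesis using arrow_value_in_path_image[of a] by (simp add: arrow_value_def)
    qed
    then have "(\<Sum>C\<in>arrow_classes X Y. int_scale (psi X Y C n) (e Y * lift X Y C * e X)) \<in> path_image"
      by (intro subgrp_sum[OF subgrp_path_image] subgrp_int_scale[OF subgrp_path_image])
    then show ?thesis by (simp add: sum_distrib_left sum_distrib_right int_scale_mult)
  qed
  let ?E = "\<Sum>X\<in>Lam. e X"
  have "n = ?E * n * ?E" by (simp add: unit_left unit_right)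
  also have "\<dots> = (\<Sum>Y\<in>Lam. \<Sum>X\<in>Lam. e Y * n * e X)"
    by (simp only: sum_distrib_right sum_distrib_left) (rule sum.swap)
  finally have n': "n = (\<Sum>Y\<in>Lam. \<Sum>X\<in>Lam. e Y * n * e X)" .
  show ?thesis
  proof (rule that)
    show "(\<Sum>Y\<in>Lam. \<Sum>X\<in>Lam. ?r X Y) \<in> path_image"
      by (intro subgrp_sum[OF subgrp_path_image] ri)
    show "(\<Sum>Y\<in>Lam. \<Sum>X\<in>Lam. ?r X Y) \<in> rad"
      by (intro subgrp_sum[OF subgrp_rad] rad_mult_left rad_mult_right m)
    have "(\<Sum>Y\<in>Lam. \<Sum>X\<in>Lam. e Y * n * e X - ?r X Y) \<in> rad2"
      by (intro subgrp_sum[OF subgrp_rad2] r2)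
    then show "n - (\<Sum>Y\<in>Lam. \<Sum>X\<in>Lam. ?r X Y) \<in> rad2"
      by (simp only: sum_subtractf n'[symmetric])
  qed
qed

text \<open>Successive approximation: for products, a b - r s = r (b - s) + (a - r) s + (a - r) (b -
  s), and each term gains a degree. Keeping the approximants r and s in \<open>rad\<close> supplies
  the degree 1 needed in the first two terms.\<close>

lemma rad_mod_fil: "n \<in> rad \<Longrightarrow> \<exists>r \<in> path_image \<inter> rad. n - r \<in> fil (Suc j)"
proof (induction j arbitrary: n)
  case 0
  then have "n \<in> fil (Suc 0)" using rad_subset_fil[OF rt] by auto
  then show ?case
    by (intro bexI[of _ 0]) (simp_all add: subgrp_0[OF subgrp_path_image] subgrp_0[OF subgrp_rad])
next
  case (Suc j)
  let ?H = "{x. \<exists>r \<in> path_image \<inter> rad. x - r \<in> fil (Suc (Suc j))}"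
  note I = subgrp_path_image and R = subgrp_rad[where 'a = 'a] and F = subgrp_fil[where 'a = 'a]
  have H: "subgrp ?H"
    unfolding subgrp_def
  proof (intro conjI ballI)
    show "0 \<in> ?H" using subgrp_0[OF I] subgrp_0[OF R] subgrp_0[OF F] by (auto intro!: bexI[of _ 0])
    fix x y assume "x \<in> ?H" "y \<in> ?H"
    then obtain r s where r: "r \<in> path_image" "r \<in> rad" "x - r \<in> fil (Suc (Suc j))"
      and s: "s \<in> path_image" "s \<in> rad" "y - s \<in> fil (Suc (Suc j))" by auto
    have "(x - y) - (r - s) = (x - r) - (y - s)" by simp
    then have "(x - y) - (r - s) \<in> fil (Suc (Suc j))" using subgrp_diff[OF F r(3) s(3)] by (simp only:)
    then show "x - y \<in> ?H"
      using subgrp_diff[OF I r(1) s(1)] subgrp_diff[OF R r(2) s(2)] by blast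
  qed
  have prod: "a * b \<in> ?H" if a: "a \<in> rad" and b: "b \<in> rad" for a b
  proof -
    obtain r where r: "r \<in> path_image" "r \<in> rad" "a - r \<in> fil (Suc j)" using Suc.IH[OF a] by auto
    obtain s where s: "s \<in> path_image" "s \<in> rad" "b - s \<in> fil (Suc j)" using Suc.IH[OF b] by auto
    have "r \<in> fil 1" "s \<in> fil 1" using rad_subset_fil[OF rt] r s by auto
    then have 1: "r * (b - s) \<in> fil (Suc (Suc j))" "(a - r) * s \<in> fil (Suc (Suc j))"
      using fil_mult[of r 1 "b - s" "Suc j"] fil_mult[of "a - r" "Suc j" s 1] r s by auto
    have 2: "(a - r) * (b - s) \<in> fil (Suc (Suc j))"
      using fil_mult[OF r(3) s(3)] fil_mono[of "Suc (Suc j)" "Suc j + Suc j"] by auto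
    have "a * b - r * s = r * (b - s) + (a - r) * s + (a - r) * (b - s)"
      by (simp add: algebra_simps)
    then have "a * b - r * s \<in> fil (Suc (Suc j))"
      using subgrp_add[OF F subgrp_add[OF F 1] 2] by (simp only:)
    then show ?thesis using path_image_mult[OF r(1) s(1)] rad_mult_left[OF s(2)] by blast
  qed
  obtain r where r: "r \<in> path_image" "r \<in> rad" "n - r \<in> rad2" using rad_mod_rad2[OF Suc.prems] by blast
  have "n - r \<in> ?H" by (rule rad2_induct[OF r(3) H prod])
  moreover have "r \<in> ?H" using r subgrp_0[OF F] by (auto intro!: bexI[of _ r])
  ultimately have "(n - r) + r \<in> ?H" by (rule subgrp_add[OF H])
  then show ?case by simp
qed

text \<open>On \<open>rad\<close> the approximation is exact beyond the size of the semigroup. A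
  general x is moved into \<open>rad\<close> by subtracting the combination of the
  \<open>e X\<close> with the same characters.\<close>

lemma path_image_eq_UNIV: "x \<in> path_image"
proof -
  have rad: "n \<in> path_image" if n: "n \<in> rad" for n
  proof -
    obtain r where r: "r \<in> path_image" "n - r \<in> fil (Suc (card (UNIV :: 'a set)))"
      using rad_mod_fil[OF n] by blast
    have "n - r = 0" by (rule fil_card_eq_0[OF r(2)]) simp
    then show ?thesis using r(1) by simp
  qed
  let ?y = "\<Sum>X\<in>Lam. int_scale (chi X x) (e X)"
  have "chi Z ?y = chi Z x" if "Z \<in> Lam" for Z
  proof -
    have "chi Z ?y = (\<Sum>X\<in>Lam. if Z = X then chi X x else 0)"
      unfolding chi_sum by (intro sum.cong refl) (simp add: chi_e that)
    then show ?thesis using that by (simp add: finite_Lam)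
  qed
  then have "x - ?y \<in> path_image" by (intro rad) (simp add: rad_def)
  moreover have "?y \<in> path_image"
  proof (intro subgrp_sum[OF subgrp_path_image] subgrp_int_scale[OF subgrp_path_image])
    fix X :: "'a set" assume "X \<in> Lam"
    then have "val X [] \<in> path_image" by (intro val_in_path_image[of _ _ X]) (simp add: verts_Q)
    then show "e X \<in> path_image" by simp
  qed
  ultimately have "(x - ?y) + ?y \<in> path_image" by (rule subgrp_add[OF subgrp_path_image])
  then show ?thesis by simp
qed

lemma presents_pathmap: "presents Q pathmap"
proof -
  have u: "(\<Sum>v\<in>verts Q. pathmap (v, [], v)) = pm_of_salg (\<Sum>X\<in>Lam. e X)"
    by (simp add: pathmap_def pm_of_salg_sum verts_Q)
  have "semigroup_mult_ext (pm_of_salg (\<Sum>X\<in>Lam. e X)) x = x \<and>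
      semigroup_mult_ext x (pm_of_salg (\<Sum>X\<in>Lam. e X)) = x" for x
  proof -
    have x: "x = pm_of_salg (salg_of_pm x)" by (simp add: salg_of_pm_inverse)
    show ?thesis
      by (subst (1 2 3 4) x) (simp only: times_salg.rep_eq[symmetric] unit_left unit_right simp_thms)
  qed
  moreover have "x \<in> lin_ext pathmap ` {a. Poly_Mapping.keys a \<subseteq> paths Q}" for x
  proof -
    obtain a where "Poly_Mapping.keys a \<subseteq> paths Q" "lin_ext pathmap a = pm_of_salg (salg_of_pm x)"
      using path_image_eq_UNIV[of "salg_of_pm x"] by (auto simp: path_image_def)
    then show ?thesis by (intro image_eqI[of _ _ a]) (simp_all add: salg_of_pm_inverse)
  qed
  ultimately show ?thesis
    unfolding presents_def u using pathmap_mult by blast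
qed

section \<open>The kernel of the evaluation\<close>

lemma psi_rad2:
  assumes "X \<in> Lam" "Y \<in> Lam" "D \<in> Z_set f X Y" "x \<in> rad2"
  shows "psi X Y D x = 0"
proof -
  have "x \<in> {x. psi X Y D x = 0}"
  proof (rule rad2_induct[OF assms(4)])
    show "subgrp {x. psi X Y D x = 0}" by (simp add: subgrp_def)
    show "a * b \<in> {x. psi X Y D x = 0}" if "a \<in> rad" "b \<in> rad" for a b
      using that assms(2) by (simp add: psi_mult_left[OF assms(1-3)] rad_def)
  qed
  then show ?thesis by simp
qed

text \<open>Duality of arrows and coordinates: \<open>psi_e\<close> separates different pairs of
  vertices, \<open>psi_lift\<close> different classes at the same pair, and \<open>cl\<close> is
  injective there.\<close>

lemma psi_arrow_value:
  assumes a: "a \<in> arcs Q" and b: "b \<in> arcs Q"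
  shows "psi (tail Q b) (head Q b) (cl b) (arrow_value a) = of_bool (a = b)"
proof -
  note B = ends_Lam[OF b] and A = ends_Lam[OF a]
  have "psi (tail Q b) (head Q b) (cl b) (arrow_value a) = (if tail Q a = tail Q b \<and> head Q a = head Q b
      then psi (tail Q b) (head Q b) (cl b) (lift (tail Q a) (head Q a) (cl a)) else 0)"
    unfolding arrow_value_def using A B arrow_classes_Z_set cl_arrow_classes a b
    by (intro psi_e lift_in_rad) auto
  also have "\<dots> = of_bool (a = b)"
  proof (cases "tail Q a = tail Q b \<and> head Q a = head Q b")
    case True
    then have "cl a = cl b \<longleftrightarrow> a = b"
      using cl[of "tail Q b" "head Q b"] B a b by (auto simp: bij_betw_def inj_on_def)
    moreover have "psi (tail Q b) (head Q b) (cl b) (lift (tail Q b) (head Q b) (cl a)) = of_bool (cl a = cl b)"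
      using B True cl_arrow_classes[OF a] cl_arrow_classes[OF b] by (intro psi_lift) auto
    ultimately show ?thesis using True by simp
  qed auto
  finally show ?thesis .
qed

text \<open>Coefficients of short paths are read off by functionals. \<open>chi x\<close> isolates
  the empty path at x, since all nonempty paths have values in \<open>rad\<close>; then
  \<open>psi\<close> isolates an arrow, since paths of length at least 2 have values in
  \<open>rad2\<close>.\<close>

lemma kernel_length:
  assumes a: "Poly_Mapping.keys a \<subseteq> paths Q" and 0: "lin_ext pathmap a = 0"
    and p: "(u, p, v) \<in> Poly_Mapping.keys a"
  shows "2 \<le> length p"
proof -
  let ?K = "Poly_Mapping.keys a" and ?c = "Poly_Mapping.lookup a"
  have "path_eval a = 0"
    using 0 unfolding lin_ext_pathmap by (metis pm_of_salg_inject zero_salg.rep_eq)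
  then have z: "(\<Sum>p\<in>?K. int_scale (?c p) (val (fst p) (fst (snd p)))) = 0" by (simp add: path_eval_def)
  have no_vertex: "q \<noteq> []" if q: "(x, q, y) \<in> ?K" for x q y
  proof
    assume "q = []"
    then have xy: "(x, [], x) \<in> ?K" "x \<in> Lam" using q a by (auto simp: verts_Q)
    have "0 = chi x (\<Sum>p\<in>?K. int_scale (?c p) (val (fst p) (fst (snd p))))" unfolding z by simp
    also have "\<dots> = (\<Sum>p\<in>?K. if p = (x, [], x) then ?c p else 0)"
      unfolding chi_sum
    proof (rule sum.cong[OF refl])
      fix p assume p: "p \<in> ?K"
      obtain u r w where puw: "p = (u, r, w)" by (cases p)
      have P: "(u, r, w) \<in> paths Q" using p a puw by auto
      show "chi x (int_scale (?c p) (val (fst p) (fst (snd p)))) = (if p = (x, [], x) then ?c p else 0)"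
      proof (cases "r = []")
        case True
        then show ?thesis using P xy(2) by (auto simp: puw verts_Q chi_e)
      next
        case False
        then have "chi x (val u r) = 0" using val_in_rad[OF P] xy(2) by (simp add: rad_def)
        then show ?thesis using False by (simp add: puw)
      qed
    qed
    also have "\<dots> = ?c (x, [], x)" using xy(1) by simp
    finally show False using xy(1) by (simp add: in_keys_iff)
  qed
  show ?thesis
  proof (rule ccontr)
    assume "\<not> 2 \<le> length p"
    then obtain b where pb: "p = [b]" using no_vertex[OF p] by (cases p; cases "tl p") auto
    then have b: "b \<in> arcs Q" "u = tail Q b" "v = head Q b"
      using p a by (auto simp: Q.paths_Cons_iff)
    note B = ends_Lam[OF b(1)]
    let ?psi = "psi (tail Q b) (head Q b) (cl b)"
    have "0 = ?psi (\<Sum>p\<in>?K. int_scale (?c p) (val (fst p) (fst (snd p))))" unfolding z by simp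
    also have "\<dots> = (\<Sum>p\<in>?K. if p = (tail Q b, [b], head Q b) then ?c p else 0)"
      unfolding psi_sum
    proof (rule sum.cong[OF refl])
      fix q assume q: "q \<in> ?K"
      obtain x r y where xry: "q = (x, r, y)" by (cases q)
      have P: "(x, r, y) \<in> paths Q" using q a xry by auto
      have ne: "r \<noteq> []" using no_vertex q xry by blast
      show "?psi (int_scale (?c q) (val (fst q) (fst (snd q)))) = (if q = (tail Q b, [b], head Q b) then ?c q else 0)"
      proof (cases "2 \<le> length r")
        case True
        then have "?psi (val x r) = 0"
          using B arrow_classes_Z_set[OF cl_arrow_classes[OF b(1)]] by (intro psi_rad2 val_in_rad2[OF P]) auto
        then show ?thesis using True by (auto simp: xry)
      next
        case False
        then obtain d where d: "r = [d]" using ne by (cases r; cases "tl r") auto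
        then have D: "d \<in> arcs Q" "x = tail Q d" "y = head Q d" using P by (auto simp: Q.paths_Cons_iff)
        show ?thesis
          using psi_arrow_value[OF D(1) b(1)] by (auto simp: xry d D e_arrow_value[OF D(1)])
      qed
    qed
    also have "\<dots> = ?c (tail Q b, [b], head Q b)" using p pb b by simp
    finally show False using p pb b by (simp add: in_keys_iff)
  qed
qed

lemma admissible_pathmap: "admissible Q (path_kernel Q pathmap)"
  unfolding admissible_def
proof (intro conjI)
  show "ideal (path_kernel Q pathmap) (path_algebra Q)"
    by (rule Q.ideal_path_kernel[OF presents_pathmap])
  show "projective_module (quotient_algebra (path_algebra Q) (path_kernel Q pathmap))"
    by (rule projective_module_if_algebra_isomorphic[OF Q.algebra_isomorphic_path_kernel[OF presents_pathmap]])
  show "path_kernel Q pathmap \<subseteq> ideal_power (path_algebra Q) (arrow_ideal Q) 2"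
    unfolding Q.ideal_power_arrow_ideal path_kernel_def using kernel_length by auto
  \<comment> \<open>Admissibility asks for an exponent of at least 2; paths at least as long as the
    size of the semigroup have value zero.\<close>
  let ?n = "max 2 (card (UNIV :: 'a set))"
  show "\<exists>n\<ge>2. ideal_power (path_algebra Q) (arrow_ideal Q) n \<subseteq> path_kernel Q pathmap"
  proof (intro exI[of _ ?n] conjI subsetI)
    fix x :: "('a set, 'e) path \<Rightarrow>\<^sub>0 int"
    assume "x \<in> ideal_power (path_algebra Q) (arrow_ideal Q) ?n"
    then have x: "Poly_Mapping.keys x \<subseteq> {(u, p, v) \<in> paths Q. ?n \<le> length p}"
      unfolding Q.ideal_power_arrow_ideal by simp
    have "pathmap p = 0" if "p \<in> Poly_Mapping.keys x" for p
    proof -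
      obtain u q v where p: "p = (u, q, v)" by (cases p)
      have "(u, q, v) \<in> paths Q" "card (UNIV :: 'a set) \<le> length q" using that x p by auto
      then have "val u q = 0" using fil_card_eq_0[OF val_in_fil] by blast
      then show ?thesis by (simp add: p pathmap_def zero_salg.rep_eq)
    qed
    then have "lin_ext pathmap x = 0" by (simp add: lin_ext_def)
    then show "x \<in> path_kernel Q pathmap" using x by (auto simp: path_kernel_def)
  qed simp
qed

end

lemma quiver_presentation_exists:
  fixes f :: "'a::{semigroup_mult,finite} set \<Rightarrow> 'a" and Q :: "('a set, 'e) pre_digraph"
  assumes conn: "connected_R_trivial TYPE('a)"
    and f: "\<And>X. X \<in> Lam \<Longrightarrow> is_idempotent (f X) \<and> left_ideal (f X) = X"
    and Q: "is_quiver_of f Q"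
  shows "\<exists>I :: (('a set, 'e) path \<Rightarrow>\<^sub>0 int) set. admissible Q I \<and>
    algebra_isomorphic (semigroup_algebra :: (int, 'a \<Rightarrow>\<^sub>0 int) module) (quotient_algebra (path_algebra Q) I)"
proof -
  obtain e :: "'a set \<Rightarrow> 'a salg" where e:
    "\<And>X Y. X \<in> Lam \<Longrightarrow> Y \<in> Lam \<Longrightarrow> e X * e Y = (if X = Y then e X else 0)"
    "\<And>X Z. X \<in> Lam \<Longrightarrow> Z \<in> Lam \<Longrightarrow> chi Z (e X) = of_bool (Z = X)"
    "\<And>a. (\<Sum>X\<in>Lam. e X) * a = a" "\<And>a. a * (\<Sum>X\<in>Lam. e X) = a"
    using unital_orthogonal_idempotents[OF conn] by blast
  interpret connected_semigroup f e
    using conn f e by unfold_locales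
  interpret fin_digraph Q using Q by (simp add: is_quiver_of_def)
  let ?arcs = "\<lambda>X Y. {a \<in> arcs Q. tail Q a = X \<and> head Q a = Y}"
  have ex: "\<exists>h. bij_betw h (?arcs X Y) (arrow_classes X Y)" if X: "X \<in> Lam" and Y: "Y \<in> Lam" for X Y
  proof (rule finite_same_card_bij)
    show "finite (?arcs X Y)" by simp
    show "finite (arrow_classes X Y)" by (rule finite_subset[of _ UNIV]) auto
    have "int (card (?arcs X Y)) = int (card (arrow_classes X Y))"
      unfolding card_arrow_classes[OF X Y] using Q X Y by (simp add: is_quiver_of_def)
    then show "card (?arcs X Y) = card (arrow_classes X Y)" by simp
  qed
  \<comment> \<open>The hypothesis on the quiver only equates cardinalities. A bijection is chosen
    for each pair of vertices, and the choices are glued along the endpoints of arrows into one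
    labelling.\<close>
  define h where "h X Y = (SOME h. bij_betw h (?arcs X Y) (arrow_classes X Y))" for X Y
  have h: "bij_betw (h X Y) (?arcs X Y) (arrow_classes X Y)" if "X \<in> Lam" "Y \<in> Lam" for X Y
    unfolding h_def by (rule someI_ex[OF ex[OF that]])
  interpret quiver_of_semigroup f e Q "\<lambda>a. h (tail Q a) (head Q a) a"
  proof
    show "verts Q = Lam" using Q by (simp add: is_quiver_of_def)
    fix X Y :: "'a set" assume "X \<in> Lam" "Y \<in> Lam"
    from h[OF this] show "bij_betw (\<lambda>a. h (tail Q a) (head Q a) a) (?arcs X Y) (arrow_classes X Y)"
      by (rule iffD1[OF bij_betw_cong, rotated]) simp
  qed
  show ?thesis
    using admissible_pathmap algebra_isomorphic_path_kernel[OF presents_pathmap] by blast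
qed

theorem theorem5p9:
  fixes f :: "'a::{semigroup_mult,finite} set \<Rightarrow> 'a"
    and Q :: "('a set, 'e) pre_digraph"
  assumes "connected_R_trivial TYPE('a)"
    and "\<And>X. X \<in> Lam \<Longrightarrow> is_idempotent (f X) \<and> left_ideal (f X) = X"
    and "is_quiver_of f Q"
  shows
    "(\<exists>I :: (('a set, 'e) path \<Rightarrow>\<^sub>0 int) set.
        admissible Q I \<and>
        algebra_isomorphic
          (semigroup_algebra :: (int, 'a \<Rightarrow>\<^sub>0 int) module)
          (quotient_algebra (path_algebra Q) I)) \<and>
     (\<forall>I :: (('a set, 'e) path \<Rightarrow>\<^sub>0 int) set.
        admissible Q I \<and>
        algebra_isomorphic
          (semigroup_algebra :: (int, 'a \<Rightarrow>\<^sub>0 int) module)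
          (quotient_algebra (path_algebra Q) I) \<longrightarrow>
        algebra_isomorphic
          (semigroup_algebra :: ('k::field, 'a \<Rightarrow>\<^sub>0 'k) module)
          (quotient_algebra (path_algebra Q) (extend_scalars I)) \<and>
        admissible Q (extend_scalars I :: (('a set, 'e) path \<Rightarrow>\<^sub>0 'k) set))"
proof (intro conjI allI impI; (elim conjE)?)
  show "\<exists>I :: (('a set, 'e) path \<Rightarrow>\<^sub>0 int) set. admissible Q I \<and>
      algebra_isomorphic (semigroup_algebra :: (int, 'a \<Rightarrow>\<^sub>0 int) module) (quotient_algebra (path_algebra Q) I)"
    using assms by (rule quiver_presentation_exists)
next
  interpret fin_digraph Q using assms(3) by (simp add: is_quiver_of_def)
  fix I :: "(('a set, 'e) path \<Rightarrow>\<^sub>0 int) set"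
  assume I: "admissible Q I"
    "algebra_isomorphic (semigroup_algebra :: (int, 'a \<Rightarrow>\<^sub>0 int) module) (quotient_algebra (path_algebra Q) I)"
  show "algebra_isomorphic (semigroup_algebra :: ('k, 'a \<Rightarrow>\<^sub>0 'k) module)
      (quotient_algebra (path_algebra Q) (extend_scalars I))"
    by (rule admissible_base_change(1)[OF I])
  show "admissible Q (extend_scalars I :: (('a set, 'e) path \<Rightarrow>\<^sub>0 'k) set)"
    by (rule admissible_base_change(2)[OF I])
qed

end
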